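(* Transversal gates on error-detecting stabilizer codes must be in the Clifford hierarchy. Precisely: let $r\ge1$ and consider $r$ codeblocks, the $b$-th being a stabilizer code on $m$-dimensional qudits with a partition $\{Q_i^{(b)}\}_i$ of its qudits into disjoint non-empty subsets, such that every codeblock is error-detecting with respect to its partition, i.e. has min-distance $d_\downarrow^{(b)}>1$. Treat the $r$ codeblocks as one stabilizer code, and let $\{Q_i\}$ be a partition of all the qudits in which each $Q_i$ is a union of subsets $Q^{(b)}_{j}$ containing at most one subset from each codeblock $b$. Then every logical operator of this combined code that is transversal with respect to $\{Q_i\}$ belongs to a finite level $\overline C_M$ of the Clifford hierarchy of the logical Pauli group.
   Context: Fix a qudit dimension $m\ge2$, $\omega_m=e^{2\pi i/m}$, $X=\sum_{l}|l\oplus1\rangle\langle l|$ (addition mod $m$), $Z=\sum_l\omega_m^l|l\rangle\langle l|$. $\mathcal P_n$ is the group generated by the single-qudit $X$'s and $Z$'s on $n$ qudits (for $m=2$ one may also include $Y=iXZ$ among the generators). The group commutator is $[A,B]=ABA^\dagger B^\dagger$. Stabilizer code: an $\llbracket n,k\rrbracket$ code ($k\ge1$) is given by a group $\mathcal S=\langle s_1,\dots,s_{n-k}\rangle\subseteq\mathcal P_n$ of mutually commuting Paulis with $|\mathcal S|=m^{n-k}$; its code space $\mathcal C\subseteq(\mathbb C^m)^{\otimes n}$ is the simultaneous $+1$ eigenspace of $\mathcal S$, of dimension $m^k$. A logical operator is a unitary on $(\mathbb C^m)^{\otimes n}$ mapping $\mathcal C$ to $\mathcal C$. Logical Pauli generators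 $\bar X_i,\bar Z_i\in\mathcal P_n$ ($1\le i\le k$) commute with $\mathcal S$ and satisfy $[\bar X_i,\bar Z_j]=\omega_m^{-\delta_{ij}}I$, $[\bar X_i,\bar X_j]=[\bar Z_i,\bar Z_j]=I$. The set of non-trivial logical Paulis is the set of cosets $\mathcal L=\{\mathcal S\prod_{i=1}^k\bar X_i^{a_i}\bar Z_i^{a_{i+k}}:a\in\{0,\dots,m-1\}^{2k}\setminus\{0\}\}$. Given a partition of the qudits into disjoint non-empty subsets $Q_1,\dots,Q_N$: a unitary $U$ is transversal if $U=\bigotimes_{i=1}^NU_i$ with $U_i$ acting only on the qudits of $Q_i$; $\mathrm{supp}(U)\subseteq[N]$ is the set of $i$ such that $U$ acts non-trivially (not as a scalar multiple of the identity) on $Q_i$. The min-distance is $d_\downarrow=\min_{G\in\mathcal L}\min_{g\in G}|\mathrm{supp}(g)|$; the code is error-detecting iff $d_\downarrow>1$. Combining $r$ codeblocks with parameters $\llbracket n_b,k_b\rrbracket$ gives the stabilizer code $\llbracket\sum_bn_b,\sum_bk_b\rrbracket$ whose stabilizer group is the product of those of the blocks and whose code space is the tensor product of the code spaces. Clifford hierarchy: for a Pauli group $\mathcal P$, $C_1(\mathcal P)=\mathcal P$ and $C_M(\mathcal P)=\{U \text{ unitary}:[U,p]\in C_{M-1}(\mathcal P)\ \forall p\in\mathcal P\}$, where unitaries are considered up to global phase. $\overline C_M$ is this hierarchy for the logical Pauli group: a logical operator is in $\overline C_M$ if the unitary it induces on the code space (identified with a tensor product of logical qudits via the logical $\bar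 X_i,\bar Z_i$) lies in the $M$-th level up to global phase. *)

theory Defs
  imports Complex_Main "HOL-Library.Disjoint_Sets" "HOL-Library.FuncSet" "HOL-Library.Function_Algebras"
    "HOL-Algebra.Coset" "HOL-Algebra.Generated_Groups"
begin

section \<open>Vectors and operators on qudits\<close>

text \<open>
  Qudits are labelled by the elements of a finite set \<open>A\<close>. The computational basis of
  \<open>(\<complex>\<^sup>m)\<^sup>\<otimes>\<^sup>A\<close> is indexed by the configurations \<open>A \<rightarrow>\<^sub>E {..<m}\<close>; vectors and matrices are
  functions on configurations that vanish outside of them (so that equality of
  operators is equality of functions).
\<close>

type_synonym 'q conf = "'q \<Rightarrow> nat"
type_synonym 'q vect = "'q conf \<Rightarrow> complex"
type_synonym ('p, 'q) cmatrix = "'p conf \<Rightarrow> 'q conf \<Rightarrow> complex"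
type_synonym 'q operator = "('q, 'q) cmatrix"

definition confs :: "nat \<Rightarrow> 'q set \<Rightarrow> 'q conf set" where
  "confs m A = A \<rightarrow>\<^sub>E {..<m}"

definition vects :: "nat \<Rightarrow> 'q set \<Rightarrow> 'q vect set" where
  "vects m A = {v. \<forall>x. v x \<noteq> 0 \<longrightarrow> x \<in> confs m A}"

definition matrices :: "nat \<Rightarrow> 'p set \<Rightarrow> 'q set \<Rightarrow> ('p, 'q) cmatrix set" where
  "matrices m A B = {M. \<forall>x y. M x y \<noteq> 0 \<longrightarrow> x \<in> confs m A \<and> y \<in> confs m B}"

text \<open>In \<open>mat_mul m B M N\<close> and \<open>mat_app m B M v\<close>, the set \<open>B\<close> labels the qudits that are
  contracted, i.e.\ the columns of \<open>M\<close>.\<close>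

definition mat_mul :: "nat \<Rightarrow> 'q set \<Rightarrow> ('p, 'q) cmatrix \<Rightarrow> ('q, 's) cmatrix \<Rightarrow> ('p, 's) cmatrix" where
  "mat_mul m B M N = (\<lambda>x y. \<Sum>z\<in>confs m B. M x z * N z y)"

definition mat_app :: "nat \<Rightarrow> 'q set \<Rightarrow> ('p, 'q) cmatrix \<Rightarrow> 'q vect \<Rightarrow> 'p vect" where
  "mat_app m B M v = (\<lambda>x. \<Sum>z\<in>confs m B. M x z * v z)"

definition mat_scale :: "complex \<Rightarrow> ('p, 'q) cmatrix \<Rightarrow> ('p, 'q) cmatrix" where
  "mat_scale c M = (\<lambda>x y. c * M x y)"

definition dagger :: "('p, 'q) cmatrix \<Rightarrow> ('q, 'p) cmatrix" where
  "dagger M = (\<lambda>x y. cnj (M y x))"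

definition ident :: "nat \<Rightarrow> 'q set \<Rightarrow> 'q operator" where
  "ident m A = (\<lambda>x y. if x = y \<and> x \<in> confs m A then 1 else 0)"

definition unitary_op :: "nat \<Rightarrow> 'q set \<Rightarrow> 'q operator \<Rightarrow> bool" where
  "unitary_op m A U \<longleftrightarrow> U \<in> matrices m A A \<and>
     mat_mul m A U (dagger U) = ident m A \<and> mat_mul m A (dagger U) U = ident m A"

definition unitary_group :: "nat \<Rightarrow> 'q set \<Rightarrow> 'q operator monoid" where
  "unitary_group m A =
     \<lparr>carrier = {U. unitary_op m A U}, monoid.mult = mat_mul m A, one = ident m A\<rparr>"

definition commutator :: "nat \<Rightarrow> 'q set \<Rightarrow> 'q operator \<Rightarrow> 'q operator \<Rightarrow> 'q operator" where
  "commutator m A U V =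
     mat_mul m A (mat_mul m A (mat_mul m A U V) (dagger U)) (dagger V)"

text \<open>The tensor product of operators \<open>U R\<close> on the qudits in \<open>R\<close>, where the disjoint
  sets \<open>R \<in> P\<close> cover \<open>A\<close>.\<close>

definition tensor :: "nat \<Rightarrow> 'q set \<Rightarrow> 'q set set \<Rightarrow> ('q set \<Rightarrow> 'q operator) \<Rightarrow> 'q operator" where
  "tensor m A P U = (\<lambda>x y. if x \<in> confs m A \<and> y \<in> confs m A
     then \<Prod>R\<in>P. U R (restrict x R) (restrict y R) else 0)"

text \<open>The tensor product of operators \<open>U b\<close> on \<open>A b\<close>, \<open>b < r\<close>, where qudit \<open>q\<close> of the
  \<open>b\<close>-th factor becomes qudit \<open>(b, q)\<close> of the product.\<close>

definition block_tensor ::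
  "nat \<Rightarrow> nat \<Rightarrow> (nat \<Rightarrow> 'q set) \<Rightarrow> (nat \<Rightarrow> 'q operator) \<Rightarrow> (nat \<times> 'q) operator" where
  "block_tensor m r A U = (\<lambda>x y.
     if x \<in> confs m (Sigma {..<r} A) \<and> y \<in> confs m (Sigma {..<r} A)
     then \<Prod>b<r. U b (\<lambda>q\<in>A b. x (b, q)) (\<lambda>q\<in>A b. y (b, q)) else 0)"

interpretation cfun: vector_space "\<lambda>(c::complex) (v::'a \<Rightarrow> complex) x. c * v x"
  by unfold_locales (auto simp: fun_eq_iff algebra_simps)


section \<open>Pauli group and Clifford hierarchy\<close>

definition omega :: "nat \<Rightarrow> complex" where
  "omega m = exp (2 * of_real pi * \<i> / of_nat m)"

definition pauli_X :: "nat \<Rightarrow> 'q set \<Rightarrow> 'q \<Rightarrow> 'q operator" where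
  "pauli_X m A q = (\<lambda>x y. if y \<in> confs m A \<and> x = y(q := (y q + 1) mod m) then 1 else 0)"

definition pauli_Z :: "nat \<Rightarrow> 'q set \<Rightarrow> 'q \<Rightarrow> 'q operator" where
  "pauli_Z m A q = (\<lambda>x y. if x = y \<and> x \<in> confs m A then omega m ^ x q else 0)"

text \<open>For \<open>m = 2\<close>, \<open>Y = \<i>XZ\<close> is included among the generators; this only enlarges the class
  of codes, since every code over the group generated by \<open>X\<close> and \<open>Z\<close> is also one over the
  larger group.\<close>

definition pauli_group :: "nat \<Rightarrow> 'q set \<Rightarrow> 'q operator set" where
  "pauli_group m A = generate (unitary_group m A)
     (pauli_X m A ` A \<union> pauli_Z m A ` A \<union>
      (if m = 2 then (\<lambda>q. mat_scale \<i> (mat_mul m A (pauli_X m A q) (pauli_Z m A q))) ` A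
       else {}))"

text \<open>Level \<open>M \<ge> 1\<close> of the hierarchy over a group \<open>P\<close> of operators on \<open>A\<close>; level \<open>0\<close> is
  a dummy. Unitaries are taken up to global phase: level \<open>1\<close> is closed under phases explicitly,
  the higher levels because the commutator does not depend on the phase of \<open>U\<close>.\<close>

fun clifford :: "nat \<Rightarrow> 'q set \<Rightarrow> 'q operator set \<Rightarrow> nat \<Rightarrow> 'q operator set" where
  "clifford m A P 0 = {}"
| "clifford m A P (Suc 0) = {mat_scale c p | c p. cmod c = 1 \<and> p \<in> P}"
| "clifford m A P (Suc (Suc M)) =
     {U. unitary_op m A U \<and> (\<forall>p\<in>P. commutator m A U p \<in> clifford m A P (Suc M))}"


section \<open>Stabilizer codes\<close>

text \<open>The list \<open>logicals\<close> contains the labels of the \<open>k\<close> logical qudits (in the order in which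
  products over the logical qudits are formed), and \<open>log_X i\<close>, \<open>log_Z i\<close> are the logical Pauli
  generators of the logical qudit \<open>i\<close>.\<close>

record ('q, 'l) stab_code =
  qudits :: "'q set"
  stab :: "'q operator set"
  logicals :: "'l list"
  log_X :: "'l \<Rightarrow> 'q operator"
  log_Z :: "'l \<Rightarrow> 'q operator"

definition code_space :: "nat \<Rightarrow> ('q, 'l) stab_code \<Rightarrow> 'q vect set" where
  "code_space m C =
     {v \<in> vects m (qudits C). \<forall>s\<in>stab C. mat_app m (qudits C) s v = v}"

definition stabilizer_code :: "nat \<Rightarrow> ('q, 'l) stab_code \<Rightarrow> bool" where
  "stabilizer_code m C \<longleftrightarrow>
    (let A = qudits C; n = card A; k = length (logicals C); L = set (logicals C) in
      finite A \<and> 1 \<le> k \<and> k \<le> n \<and>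
      (\<exists>gs. length gs = n - k \<and> set gs \<subseteq> pauli_group m A \<and>
            stab C = generate (unitary_group m A) (set gs)) \<and>
      (\<forall>s\<in>stab C. \<forall>t\<in>stab C. mat_mul m A s t = mat_mul m A t s) \<and>
      card (stab C) = m ^ (n - k) \<and>
      cfun.dim (code_space m C) = m ^ k \<and>
      distinct (logicals C) \<and>
      (\<forall>i\<in>L. log_X C i \<in> pauli_group m A \<and> log_Z C i \<in> pauli_group m A) \<and>
      (\<forall>i\<in>L. \<forall>s\<in>stab C. mat_mul m A (log_X C i) s = mat_mul m A s (log_X C i) \<and>
                     mat_mul m A (log_Z C i) s = mat_mul m A s (log_Z C i)) \<and>
      (\<forall>i\<in>L. \<forall>j\<in>L.
         commutator m A (log_X C i) (log_Z C j) =
           mat_scale (if i = j then inverse (omega m) else 1) (ident m A) \<and>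
         commutator m A (log_X C i) (log_X C j) = ident m A \<and>
         commutator m A (log_Z C i) (log_Z C j) = ident m A))"

definition logical_monomial ::
  "nat \<Rightarrow> ('q, 'l) stab_code \<Rightarrow> ('l \<Rightarrow> nat) \<Rightarrow> ('l \<Rightarrow> nat) \<Rightarrow> 'q operator" where
  "logical_monomial m C a a' =
     (let G = unitary_group m (qudits C) in
      foldr (\<lambda>i p. ((log_X C i [^]\<^bsub>G\<^esub> a i) \<otimes>\<^bsub>G\<^esub> (log_Z C i [^]\<^bsub>G\<^esub> a' i)) \<otimes>\<^bsub>G\<^esub> p)
        (logicals C) \<one>\<^bsub>G\<^esub>)"

definition nontrivial_logical_paulis :: "nat \<Rightarrow> ('q, 'l) stab_code \<Rightarrow> 'q operator set set" where
  "nontrivial_logical_paulis m C =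
     {stab C #>\<^bsub>unitary_group m (qudits C)\<^esub> logical_monomial m C a a' | a a'.
        a \<in> set (logicals C) \<rightarrow>\<^sub>E {..<m} \<and> a' \<in> set (logicals C) \<rightarrow>\<^sub>E {..<m} \<and>
        (\<exists>i\<in>set (logicals C). a i \<noteq> 0 \<or> a' i \<noteq> 0)}"


section \<open>Transversality, support and distance\<close>

definition transversal :: "nat \<Rightarrow> 'q set \<Rightarrow> 'q set set \<Rightarrow> 'q operator \<Rightarrow> bool" where
  "transversal m A P U \<longleftrightarrow> unitary_op m A U \<and>
     (\<exists>V. (\<forall>R\<in>P. unitary_op m R (V R)) \<and> U = tensor m A P V)"

definition acts_as_scalar :: "nat \<Rightarrow> 'q set \<Rightarrow> 'q set \<Rightarrow> 'q operator \<Rightarrow> bool" where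
  "acts_as_scalar m A R U \<longleftrightarrow>
     (\<exists>c V. V \<in> matrices m (A - R) (A - R) \<and>
        U = tensor m A {R, A - R} (\<lambda>T. if T = R then mat_scale c (ident m R) else V))"

definition supp :: "nat \<Rightarrow> 'q set \<Rightarrow> 'q set set \<Rightarrow> 'q operator \<Rightarrow> 'q set set" where
  "supp m A P U = {R\<in>P. \<not> acts_as_scalar m A R U}"

text \<open>The infima are over non-empty sets of natural numbers, hence minima.\<close>

definition min_distance :: "nat \<Rightarrow> ('q, 'l) stab_code \<Rightarrow> 'q set set \<Rightarrow> nat" where
  "min_distance m C P =
     (INF G\<in>nontrivial_logical_paulis m C. INF g\<in>G. card (supp m (qudits C) P g))"

definition error_detecting :: "nat \<Rightarrow> ('q, 'l) stab_code \<Rightarrow> 'q set set \<Rightarrow> bool" where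
  "error_detecting m C P \<longleftrightarrow> min_distance m C P > 1"


section \<open>Logical operators\<close>

definition logical_operator :: "nat \<Rightarrow> ('q, 'l) stab_code \<Rightarrow> 'q operator \<Rightarrow> bool" where
  "logical_operator m C U \<longleftrightarrow> unitary_op m (qudits C) U \<and>
     mat_app m (qudits C) U ` code_space m C \<subseteq> code_space m C"

text \<open>
  An identification of \<open>k\<close> logical qudits with the code space: an isometry \<open>E\<close> from
  \<open>(\<complex>\<^sup>m)\<^sup>\<otimes>\<^sup>k\<close> onto the code space that turns the Paulis \<open>X\<^sub>i\<close>, \<open>Z\<^sub>i\<close> of the logical qudits into
  the logical generators. Phases must be allowed here, as the \<open>m\<close>-th powers of the logical
  generators may be scalars other than \<open>1\<close> (e.g.\ if \<open>XZ\<close> is a logical generator for \<open>m = 2\<close>).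
  Two such \<open>E\<close> differ by a Pauli operator on the logical qudits and a phase, so the level of an
  operator in the Clifford hierarchy does not depend on the choice of \<open>E\<close>.
\<close>

definition encoding :: "nat \<Rightarrow> ('q, 'l) stab_code \<Rightarrow> ('q, 'l) cmatrix \<Rightarrow> bool" where
  "encoding m C E \<longleftrightarrow>
    (let A = qudits C; L = set (logicals C) in
      E \<in> matrices m A L \<and>
      mat_mul m A (dagger E) E = ident m L \<and>
      mat_app m L E ` vects m L = code_space m C \<and>
      (\<forall>i\<in>L. \<exists>c. cmod c = 1 \<and>
         mat_mul m A (log_X C i) E = mat_scale c (mat_mul m L E (pauli_X m L i))) \<and>
      (\<forall>i\<in>L. \<exists>c. cmod c = 1 \<and>
         mat_mul m A (log_Z C i) E = mat_scale c (mat_mul m L E (pauli_Z m L i))))"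

definition induced :: "nat \<Rightarrow> ('q, 'l) stab_code \<Rightarrow> ('q, 'l) cmatrix \<Rightarrow> 'q operator \<Rightarrow> 'l operator" where
  "induced m C E U = mat_mul m (qudits C) (dagger E) (mat_mul m (qudits C) U E)"

definition logical_clifford :: "nat \<Rightarrow> ('q, 'l) stab_code \<Rightarrow> nat \<Rightarrow> 'q operator set" where
  "logical_clifford m C M = {U. logical_operator m C U \<and>
     (\<exists>E. encoding m C E \<and>
        induced m C E U
          \<in> clifford m (set (logicals C)) (pauli_group m (set (logicals C))) M)}"


section \<open>Several codeblocks as one code\<close>

definition combine :: "nat \<Rightarrow> nat \<Rightarrow> (nat \<Rightarrow> ('q, 'l) stab_code) \<Rightarrow> (nat \<times> 'q, nat \<times> 'l) stab_code" where
  "combine m r C =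
    (let A = (\<lambda>b. qudits (C b));
         on_block = (\<lambda>b U. block_tensor m r A (\<lambda>b'. if b' = b then U else ident m (A b')))
     in \<lparr>qudits = Sigma {..<r} A,
         stab = {block_tensor m r A s | s. \<forall>b<r. s b \<in> stab (C b)},
         logicals = concat (map (\<lambda>b. map (Pair b) (logicals (C b))) [0..<r]),
         log_X = (\<lambda>(b, i). on_block b (log_X (C b) i)),
         log_Z = (\<lambda>(b, i). on_block b (log_Z (C b) i))\<rparr>)"

end

(* A transversal operator that is trivial on the parts in F has a commutator with a Pauli P trivial
   on a part R that is trivial on the parts in F and on R. It therefore suffices that every logical
   Pauli of the combined code has a representative trivial on R ("cleaning"): then, after as many
   commutators as there are parts, only a phase is left.

   Cleaning works block by block and, since m need not be prime, by Fourier analysis on Z_m^(2n). Let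
   T be a part of an error-detecting block. Counting shows that the Paulis commuting with the
   stabilizer S are, up to phases, exactly the products of stabilizers and logical Paulis, so error
   detection says that a Pauli on T commuting with S commutes with every logical Pauli p. Summing the
   commutation character of g with s p over all s in S and all Paulis g on T then gives a positive
   number; but for fixed s the sum over g vanishes unless s p is trivial on T. *)

theory Submission
  imports Defs
begin

section \<open>Matrix algebra\<close>

text \<open>The hierarchy concerns the induced logical unitary, whereas triviality on a part is
  visible only on physical operators. The relation \<open>implements\<close> links the two:
  \<open>U E = c E u\<close> for a fixed encoding \<open>E\<close> and a phase \<open>c\<close>. It
  passes to products, adjoints and hence commutators. It does not see stabilizers, since
  \<open>s E = E\<close>; so a cleaned representative can stand for any logical Pauli. This requires
  an actual encoding. It is built from a joint eigenvector of the logical Z's, and comparing traces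
  of projections shows that it fills the code space. The counting is done modulo phases. It works
  because a scalar in the stabilizer group fixes a nonzero code vector and is therefore 1, so
  distinct stabilizers stay distinct modulo phases. Each level of the hierarchy quantifies over all
  logical Paulis \<open>p\<close>. The part to be trivialized is fixed first and serves every
  \<open>p\<close>; only the representative depends on \<open>p\<close>. Each part thus costs one
  level, and the final phase times the identity sits in level 1.\<close>

declare cfun.scale_scale [simp del] \<comment> \<open>it undoes \<open>mult.assoc\<close> under a \<open>\<lambda>\<close>\<close>

lemma finite_confs [simp]: "finite A \<Longrightarrow> finite (confs m A)"
  unfolding confs_def by (intro finite_PiE) auto

lemma card_confs: "finite A \<Longrightarrow> card (confs m A) = m ^ card A"
  unfolding confs_def by (simp add: card_PiE)

lemma mat_mul_assoc:
  "mat_mul m C (mat_mul m B M N) K = mat_mul m B M (mat_mul m C N K)"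
proof (intro ext)
  fix x y
  have "(\<Sum>z\<in>confs m C. \<Sum>w\<in>confs m B. M x w * N w z * K z y) =
        (\<Sum>w\<in>confs m B. \<Sum>z\<in>confs m C. M x w * N w z * K z y)"
    by (rule sum.swap)
  then show "mat_mul m C (mat_mul m B M N) K x y = mat_mul m B M (mat_mul m C N K) x y"
    unfolding mat_mul_def by (simp add: sum_distrib_left sum_distrib_right mult.assoc)
qed

lemma mat_app_mul: "mat_app m C (mat_mul m B M N) v = mat_app m B M (mat_app m C N v)"
proof (intro ext)
  fix x
  have "(\<Sum>z\<in>confs m C. \<Sum>w\<in>confs m B. M x w * N w z * v z) =
        (\<Sum>w\<in>confs m B. \<Sum>z\<in>confs m C. M x w * N w z * v z)"
    by (rule sum.swap)
  then show "mat_app m C (mat_mul m B M N) v x = mat_app m B M (mat_app m C N v) x"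
    unfolding mat_mul_def mat_app_def by (simp add: sum_distrib_left sum_distrib_right mult.assoc)
qed

lemma matrices_0: "M \<in> matrices m A B \<Longrightarrow> x \<notin> confs m A \<or> y \<notin> confs m B \<Longrightarrow> M x y = 0"
  unfolding matrices_def by auto

lemma ident_mul:
  assumes "finite A" "M \<in> matrices m A B"
  shows "mat_mul m A (ident m A) M = M"
proof (intro ext)
  fix x y
  have "(\<Sum>z\<in>confs m A. ident m A x z * M z y) =
        (\<Sum>z\<in>confs m A. if z = x then M z y else 0)"
    by (rule sum.cong) (auto simp: ident_def)
  also have "\<dots> = M x y"
    using assms by (auto simp: matrices_0)
  finally show "mat_mul m A (ident m A) M x y = M x y"
    unfolding mat_mul_def .
qed

lemma mul_ident:
  assumes "finite B" "M \<in> matrices m A B"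
  shows "mat_mul m B M (ident m B) = M"
proof (intro ext)
  fix x y
  have "(\<Sum>z\<in>confs m B. M x z * ident m B z y) =
        (\<Sum>z\<in>confs m B. if z = y then M x z else 0)"
    by (rule sum.cong) (auto simp: ident_def)
  also have "\<dots> = M x y"
    using assms by (auto simp: matrices_0)
  finally show "mat_mul m B M (ident m B) x y = M x y"
    unfolding mat_mul_def .
qed

text \<open>One of the two label sets of \<open>M\<close> occurs only in a premise of
  \<open>ident_mul\<close> and \<open>mul_ident\<close>, where the simplifier cannot determine it;
  for square matrices the conclusion fixes it.\<close>

lemmas ident_mul_square [simp] = ident_mul [where B = A and A = A for A]
lemmas mul_ident_square [simp] = mul_ident [where B = A and A = A for A]

lemma ident_app [simp]:
  assumes "finite A" "v \<in> vects m A"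
  shows "mat_app m A (ident m A) v = v"
proof (intro ext)
  fix x
  have "(\<Sum>z\<in>confs m A. ident m A x z * v z) =
        (\<Sum>z\<in>confs m A. if z = x then v z else 0)"
    by (rule sum.cong) (auto simp: ident_def)
  also have "\<dots> = v x"
    using assms by (auto simp: vects_def)
  finally show "mat_app m A (ident m A) v x = v x"
    unfolding mat_app_def .
qed

lemma mat_mul_in_matrices [intro]:
  assumes "M \<in> matrices m A B" "N \<in> matrices m B' D"
  shows "mat_mul m E M N \<in> matrices m A D"
  unfolding matrices_def mat_mul_def
proof (clarify, intro conjI)
  fix x y assume "(\<Sum>z\<in>confs m E. M x z * N z y) \<noteq> 0"
  then obtain z where z: "M x z * N z y \<noteq> 0" by (meson sum.neutral)
  show "x \<in> confs m A" using z assms unfolding matrices_def by auto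
  show "y \<in> confs m D" using z assms unfolding matrices_def by auto
qed

lemma mat_app_in_vects [intro]:
  assumes "M \<in> matrices m A B"
  shows "mat_app m D M v \<in> vects m A"
  unfolding vects_def mat_app_def
proof (clarify)
  fix x assume "(\<Sum>z\<in>confs m D. M x z * v z) \<noteq> 0"
  then obtain z where z: "M x z * v z \<noteq> 0" by (meson sum.neutral)
  then show "x \<in> confs m A" using assms unfolding matrices_def by auto
qed

lemmas mat_mul_in_matrices_square [simp] =
  mat_mul_in_matrices [where A = A and B = A and B' = A and D = A for A]
lemmas mat_app_in_vects_square [simp] = mat_app_in_vects [where A = A and B = A for A]

lemma dagger_in_matrices [intro, simp]: "M \<in> matrices m A B \<Longrightarrow> dagger M \<in> matrices m B A"
  unfolding matrices_def dagger_def by auto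

lemma scale_in_matrices [intro, simp]: "M \<in> matrices m A B \<Longrightarrow> mat_scale c M \<in> matrices m A B"
  unfolding matrices_def mat_scale_def by auto

lemma ident_in_matrices [intro, simp]: "ident m A \<in> matrices m A A"
  unfolding matrices_def ident_def by auto

lemma dagger_mul: "dagger (mat_mul m B M N) = mat_mul m B (dagger N) (dagger M)"
  unfolding dagger_def mat_mul_def by (simp add: mult.commute)

lemma dagger_dagger [simp]: "dagger (dagger M) = M"
  unfolding dagger_def by simp

lemma dagger_ident [simp]: "dagger (ident m A) = ident m A"
  unfolding dagger_def ident_def by (intro ext) auto

lemma dagger_scale: "dagger (mat_scale c M) = mat_scale (cnj c) (dagger M)"
  unfolding dagger_def mat_scale_def by simp

lemma mul_scale_left [simp]: "mat_mul m B (mat_scale c M) N = mat_scale c (mat_mul m B M N)"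
  unfolding mat_scale_def mat_mul_def by (simp add: sum_distrib_left mult.assoc)

lemma mul_scale_right [simp]: "mat_mul m B M (mat_scale c N) = mat_scale c (mat_mul m B M N)"
  unfolding mat_scale_def mat_mul_def by (simp add: sum_distrib_left mult.left_commute)

lemma mat_scale_scale [simp]: "mat_scale c (mat_scale d M) = mat_scale (c * d) M"
  unfolding mat_scale_def by (simp add: mult.assoc)

lemma mat_scale_1 [simp]: "mat_scale 1 M = M"
  unfolding mat_scale_def by simp

lemma scale_app: "mat_app m B (mat_scale c M) v = (\<lambda>x. c * mat_app m B M v x)"
  unfolding mat_scale_def mat_app_def by (simp add: sum_distrib_left mult.assoc)

lemma app_scale: "mat_app m B M (\<lambda>x. c * v x) = (\<lambda>x. c * mat_app m B M v x)"
  unfolding mat_app_def by (simp add: sum_distrib_left mult.left_commute)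

lemma app_zero [simp]: "mat_app m B M (\<lambda>x. 0) = (\<lambda>x. 0)"
  unfolding mat_app_def by simp

lemma cnj_mult_eq_1 [simp]: "cmod c = 1 \<Longrightarrow> c * cnj c = 1" "cmod c = 1 \<Longrightarrow> cnj c * c = 1"
  by (metis complex_norm_square mult.commute of_real_1 power_one)+

lemma unitary_in_matrices [simp]: "unitary_op m A U \<Longrightarrow> U \<in> matrices m A A"
  unfolding unitary_op_def by simp

lemma unitary_mul_dagger [simp]: "unitary_op m A U \<Longrightarrow> mat_mul m A U (dagger U) = ident m A"
  and unitary_dagger_mul [simp]: "unitary_op m A U \<Longrightarrow> mat_mul m A (dagger U) U = ident m A"
  unfolding unitary_op_def by simp_all

text \<open>\<open>M\<close> may be rectangular because the rule is also applied to encodings, whose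
  columns are logical configurations.\<close>

lemma unitary_dagger_mul_cancel:
  assumes "finite A" "unitary_op m A U" "M \<in> matrices m A B"
  shows "mat_mul m A (dagger U) (mat_mul m A U M) = M"
  using assms by (simp add: ident_mul flip: mat_mul_assoc)

lemma unitary_mul_dagger_cancel:
  assumes "finite A" "unitary_op m A U" "M \<in> matrices m A B"
  shows "mat_mul m A U (mat_mul m A (dagger U) M) = M"
  using assms by (simp add: ident_mul flip: mat_mul_assoc)

lemma unitary_ident [simp]: "finite A \<Longrightarrow> unitary_op m A (ident m A)"
  unfolding unitary_op_def by simp

lemma unitary_dagger [intro, simp]: "unitary_op m A U \<Longrightarrow> unitary_op m A (dagger U)"
  unfolding unitary_op_def by simp

lemma unitary_scale [intro]: "unitary_op m A U \<Longrightarrow> cmod c = 1 \<Longrightarrow> unitary_op m A (mat_scale c U)"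
  unfolding unitary_op_def by (simp add: dagger_scale)

lemma unitary_mul [intro]:
  assumes "finite A" "unitary_op m A U" "unitary_op m A V"
  shows "unitary_op m A (mat_mul m A U V)"
proof -
  have "mat_mul m A (mat_mul m A U V) (dagger (mat_mul m A U V)) = ident m A"
    unfolding dagger_mul mat_mul_assoc
    using assms by (simp add: unitary_mul_dagger_cancel [where B = A])
  moreover have "mat_mul m A (dagger (mat_mul m A U V)) (mat_mul m A U V) = ident m A"
    unfolding dagger_mul mat_mul_assoc
    using assms by (simp add: unitary_dagger_mul_cancel [where B = A])
  ultimately show ?thesis
    using assms unfolding unitary_op_def by auto
qed

lemma unitary_commutator:
  assumes "finite A" "unitary_op m A U" "unitary_op m A V"
  shows "unitary_op m A (commutator m A U V)"
  unfolding commutator_def using assms by (intro unitary_mul unitary_dagger)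

lemma commutator_eq_scaleD:
  assumes "finite A" "unitary_op m A U" "unitary_op m A V"
    and "commutator m A U V = mat_scale c (ident m A)"
  shows "mat_mul m A U V = mat_scale c (mat_mul m A V U)"
proof -
  have "mat_mul m A (commutator m A U V) (mat_mul m A V U) = mat_mul m A U V"
    unfolding commutator_def mat_mul_assoc
    using assms(1-3) by (simp add: unitary_dagger_mul_cancel [where B = A])
  moreover have "mat_mul m A (mat_scale c (ident m A)) (mat_mul m A V U) =
      mat_scale c (mat_mul m A V U)"
    using assms(1-3) by auto
  ultimately show ?thesis using assms(4) by simp
qed

lemma carrier_unitary_group [simp]: "carrier (unitary_group m A) = {U. unitary_op m A U}"
  and mult_unitary_group [simp]: "monoid.mult (unitary_group m A) = mat_mul m A"
  and one_unitary_group [simp]: "monoid.one (unitary_group m A) = ident m A"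
  unfolding unitary_group_def by simp_all

lemma group_unitary_group [intro]: "finite A \<Longrightarrow> group (unitary_group m A)"
  by (rule groupI) (auto simp: mat_mul_assoc Bex_def intro: unitary_dagger unitary_dagger_mul)

lemma inv_unitary_group [simp]:
  assumes "finite A" "unitary_op m A U"
  shows "m_inv (unitary_group m A) U = dagger U"
  by (rule group.inv_equality) (use assms in auto)

section \<open>Traces and orthogonal projections\<close>

definition mat_trace :: "nat \<Rightarrow> 'q set \<Rightarrow> 'q operator \<Rightarrow> complex" where
  "mat_trace m A M = (\<Sum>x\<in>confs m A. M x x)"

lemma mat_trace_mul_commute:
  "mat_trace m A (mat_mul m B M N) = mat_trace m B (mat_mul m A N M)"
  unfolding mat_trace_def mat_mul_def by (subst sum.swap) (simp add: mult.commute)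

lemma mat_trace_ident: "finite A \<Longrightarrow> mat_trace m A (ident m A) = of_nat (m ^ card A)"
  unfolding mat_trace_def ident_def by (simp add: card_confs)

text \<open>For an orthogonal projection the trace is the squared Hilbert-Schmidt norm.\<close>

lemma projection_trace_0:
  assumes "finite A" "D \<in> matrices m A A" "dagger D = D" "mat_mul m A D D = D"
    and "mat_trace m A D = 0"
  shows "D = (\<lambda>x y. 0)"
proof (intro ext)
  fix x y
  have herm: "D v u = cnj (D u v)" for u v
    using assms(3) unfolding dagger_def fun_eq_iff by (metis complex_cnj_cnj)
  have "(\<Sum>u\<in>confs m A. \<Sum>v\<in>confs m A. D u v * D v u) = 0"
    using assms(5) by (subst (asm) assms(4) [symmetric]) (simp add: mat_trace_def mat_mul_def)
  also have "(\<Sum>u\<in>confs m A. \<Sum>v\<in>confs m A. D u v * D v u) =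
      of_real (\<Sum>u\<in>confs m A. \<Sum>v\<in>confs m A. (cmod (D u v))\<^sup>2)"
    unfolding of_real_sum
    by (intro sum.cong refl) (subst (2) herm, simp only: complex_norm_square)
  finally have "(\<Sum>u\<in>confs m A. \<Sum>v\<in>confs m A. (cmod (D u v))\<^sup>2) = 0"
    using of_real_eq_0_iff by blast
  then have "\<forall>u\<in>confs m A. \<forall>v\<in>confs m A. D u v = 0"
    using assms(1) by (simp add: sum_nonneg_eq_0_iff sum_nonneg)
  then show "D x y = 0"
    using assms(2) matrices_0 by blast
qed

lemma mat_mul_diff_left: "mat_mul m B (\<lambda>x y. M x y - M' x y) N = (\<lambda>x y. mat_mul m B M N x y - mat_mul m B M' N x y)"
  and mat_mul_diff_right: "mat_mul m B M (\<lambda>x y. N x y - N' x y) = (\<lambda>x y. mat_mul m B M N x y - mat_mul m B M N' x y)"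
  unfolding mat_mul_def by (simp_all add: algebra_simps sum_subtractf)

text \<open>Taking adjoints in \<open>P R = R\<close> gives \<open>R P = R\<close>, so
  \<open>P - R\<close> is again an orthogonal projection, and its trace vanishes. Comparing traces
  takes the place of rank and dimension arguments below.\<close>

lemma projection_eqI:
  assumes "finite A" "P \<in> matrices m A A" "R \<in> matrices m A A"
    and "dagger P = P" "mat_mul m A P P = P" "dagger R = R" "mat_mul m A R R = R"
    and "mat_mul m A P R = R" and "mat_trace m A P = mat_trace m A R"
  shows "P = R"
proof -
  let ?D = "\<lambda>x y. P x y - R x y"
  have RP: "mat_mul m A R P = R"
    using arg_cong [OF assms(8), of dagger] by (simp add: dagger_mul assms(4,6))
  have "?D = (\<lambda>x y. 0)"
  proof (rule projection_trace_0 [OF assms(1)])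
    show "?D \<in> matrices m A A"
      unfolding matrices_def
    proof clarify
      fix x y assume "P x y - R x y \<noteq> 0"
      then have "P x y \<noteq> 0 \<or> R x y \<noteq> 0" by auto
      then show "x \<in> confs m A \<and> y \<in> confs m A"
        using assms(2,3) unfolding matrices_def by blast
    qed
    show "dagger ?D = ?D"
      using assms(4,6) unfolding dagger_def by (auto simp: fun_eq_iff)
    show "mat_mul m A ?D ?D = ?D"
      by (simp add: mat_mul_diff_left mat_mul_diff_right assms(5,7,8) RP)
    show "mat_trace m A ?D = 0"
      using assms(9) unfolding mat_trace_def by (simp add: sum_subtractf)
  qed
  then show ?thesis by (simp add: fun_eq_iff)
qed

text \<open>The product of \<open>M\<close> and its adjoint, in this order, is a projection below
  the identity, and by cyclicity it has the trace of the identity.\<close>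

lemma isometry_unitary:
  assumes "finite A" "M \<in> matrices m A A" "mat_mul m A (dagger M) M = ident m A"
  shows "unitary_op m A M"
proof -
  have "ident m A = mat_mul m A M (dagger M)"
  proof (rule projection_eqI [OF assms(1)])
    show "mat_mul m A (mat_mul m A M (dagger M)) (mat_mul m A M (dagger M)) = mat_mul m A M (dagger M)"
      by (simp add: mat_mul_assoc)
        (metis assms ident_mul dagger_in_matrices mat_mul_assoc)
    show "mat_trace m A (ident m A) = mat_trace m A (mat_mul m A M (dagger M))"
      by (subst mat_trace_mul_commute) (simp add: assms(3))
  qed (use assms in \<open>auto simp: dagger_mul\<close>)
  then show ?thesis
    using assms unfolding unitary_op_def by simp
qed

section \<open>Weyl operators\<close>

lemma omega_cis: "omega m = cis (2 * pi / real m)"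
  unfolding omega_def cis_conv_exp by (simp add: mult_ac)

lemma cmod_omega [simp]: "cmod (omega m) = 1"
  by (simp add: omega_cis)

lemma omega_nonzero [simp]: "omega m \<noteq> 0"
  unfolding omega_def by simp

lemma omega_power_m: "0 < m \<Longrightarrow> omega m ^ m = 1"
  by (simp add: omega_cis DeMoivre)

lemma omega_power_mod: "0 < m \<Longrightarrow> omega m ^ (k mod m) = omega m ^ k"
  by (metis mod_mult_div_eq mult_1_right omega_power_m power_add power_mult power_one)

lemma omega_power_cong: "0 < m \<Longrightarrow> k mod m = l mod m \<Longrightarrow> omega m ^ k = omega m ^ l"
  by (metis omega_power_mod)

text \<open>The root is primitive because \<open>cos x = 1\<close> only at integer multiples of
  \<open>2 * pi\<close>.\<close>

lemma omega_power_eq_1_iff: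
  assumes "0 < m"
  shows "omega m ^ k = 1 \<longleftrightarrow> m dvd k"
proof
  assume "m dvd k"
  then show "omega m ^ k = 1"
    using assms by (auto simp: power_mult omega_power_m)
next
  assume "omega m ^ k = 1"
  then have "cos (real k * (2 * pi / real m)) = 1"
    by (simp add: omega_cis DeMoivre complex_eq_iff)
  then obtain n :: int where "real k * (2 * pi / real m) = of_int n * 2 * pi"
    by (auto simp: cos_one_2pi_int)
  then have "real k = of_int n * real m"
    using assms by (simp add: field_simps)
  then have "int k = n * int m"
    by (metis of_int_eq_iff of_int_mult of_int_of_nat_eq)
  then show "m dvd k"
    by (metis dvd_triv_right int_dvd_int_iff)
qed

lemma omega_power_inj:
  assumes "omega m ^ x = omega m ^ y" "x < m" "y < m"
  shows "x = y"
proof -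
  have "x = y" if xy: "omega m ^ x = omega m ^ y" "x \<le> y" "y < m" for x y
  proof -
    define k where "k = y - x"
    have y: "y = x + k" using xy by (simp add: k_def)
    have "omega m ^ k = 1" using xy(1) unfolding y power_add by simp
    then have "m dvd k" using xy(3) by (simp add: omega_power_eq_1_iff)
    moreover have "k < m" using xy y by simp
    ultimately have "k = 0" using nat_dvd_not_less by blast
    then show ?thesis using y by simp
  qed
  then show ?thesis using assms by (metis nat_le_linear)
qed

text \<open>A geometric series whose ratio differs from 1 unless \<open>m dvd j\<close>.\<close>

lemma sum_omega_power:
  assumes "0 < m"
  shows "(\<Sum>t<m. omega m ^ (j * t)) = (if m dvd j then of_nat m else 0)"
proof (cases "m dvd j")
  case True
  then have "omega m ^ (j * t) = 1" for t
    using assms by (subst omega_power_eq_1_iff) auto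
  then show ?thesis using True by simp
next
  case False
  then have "omega m ^ j \<noteq> 1" using assms by (simp add: omega_power_eq_1_iff)
  then show ?thesis
    using False assms geometric_sum [of "omega m ^ j" m] omega_power_eq_1_iff [of m "j * m"]
    by (simp flip: power_mult)
qed

text \<open>This is \<open>X^a Z^b\<close>, qudit by qudit, with \<open>Z\<close> acting first. The
  exponents are unreduced naturals, so that products simply add them; only their residues on
  \<open>A\<close> matter.\<close>

definition weyl :: "nat \<Rightarrow> 'q set \<Rightarrow> ('q \<Rightarrow> nat) \<Rightarrow> ('q \<Rightarrow> nat) \<Rightarrow> 'q operator" where
  "weyl m A a b = (\<lambda>x y. if x \<in> confs m A \<and> y \<in> confs m A
     then \<Prod>q\<in>A. if x q = (y q + a q) mod m then omega m ^ (b q * y q) else 0 else 0)"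

lemma weyl_in_matrices [simp]: "weyl m A a b \<in> matrices m A A"
  unfolding weyl_def matrices_def by auto

lemma weyl_cong:
  assumes "0 < m" "\<And>q. q \<in> A \<Longrightarrow> a q mod m = a' q mod m" "\<And>q. q \<in> A \<Longrightarrow> b q mod m = b' q mod m"
  shows "weyl m A a b = weyl m A a' b'"
proof -
  have "(if s = (t + a q) mod m then omega m ^ (b q * t) else 0) =
        (if s = (t + a' q) mod m then omega m ^ (b' q * t) else 0)" if "q \<in> A" for q s t
  proof -
    have "(t + a q) mod m = (t + a' q) mod m"
      by (rule mod_add_cong) (simp_all add: assms that)
    moreover have "(b q * t) mod m = (b' q * t) mod m"
      by (rule mod_mult_cong) (simp_all add: assms that)
    then have "omega m ^ (b q * t) = omega m ^ (b' q * t)"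
      by (rule omega_power_cong [OF assms(1)])
    ultimately show ?thesis by simp
  qed
  then show ?thesis
    unfolding weyl_def by (intro ext if_cong [OF refl _ refl] prod.cong refl) blast
qed

lemma weyl_mod:
  assumes "0 < m"
  shows "weyl m A a b = weyl m A (\<lambda>q\<in>A. a q mod m) (\<lambda>q\<in>A. b q mod m)"
  by (rule weyl_cong [OF assms]) auto

text \<open>Both factors are products over the qudits, so the contraction splits into one sum per
  qudit. Each such sum has at most one nonzero term, and moving \<open>Z^b\<close> past
  \<open>X^a'\<close> leaves the phase.\<close>

lemma weyl_mul:
  assumes "finite A" "0 < m"
  shows "mat_mul m A (weyl m A a b) (weyl m A a' b') =
    mat_scale (omega m ^ (\<Sum>q\<in>A. b q * a' q)) (weyl m A (\<lambda>q. a q + a' q) (\<lambda>q. b q + b' q))"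
proof (intro ext)
  fix x y
  let ?f = "\<lambda>q s t. if s = (t + a q) mod m then omega m ^ (b q * t) else 0"
  let ?g = "\<lambda>q s t. if s = (t + a' q) mod m then omega m ^ (b' q * t) else 0"
  let ?h = "\<lambda>q s t. if s = (t + (a q + a' q)) mod m then omega m ^ ((b q + b' q) * t) else 0"
  show "mat_mul m A (weyl m A a b) (weyl m A a' b') x y =
    mat_scale (omega m ^ (\<Sum>q\<in>A. b q * a' q)) (weyl m A (\<lambda>q. a q + a' q) (\<lambda>q. b q + b' q)) x y"
  proof (cases "x \<in> confs m A \<and> y \<in> confs m A")
    case True
    have "mat_mul m A (weyl m A a b) (weyl m A a' b') x y =
        (\<Sum>z\<in>confs m A. \<Prod>q\<in>A. ?f q (x q) (z q) * ?g q (z q) (y q))"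
      unfolding mat_mul_def weyl_def using True by (intro sum.cong refl) (simp add: prod.distrib)
    also have "\<dots> = (\<Prod>q\<in>A. \<Sum>t\<in>{..<m}. ?f q (x q) t * ?g q t (y q))"
      unfolding confs_def using assms(1) by (subst prod_sum_PiE) auto
    also have "\<dots> = (\<Prod>q\<in>A. omega m ^ (b q * a' q) * ?h q (x q) (y q))"
    proof (rule prod.cong [OF refl])
      fix q assume "q \<in> A"
      let ?t = "(y q + a' q) mod m"
      have "(\<Sum>t\<in>{..<m}. ?f q (x q) t * ?g q t (y q)) =
          (\<Sum>t\<in>{..<m}. if t = ?t then ?f q (x q) ?t * omega m ^ (b' q * y q) else 0)"
        by (intro sum.cong refl) auto
      also have "\<dots> = ?f q (x q) ?t * omega m ^ (b' q * y q)"
        using assms(2) by simp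
      also have "\<dots> = omega m ^ (b q * a' q) * ?h q (x q) (y q)"
      proof -
        have "(?t + a q) mod m = (y q + (a q + a' q)) mod m"
          by (simp add: mod_simps algebra_simps)
        moreover have "omega m ^ (b q * ?t) = omega m ^ (b q * (y q + a' q))"
          by (rule omega_power_cong [OF assms(2)]) (simp add: mod_simps)
        ultimately show ?thesis
          by (simp add: algebra_simps flip: power_add)
      qed
      finally show "(\<Sum>t\<in>{..<m}. ?f q (x q) t * ?g q t (y q)) =
        omega m ^ (b q * a' q) * ?h q (x q) (y q)" .
    qed
    also have "\<dots> = mat_scale (omega m ^ (\<Sum>q\<in>A. b q * a' q))
        (weyl m A (\<lambda>q. a q + a' q) (\<lambda>q. b q + b' q)) x y"
      using True by (simp add: mat_scale_def weyl_def prod.distrib power_sum)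
    finally show ?thesis .
  next
    case False
    moreover have "mat_mul m A (weyl m A a b) (weyl m A a' b') \<in> matrices m A A" by simp
    ultimately have "mat_mul m A (weyl m A a b) (weyl m A a' b') x y = 0"
      using matrices_0 by blast
    then show ?thesis using False by (auto simp: mat_scale_def weyl_def)
  qed
qed

lemma weyl_0:
  assumes "finite A"
  shows "weyl m A (\<lambda>_. 0) (\<lambda>_. 0) = ident m A"
proof (intro ext)
  fix x y
  show "weyl m A (\<lambda>_. 0) (\<lambda>_. 0) x y = ident m A x y"
  proof (cases "x \<in> confs m A \<and> y \<in> confs m A")
    case True
    then have "(\<forall>q\<in>A. x q = y q mod m) \<longleftrightarrow> x = y"
      unfolding confs_def by (auto simp: PiE_iff intro: extensionalityI [of x A y])
    then show ?thesis
      using True assms by (auto simp: weyl_def ident_def intro: prod_zero_iff)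
  next
    case False
    then show ?thesis by (auto simp: weyl_def ident_def)
  qed
qed

lemma weyl_trivial:
  assumes "finite A" "0 < m" "\<And>q. q \<in> A \<Longrightarrow> m dvd a q" "\<And>q. q \<in> A \<Longrightarrow> m dvd b q"
  shows "weyl m A a b = ident m A"
  unfolding weyl_0 [OF assms(1), symmetric] using assms by (intro weyl_cong) auto

lemma add_pred_mult: "0 < m \<Longrightarrow> k + (m - 1) * k = m * k" for m k :: nat
  by (cases m) auto

text \<open>Natural exponents have no negatives: \<open>(m - 1) * a q\<close> stands for
  \<open>- a q\<close> modulo \<open>m\<close>. The phase comes from reordering
  \<open>Z^(-b) X^(-a)\<close>.\<close>

lemma weyl_dagger:
  assumes "finite A" "0 < m"
  shows "dagger (weyl m A a b) =
    mat_scale (omega m ^ (\<Sum>q\<in>A. b q * a q)) (weyl m A (\<lambda>q. (m - 1) * a q) (\<lambda>q. (m - 1) * b q))"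
proof (intro ext)
  fix x y
  have "cnj (if t = (s + a q) mod m then omega m ^ (b q * s) else 0) =
      omega m ^ (b q * a q) * (if s = (t + (m - 1) * a q) mod m then omega m ^ ((m - 1) * b q * t) else 0)"
    if "s < m" "t < m" for s t q
  proof (cases "t = (s + a q) mod m")
    case True
    have "(t + (m - 1) * a q) mod m = (s + (a q + (m - 1) * a q)) mod m"
      unfolding True by (simp add: mod_simps algebra_simps)
    also have "a q + (m - 1) * a q = m * a q"
      using assms(2) by (rule add_pred_mult)
    finally have s: "s = (t + (m - 1) * a q) mod m" using that by simp
    have "omega m ^ (b q * s) * (omega m ^ (b q * a q) * omega m ^ ((m - 1) * b q * t)) =
        omega m ^ (b q * (s + a q)) * omega m ^ ((m - 1) * b q * t)"
      by (simp add: algebra_simps power_add)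
    also have "omega m ^ (b q * (s + a q)) = omega m ^ (b q * t)"
      unfolding True by (rule omega_power_cong [OF assms(2)]) (simp add: mod_simps)
    also have "omega m ^ (b q * t) * omega m ^ ((m - 1) * b q * t) = omega m ^ (m * (b q * t))"
      using add_pred_mult [OF assms(2), of "b q * t"] by (simp add: mult.assoc flip: power_add)
    also have "\<dots> = 1" using assms(2) by (simp add: power_mult omega_power_m)
    finally have "cnj (omega m ^ (b q * s)) = cnj (omega m ^ (b q * s)) *
        (omega m ^ (b q * s) * (omega m ^ (b q * a q) * omega m ^ ((m - 1) * b q * t)))"
      by simp
    also have "\<dots> = omega m ^ (b q * a q) * omega m ^ ((m - 1) * b q * t)"
      unfolding mult.assoc [symmetric] by (simp add: norm_power del: complex_cnj_power)
    finally show ?thesis by (simp only: if_P [OF True] if_P [OF s])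
  next
    case False
    have "s \<noteq> (t + (m - 1) * a q) mod m"
    proof
      assume s: "s = (t + (m - 1) * a q) mod m"
      have "(s + a q) mod m = (t + (a q + (m - 1) * a q)) mod m"
        unfolding s by (simp add: mod_simps algebra_simps)
      also have "a q + (m - 1) * a q = m * a q"
        using assms(2) by (rule add_pred_mult)
      finally show False using that False by simp
    qed
    then show ?thesis by (simp only: if_not_P [OF False]) simp
  qed
  then show "dagger (weyl m A a b) x y =
    mat_scale (omega m ^ (\<Sum>q\<in>A. b q * a q)) (weyl m A (\<lambda>q. (m - 1) * a q) (\<lambda>q. (m - 1) * b q)) x y"
    unfolding dagger_def mat_scale_def weyl_def power_sum
    by (auto simp: confs_def PiE_iff simp flip: prod.distrib intro!: prod.cong)
qed

lemma weyl_unitary [simp]: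
  assumes "finite A" "0 < m"
  shows "unitary_op m A (weyl m A a b)"
proof (rule isometry_unitary)
  have dvd: "m dvd (m - 1) * k + k" for k
    by (metis add_pred_mult add.commute dvd_triv_left assms(2))
  \<comment> \<open>The phases of \<open>weyl_dagger\<close> and \<open>weyl_mul\<close> combine to
    an exponent divisible by \<open>m\<close>.\<close>
  have "(\<Sum>q\<in>A. b q * a q) + (\<Sum>q\<in>A. (m - 1) * b q * a q) = m * (\<Sum>q\<in>A. b q * a q)"
    using add_pred_mult [OF assms(2), of "\<Sum>q\<in>A. b q * a q"] by (simp add: sum_distrib_left mult.assoc)
  moreover have "weyl m A (\<lambda>q. (m - 1) * a q + a q) (\<lambda>q. (m - 1) * b q + b q) = ident m A"
    using assms dvd by (intro weyl_trivial)
  ultimately show "mat_mul m A (dagger (weyl m A a b)) (weyl m A a b) = ident m A"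
    using assms by (simp add: weyl_dagger weyl_mul omega_power_m power_mult flip: power_add)
qed (use assms in auto)

section \<open>The Pauli group in terms of Weyl operators\<close>

lemma pauli_X_weyl:
  assumes "finite A" "2 \<le> m" "q \<in> A"
  shows "pauli_X m A q = weyl m A (\<lambda>p. of_bool (p = q)) (\<lambda>_. 0)"
proof (intro ext)
  fix x y
  show "pauli_X m A q x y = weyl m A (\<lambda>p. of_bool (p = q)) (\<lambda>_. 0) x y"
  proof (cases "x \<in> confs m A \<and> y \<in> confs m A")
    case True
    have "x = y(q := (y q + 1) mod m) \<longleftrightarrow> (\<forall>p\<in>A. x p = (y p + of_bool (p = q)) mod m)"
    proof
      assume "x = y(q := (y q + 1) mod m)"
      then show "\<forall>p\<in>A. x p = (y p + of_bool (p = q)) mod m"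
        using True by (auto simp: confs_def PiE_iff)
    next
      assume r: "\<forall>p\<in>A. x p = (y p + of_bool (p = q)) mod m"
      show "x = y(q := (y q + 1) mod m)"
        by (rule extensionalityI [of _ A])
          (use True r assms(3) in \<open>auto simp: confs_def PiE_iff extensional_def\<close>)
    qed
    then show ?thesis
      using True assms(1) by (auto simp: pauli_X_def weyl_def intro: prod_zero_iff)
  next
    case False
    have "x \<in> confs m A" if "y \<in> confs m A" "x = y(q := (y q + 1) mod m)"
      using that assms(2,3) by (auto simp: confs_def PiE_iff extensional_def)
    then show ?thesis using False by (auto simp: pauli_X_def weyl_def)
  qed
qed

lemma pauli_Z_weyl:
  assumes "finite A" "q \<in> A"
  shows "pauli_Z m A q = weyl m A (\<lambda>_. 0) (\<lambda>p. of_bool (p = q))"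
proof (intro ext)
  fix x y
  show "pauli_Z m A q x y = weyl m A (\<lambda>_. 0) (\<lambda>p. of_bool (p = q)) x y"
  proof (cases "x \<in> confs m A \<and> y \<in> confs m A")
    case True
    then have xy: "(\<forall>q\<in>A. x q = y q mod m) \<longleftrightarrow> x = y"
      unfolding confs_def by (auto simp: PiE_iff intro: extensionalityI [of x A y])
    have "(\<Prod>p\<in>A. omega m ^ (of_bool (p = q) * y p)) = omega m ^ y q"
      using assms by (simp add: of_bool_def if_distrib [of "\<lambda>k. k * _"] if_distrib [of "\<lambda>k. _ ^ k"] cong: if_cong)
    then have "weyl m A (\<lambda>_. 0) (\<lambda>p. of_bool (p = q)) x y = (if x = y then omega m ^ y q else 0)"
      using True assms(1) unfolding weyl_def by (auto simp: xy [symmetric] intro!: prod_zero)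
    then show ?thesis using True by (simp add: pauli_Z_def)
  next
    case False
    then show ?thesis by (auto simp: pauli_Z_def weyl_def)
  qed
qed

definition paulis :: "nat \<Rightarrow> 'q set \<Rightarrow> 'q operator set" where
  "paulis m A = {mat_scale c (weyl m A a b) | c a b. cmod c = 1}"

lemma paulisI: "cmod c = 1 \<Longrightarrow> mat_scale c (weyl m A a b) \<in> paulis m A"
  unfolding paulis_def by blast

lemma weyl_in_paulis [simp]: "weyl m A a b \<in> paulis m A"
  using paulisI [of 1] by simp

lemma paulis_reduced:
  assumes "0 < m" "g \<in> paulis m A"
  obtains c a b where "cmod c = 1" "a \<in> confs m A" "b \<in> confs m A" "g = mat_scale c (weyl m A a b)"
proof -
  obtain c a b where g: "g = mat_scale c (weyl m A a b)" "cmod c = 1"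
    using assms(2) unfolding paulis_def by blast
  show thesis
  proof (rule that [OF g(2)])
    show "g = mat_scale c (weyl m A (\<lambda>q\<in>A. a q mod m) (\<lambda>q\<in>A. b q mod m))"
      using g weyl_mod [OF assms(1)] by metis
  qed (use assms(1) in \<open>auto simp: confs_def PiE_iff\<close>)
qed

lemma paulis_unitary: "finite A \<Longrightarrow> 0 < m \<Longrightarrow> g \<in> paulis m A \<Longrightarrow> unitary_op m A g"
  unfolding paulis_def by auto

lemma paulis_scale: "cmod c = 1 \<Longrightarrow> g \<in> paulis m A \<Longrightarrow> mat_scale c g \<in> paulis m A"
  unfolding paulis_def using norm_mult [of c] by fastforce

lemma paulis_mul:
  assumes "finite A" "0 < m" "g \<in> paulis m A" "h \<in> paulis m A"
  shows "mat_mul m A g h \<in> paulis m A"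
proof -
  obtain c a b d a' b' where "cmod c = 1" "cmod d = 1"
    "g = mat_scale c (weyl m A a b)" "h = mat_scale d (weyl m A a' b')"
    using assms unfolding paulis_def by blast
  then show ?thesis
    using assms(1,2) by (auto simp: weyl_mul norm_mult norm_power intro!: paulisI)
qed

lemma paulis_dagger:
  assumes "finite A" "0 < m" "g \<in> paulis m A"
  shows "dagger g \<in> paulis m A"
proof -
  obtain c a b where "cmod c = 1" "g = mat_scale c (weyl m A a b)"
    using assms unfolding paulis_def by blast
  then show ?thesis
    using assms(1,2) by (auto simp: weyl_dagger dagger_scale norm_mult norm_power intro!: paulisI)
qed

lemma paulis_ident [simp]: "finite A \<Longrightarrow> ident m A \<in> paulis m A"
  by (metis weyl_0 weyl_in_paulis)

lemma pauli_generators: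
  assumes "finite A" "2 \<le> m"
  shows "pauli_X m A ` A \<union> pauli_Z m A ` A \<union>
      (if m = 2 then (\<lambda>q. mat_scale \<i> (mat_mul m A (pauli_X m A q) (pauli_Z m A q))) ` A
       else {}) \<subseteq> paulis m A"
  using assms by (auto simp: pauli_X_weyl pauli_Z_weyl intro!: paulis_scale paulis_mul)

lemma pauli_group_subset_paulis:
  assumes "finite A" "2 \<le> m"
  shows "pauli_group m A \<subseteq> paulis m A"
proof
  fix g assume "g \<in> pauli_group m A"
  then show "g \<in> paulis m A"
    unfolding pauli_group_def
  proof induction
    case one
    then show ?case using assms by simp
  next
    case (incl h)
    then show ?case using pauli_generators [OF assms] by blast
  next
    case (inv h)
    then have "h \<in> paulis m A" using pauli_generators [OF assms] by blast
    then show ?case using assms by (simp add: paulis_unitary paulis_dagger)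
  next
    case (eng g h)
    then show ?case using assms by (simp add: paulis_mul)
  qed
qed

section \<open>Commutation characters\<close>

definition chi :: "nat \<Rightarrow> 'q set \<Rightarrow> 'q operator \<Rightarrow> 'q operator \<Rightarrow> complex" where
  "chi m A U V = (THE c. mat_mul m A U V = mat_scale c (mat_mul m A V U))"

lemma mat_scale_unitary_cancel:
  assumes "finite A" "0 < m" "unitary_op m A U" "mat_scale c U = mat_scale d U"
  shows "c = d"
proof -
  have "mat_mul m A (mat_scale c U) (dagger U) = mat_mul m A (mat_scale d U) (dagger U)"
    using assms(4) by simp
  then have "mat_scale c (ident m A) = mat_scale d (ident m A)"
    using assms(3) by simp
  moreover have "(\<lambda>q\<in>A. 0) \<in> confs m A" using assms(2) by (auto simp: confs_def)
  ultimately show ?thesis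
    by (auto simp: mat_scale_def ident_def fun_eq_iff split: if_splits)
qed

text \<open>Unitarity makes the scalar unique, so the definite description picks the one
  exhibited.\<close>

lemma chi_eqI:
  assumes "finite A" "0 < m" "unitary_op m A U" "unitary_op m A V"
    and "mat_mul m A U V = mat_scale c (mat_mul m A V U)"
  shows "chi m A U V = c"
  unfolding chi_def
proof (rule the_equality)
  fix d assume "mat_mul m A U V = mat_scale d (mat_mul m A V U)"
  then show "d = c"
    using mat_scale_unitary_cancel [OF assms(1,2)] assms unitary_mul by metis
qed (fact assms(5))

lemma weyl_commute:
  assumes "finite A" "0 < m"
  shows "mat_mul m A (weyl m A a b) (weyl m A a' b') =
    mat_scale (omega m ^ (\<Sum>q\<in>A. b q * a' q) * cnj (omega m ^ (\<Sum>q\<in>A. b' q * a q)))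
      (mat_mul m A (weyl m A a' b') (weyl m A a b))"
  using assms
  by (simp add: weyl_mul mult.assoc norm_power add.commute del: complex_cnj_power)

text \<open>The root is raised to the symplectic form of the two exponent vectors; the conjugate
  stands for the subtraction that natural exponents lack. The phase \<open>c\<close> is central and
  drops out.\<close>

lemma chi_weyl:
  assumes "finite A" "0 < m" "cmod c = 1"
  shows "chi m A (weyl m A a b) (mat_scale c (weyl m A a' b')) =
    omega m ^ (\<Sum>q\<in>A. b q * a' q) * cnj (omega m ^ (\<Sum>q\<in>A. b' q * a q))"
proof (rule chi_eqI)
  show "mat_mul m A (weyl m A a b) (mat_scale c (weyl m A a' b')) =
    mat_scale (omega m ^ (\<Sum>q\<in>A. b q * a' q) * cnj (omega m ^ (\<Sum>q\<in>A. b' q * a q)))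
      (mat_mul m A (mat_scale c (weyl m A a' b')) (weyl m A a b))"
    unfolding mul_scale_right mul_scale_left
    by (subst weyl_commute [OF assms(1,2)]) (simp add: mult.commute)
qed (use assms in \<open>auto intro: unitary_scale\<close>)

lemma chi_paulis:
  assumes "finite A" "0 < m" "g \<in> paulis m A" "h \<in> paulis m A"
  shows "mat_mul m A g h = mat_scale (chi m A g h) (mat_mul m A h g)"
proof -
  obtain c a b d a' b' where gh: "g = mat_scale c (weyl m A a b)" "h = mat_scale d (weyl m A a' b')"
    using assms unfolding paulis_def by blast
  obtain e where "mat_mul m A (weyl m A a b) (weyl m A a' b') =
      mat_scale e (mat_mul m A (weyl m A a' b') (weyl m A a b))"
    using weyl_commute [OF assms(1,2)] by blast
  then have "mat_mul m A g h = mat_scale e (mat_mul m A h g)"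
    by (simp add: gh mult_ac)
  then show ?thesis
    using chi_eqI assms paulis_unitary by metis
qed

text \<open>Together with \<open>chi_mul_left\<close> this makes \<open>chi\<close> a bicharacter,
  the source of the orthogonality relations for sums over the stabilizer.\<close>

lemma chi_mul:
  assumes "finite A" "0 < m" "g \<in> paulis m A" "h \<in> paulis m A" "k \<in> paulis m A"
  shows "chi m A g (mat_mul m A h k) = chi m A g h * chi m A g k"
proof (rule chi_eqI)
  have "mat_mul m A g (mat_mul m A h k) = mat_mul m A (mat_mul m A g h) k"
    by (simp add: mat_mul_assoc)
  also have "\<dots> = mat_scale (chi m A g h) (mat_mul m A h (mat_mul m A g k))"
    by (subst chi_paulis) (use assms in \<open>simp_all add: mat_mul_assoc\<close>)
  also have "mat_mul m A g k = mat_scale (chi m A g k) (mat_mul m A k g)"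
    by (rule chi_paulis) (use assms in simp_all)
  finally show "mat_mul m A g (mat_mul m A h k) =
      mat_scale (chi m A g h * chi m A g k) (mat_mul m A (mat_mul m A h k) g)"
    by (simp add: mat_mul_assoc)
qed (use assms in \<open>auto intro!: paulis_mul paulis_unitary\<close>)

lemma chi_mul_left:
  assumes "finite A" "0 < m" "g \<in> paulis m A" "h \<in> paulis m A" "k \<in> paulis m A"
  shows "chi m A (mat_mul m A g h) k = chi m A g k * chi m A h k"
proof (rule chi_eqI)
  have "mat_mul m A (mat_mul m A g h) k = mat_mul m A g (mat_mul m A h k)"
    by (simp add: mat_mul_assoc)
  also have "\<dots> = mat_scale (chi m A h k) (mat_mul m A (mat_mul m A g k) h)"
    by (subst chi_paulis) (use assms in \<open>simp_all add: mat_mul_assoc\<close>)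
  also have "mat_mul m A g k = mat_scale (chi m A g k) (mat_mul m A k g)"
    by (rule chi_paulis) (use assms in simp_all)
  finally show "mat_mul m A (mat_mul m A g h) k =
      mat_scale (chi m A g k * chi m A h k) (mat_mul m A k (mat_mul m A g h))"
    by (simp add: mat_mul_assoc mult.commute)
qed (use assms in \<open>auto intro!: paulis_mul paulis_unitary\<close>)

lemma chi_commute:
  assumes "finite A" "0 < m" "unitary_op m A g" "unitary_op m A h"
    and "mat_mul m A g h = mat_mul m A h g"
  shows "chi m A g h = 1"
  using assms by (intro chi_eqI) auto

lemma chi_scale:
  assumes "finite A" "0 < m" "g \<in> paulis m A" "h \<in> paulis m A" "cmod c = 1"
  shows "chi m A (mat_scale c g) h = chi m A g h"
proof (rule chi_eqI)
  show "mat_mul m A (mat_scale c g) h = mat_scale (chi m A g h) (mat_mul m A h (mat_scale c g))"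
    unfolding mul_scale_left using assms by (subst chi_paulis) (auto simp: mult.commute)
qed (use assms in \<open>auto intro: paulis_unitary unitary_scale\<close>)

lemma chi_swap:
  assumes "finite A" "0 < m" "g \<in> paulis m A" "h \<in> paulis m A"
  shows "chi m A g h * chi m A h g = 1"
proof -
  have "mat_scale 1 (mat_mul m A g h) = mat_scale (chi m A g h * chi m A h g) (mat_mul m A g h)"
    by (subst chi_paulis [OF assms], subst chi_paulis [OF assms(1,2,4,3)]) simp
  then show ?thesis
    using mat_scale_unitary_cancel [OF assms(1,2)] assms paulis_unitary unitary_mul by metis
qed

definition zero_ext :: "'q set \<Rightarrow> ('q \<Rightarrow> nat) \<Rightarrow> 'q \<Rightarrow> nat" where
  "zero_ext R a = (\<lambda>q. if q \<in> R then a q else 0)"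

text \<open>Orthogonality of characters on \<open>Z_m^(2|R|)\<close>: summing over all Paulis
  supported in \<open>R\<close> detects whether a given Pauli is trivial on \<open>R\<close>. The
  sum factors into one geometric sum per qudit and kind of exponent, so the criterion is plain
  divisibility, valid for composite \<open>m\<close>.\<close>

lemma sum_chi:
  fixes A R :: "'q set"
  assumes "finite A" "0 < m" "R \<subseteq> A" "cmod c = 1"
  shows "(\<Sum>y\<in>confs m R \<times> confs m R.
      chi m A (weyl m A (zero_ext R (fst y)) (zero_ext R (snd y))) (mat_scale c (weyl m A a b))) =
    (if \<forall>q\<in>R. m dvd a q \<and> m dvd b q then of_nat (m ^ (2 * card R)) else 0)"
proof -
  have fR: "finite R" using assms finite_subset by blast
  have sub: "(\<Sum>q\<in>A. zero_ext R f q * g q) = (\<Sum>q\<in>R. f q * g q)"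
    "(\<Sum>q\<in>A. g q * zero_ext R f q) = (\<Sum>q\<in>R. f q * g q)" for f g
    using assms by (simp_all add: zero_ext_def if_distrib [of "\<lambda>k. k * _"] if_distrib [of "\<lambda>k. _ * k"]
        sum.If_cases Int_absorb1 mult.commute cong: if_cong)
  have power: "(\<Prod>q\<in>R. if m dvd f q then of_nat m else 0) =
      (if \<forall>q\<in>R. m dvd f q then of_nat (m ^ card R) else (0::complex))" for f
    using fR by (auto intro: prod_zero)
  have gauss: "(\<Sum>y\<in>confs m R. omega m ^ (\<Sum>q\<in>R. y q * f q)) =
      (if \<forall>q\<in>R. m dvd f q then of_nat (m ^ card R) else 0)" for f
  proof -
    have "(\<Sum>y\<in>confs m R. omega m ^ (\<Sum>q\<in>R. y q * f q)) =
        (\<Sum>y\<in>R \<rightarrow>\<^sub>E {..<m}. \<Prod>q\<in>R. omega m ^ (f q * y q))"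
      by (simp add: confs_def power_sum mult.commute)
    also have "\<dots> = (\<Prod>q\<in>R. \<Sum>t\<in>{..<m}. omega m ^ (f q * t))"
      using fR by (subst prod_sum_PiE) auto
    finally show ?thesis by (simp only: sum_omega_power [OF assms(2)] power)
  qed
  \<comment> \<open>The shift exponents \<open>fst y\<close> enter \<open>chi\<close> through its
    conjugated factor, so the double sum is a product in which one sum is conjugated.\<close>
  have prod: "(\<Sum>y\<in>S \<times> T. g (snd y) * cnj (f (fst y))) = cnj (sum f S) * sum g T"
    for f g :: "('q \<Rightarrow> nat) \<Rightarrow> complex" and S T
    by (simp add: sum_product sum.cartesian_product case_prod_unfold mult.commute [of "g _"])
  have "(\<Sum>y\<in>confs m R \<times> confs m R.
      chi m A (weyl m A (zero_ext R (fst y)) (zero_ext R (snd y))) (mat_scale c (weyl m A a b))) =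
    (\<Sum>y\<in>confs m R \<times> confs m R.
      omega m ^ (\<Sum>q\<in>R. snd y q * a q) * cnj (omega m ^ (\<Sum>q\<in>R. fst y q * b q)))"
    by (simp only: chi_weyl [OF assms(1,2,4)] sub)
  also have "\<dots> = cnj (\<Sum>y\<in>confs m R. omega m ^ (\<Sum>q\<in>R. y q * b q)) *
      (\<Sum>y\<in>confs m R. omega m ^ (\<Sum>q\<in>R. y q * a q))"
    by (rule prod)
  also have "\<dots> = (if \<forall>q\<in>R. m dvd a q \<and> m dvd b q then of_nat (m ^ (2 * card R)) else 0)"
    unfolding gauss by (auto simp: mult_2 power_add)
  finally show ?thesis .
qed

section \<open>Weyl operators as tensor products\<close>

lemma tensor_weyl:
  assumes "finite A" "partition_on A P"
  shows "weyl m A a b = tensor m A P (\<lambda>R. weyl m R a b)"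
proof (intro ext)
  fix x y
  have P: "finite P" "\<And>R. R \<in> P \<Longrightarrow> R \<subseteq> A" "\<Union>P = A"
    using assms finite_elements [OF assms] by (auto simp: partition_on_def)
  have fR: "finite R" if "R \<in> P" for R
    using P(2) [OF that] assms(1) finite_subset by blast
  show "weyl m A a b x y = tensor m A P (\<lambda>R. weyl m R a b) x y"
  proof (cases "x \<in> confs m A \<and> y \<in> confs m A")
    case True
    let ?f = "\<lambda>q. if x q = (y q + a q) mod m then omega m ^ (b q * y q) else 0"
    have "weyl m A a b x y = prod ?f (\<Union>P)"
      using True by (simp add: weyl_def P(3))
    also have "\<dots> = (\<Prod>R\<in>P. prod ?f R)"
      using assms(2) fR by (subst prod.Union_disjoint) (auto simp: partition_on_def disjoint_def)
    also have "\<dots> = (\<Prod>R\<in>P. weyl m R a b (restrict x R) (restrict y R))"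
    proof (rule prod.cong [OF refl])
      fix R assume "R \<in> P"
      then have "restrict x R \<in> confs m R" "restrict y R \<in> confs m R"
        using True P(2) by (auto simp: confs_def)
      then show "prod ?f R = weyl m R a b (restrict x R) (restrict y R)"
        by (auto simp: weyl_def intro!: prod.cong)
    qed
    finally show ?thesis using True by (simp add: tensor_def)
  next
    case False
    then show ?thesis by (auto simp: weyl_def tensor_def)
  qed
qed

lemma tensor_insert_empty: "finite P \<Longrightarrow> {} \<notin> P \<Longrightarrow>
  (\<And>x y. U {} (restrict x {}) (restrict y {}) = 1) \<Longrightarrow>
  tensor m A (insert {} P) U = tensor m A P U"
  unfolding tensor_def by (intro ext) simp

lemma acts_as_scalar_weyl:
  assumes "finite A" "0 < m" "T \<subseteq> A" "T \<noteq> {}"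
    and "\<And>q. q \<in> T \<Longrightarrow> a q = 0" "\<And>q. q \<in> T \<Longrightarrow> b q = 0"
  shows "acts_as_scalar m A T (mat_scale c (weyl m A a b))"
proof -
  have ne: "A - T \<noteq> T" using assms(4) by blast
  have fin: "finite T" using assms finite_subset by blast
  have triv: "weyl m T a b = ident m T"
    using assms fin by (intro weyl_trivial) auto
  have "weyl m A a b = tensor m A {T, A - T} (\<lambda>R. weyl m R a b)"
  \<comment> \<open>If \<open>T\<close> is all of \<open>A\<close>, the family
    \<open>{T, A - T}\<close> contains the empty set and is not a partition; the factor on no qudits
    equals 1 and can be removed.\<close>
  proof (cases "A - T = {}")
    case True
    have "weyl m {} a b (restrict x {}) (restrict y {}) = 1" for x y
      by (simp add: weyl_def confs_def restrict_def)
    moreover have "partition_on A {T}"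
      using assms(3,4) True by (auto simp: partition_on_def)
    ultimately show ?thesis
      unfolding True using tensor_insert_empty [of "{T}"] tensor_weyl [OF assms(1)] assms(4)
      by (simp add: insert_commute)
  next
    case False
    then have "partition_on A {T, A - T}"
      using assms(3,4) by (auto simp: partition_on_def disjoint_def)
    then show ?thesis by (rule tensor_weyl [OF assms(1)])
  qed
  then have "mat_scale c (weyl m A a b) = tensor m A {T, A - T}
      (\<lambda>R. if R = T then mat_scale c (ident m T) else weyl m (A - T) a b)"
    using ne by (auto simp: fun_eq_iff mat_scale_def tensor_def triv)
  then show ?thesis
    unfolding acts_as_scalar_def using weyl_in_matrices by blast
qed

section \<open>Stabilizer codes\<close>

locale stabilizer =
  fixes m :: nat and C :: "('q, 'l) stab_code"
  assumes m_ge_2: "2 \<le> m" and code: "stabilizer_code m C"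
begin

abbreviation "A \<equiv> qudits C"
abbreviation "S \<equiv> stab C"
abbreviation "L \<equiv> set (logicals C)"

section \<open>Stabilizer group and logical generators\<close>

lemma m_pos [simp]: "0 < m" and m_nonzero [simp]: "m \<noteq> 0"
  using m_ge_2 by simp_all

lemma finite_A [simp]: "finite A"
  and card_L: "card L = length (logicals C)"
  and k_le_n: "length (logicals C) \<le> card A"
  and distinct_logicals: "distinct (logicals C)"
  and card_S: "card S = m ^ (card A - card L)"
  and dim_code_space: "cfun.dim (code_space m C) = m ^ card L"
  using code unfolding stabilizer_code_def Let_def by (auto simp: distinct_card)

lemma group: "group (unitary_group m A)"
  by (rule group_unitary_group) simp

lemma generate_S: "\<exists>gs \<subseteq> pauli_group m A. S = generate (unitary_group m A) gs"
  using code unfolding stabilizer_code_def Let_def by metis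

lemma S_subset_paulis: "S \<subseteq> paulis m A"
proof -
  obtain gs where gs: "gs \<subseteq> pauli_group m A" "S = generate (unitary_group m A) gs"
    using generate_S by blast
  have gp: "g \<in> paulis m A" if "g \<in> gs" for g
    using that gs(1) pauli_group_subset_paulis [OF finite_A m_ge_2] by blast
  have "g \<in> generate (unitary_group m A) gs \<Longrightarrow> g \<in> paulis m A" for g
    by (induction rule: generate.induct) (auto simp: gp paulis_dagger paulis_unitary paulis_mul)
  then show ?thesis unfolding gs(2) by blast
qed

lemma subgroup_S: "subgroup S (unitary_group m A)"
proof -
  obtain gs where gs: "gs \<subseteq> pauli_group m A" "S = generate (unitary_group m A) gs"
    using generate_S by blast
  then have "gs \<subseteq> carrier (unitary_group m A)"
    using pauli_group_subset_paulis [OF finite_A m_ge_2] paulis_unitary [OF finite_A m_pos] by auto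
  then show ?thesis
    unfolding gs(2) by (rule group.generate_is_subgroup [OF group])
qed

lemma S_paulis [simp]: "s \<in> S \<Longrightarrow> s \<in> paulis m A"
  using S_subset_paulis by blast

lemma S_unitary [simp]: "s \<in> S \<Longrightarrow> unitary_op m A s"
  by (simp add: paulis_unitary)

lemma ident_S [simp]: "ident m A \<in> S"
  using subgroup.one_closed [OF subgroup_S] by simp

lemma mul_S [simp]: "s \<in> S \<Longrightarrow> t \<in> S \<Longrightarrow> mat_mul m A s t \<in> S"
  using subgroup.m_closed [OF subgroup_S] by simp

lemma dagger_S [simp]: "s \<in> S \<Longrightarrow> dagger s \<in> S"
  using subgroup.m_inv_closed [OF subgroup_S] by simp

lemma finite_S [simp]: "finite S"
  using card_S by (metis card.infinite m_pos not_less_zero zero_less_power)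

lemma log_X_paulis [simp]: "i \<in> L \<Longrightarrow> log_X C i \<in> paulis m A"
  and log_Z_paulis [simp]: "i \<in> L \<Longrightarrow> log_Z C i \<in> paulis m A"
  using code pauli_group_subset_paulis [OF finite_A m_ge_2]
  unfolding stabilizer_code_def Let_def by auto

lemma log_X_commute_S: "i \<in> L \<Longrightarrow> s \<in> S \<Longrightarrow> mat_mul m A (log_X C i) s = mat_mul m A s (log_X C i)"
  and log_Z_commute_S: "i \<in> L \<Longrightarrow> s \<in> S \<Longrightarrow> mat_mul m A (log_Z C i) s = mat_mul m A s (log_Z C i)"
  and commutator_XZ: "i \<in> L \<Longrightarrow> j \<in> L \<Longrightarrow> commutator m A (log_X C i) (log_Z C j) =
           mat_scale (if i = j then inverse (omega m) else 1) (ident m A)"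
  and commutator_XX: "i \<in> L \<Longrightarrow> j \<in> L \<Longrightarrow> commutator m A (log_X C i) (log_X C j) = mat_scale 1 (ident m A)"
  and commutator_ZZ: "i \<in> L \<Longrightarrow> j \<in> L \<Longrightarrow> commutator m A (log_Z C i) (log_Z C j) = mat_scale 1 (ident m A)"
  using code unfolding stabilizer_code_def Let_def by auto

lemma chi_commutator:
  assumes "g \<in> paulis m A" "h \<in> paulis m A" "commutator m A g h = mat_scale c (ident m A)"
  shows "chi m A g h = c"
  using assms by (intro chi_eqI commutator_eq_scaleD) (auto intro: paulis_unitary)

lemma chi_XZ: "i \<in> L \<Longrightarrow> j \<in> L \<Longrightarrow> chi m A (log_X C i) (log_Z C j) = (if i = j then inverse (omega m) else 1)"
  and chi_XX: "i \<in> L \<Longrightarrow> j \<in> L \<Longrightarrow> chi m A (log_X C i) (log_X C j) = 1"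
  and chi_ZZ: "i \<in> L \<Longrightarrow> j \<in> L \<Longrightarrow> chi m A (log_Z C i) (log_Z C j) = 1"
  using chi_commutator commutator_XZ commutator_XX commutator_ZZ by auto

lemma chi_ZX:
  assumes "i \<in> L" "j \<in> L"
  shows "chi m A (log_Z C i) (log_X C j) = (if i = j then omega m else 1)"
  using chi_swap [of A m "log_X C j" "log_Z C i"] assms by (auto simp: chi_XZ field_simps split: if_splits)

section \<open>Logical monomials\<close>

lemma pow_paulis [simp]: "g \<in> paulis m A \<Longrightarrow> g [^]\<^bsub>unitary_group m A\<^esub> (n::nat) \<in> paulis m A"
  by (induction n) (auto simp: paulis_mul)

lemma chi_ident_left [simp]: "h \<in> paulis m A \<Longrightarrow> chi m A (ident m A) h = 1"
  by (rule chi_commute) (auto intro: paulis_unitary simp: paulis_unitary)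

lemma chi_pow:
  assumes "g \<in> paulis m A" "h \<in> paulis m A"
  shows "chi m A (g [^]\<^bsub>unitary_group m A\<^esub> (n::nat)) h = chi m A g h ^ n"
  by (induction n) (use assms in \<open>auto simp: chi_mul_left\<close>)

text \<open>The characters against \<open>log_Z C j\<close> and \<open>log_X C j\<close> recover the
  exponents \<open>a j\<close> and \<open>a' j\<close>, so monomials with different reduced
  exponents differ even up to phase. General lists of logical qudits allow induction; distinctness
  lets exactly one factor contribute.\<close>

lemma monomial_list:
  fixes a a' :: "'l \<Rightarrow> nat"
  assumes "set xs \<subseteq> L"
  defines "M \<equiv> \<lambda>xs. foldr (\<lambda>i p. mat_mul m A (mat_mul m A (log_X C i [^]\<^bsub>unitary_group m A\<^esub> a i)
      (log_Z C i [^]\<^bsub>unitary_group m A\<^esub> a' i)) p) xs (ident m A)"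
  shows "M xs \<in> paulis m A"
    and "h \<in> paulis m A \<Longrightarrow> (\<And>i. i \<in> set xs \<Longrightarrow> chi m A (log_X C i) h = 1 \<and> chi m A (log_Z C i) h = 1)
      \<Longrightarrow> chi m A (M xs) h = 1"
    and "distinct xs \<Longrightarrow> j \<in> set xs \<Longrightarrow> chi m A (M xs) (log_Z C j) = inverse (omega m) ^ a j"
    and "distinct xs \<Longrightarrow> j \<in> set xs \<Longrightarrow> chi m A (M xs) (log_X C j) = omega m ^ a' j"
proof -
  have M: "M xs \<in> paulis m A" if "set xs \<subseteq> L" for xs
    using that by (induction xs) (auto simp: M_def paulis_mul)
  then show "M xs \<in> paulis m A" using assms by blast
  have triv: "chi m A (M xs) h = 1" if "set xs \<subseteq> L" "h \<in> paulis m A"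
    "\<And>i. i \<in> set xs \<Longrightarrow> chi m A (log_X C i) h = 1 \<and> chi m A (log_Z C i) h = 1" for xs h
    using that
  proof (induction xs)
    case (Cons i xs)
    then show ?case
      using M [of xs] by (simp add: M_def chi_mul_left chi_pow paulis_mul)
  qed (simp add: M_def)
  then show "h \<in> paulis m A \<Longrightarrow> (\<And>i. i \<in> set xs \<Longrightarrow> chi m A (log_X C i) h = 1 \<and> chi m A (log_Z C i) h = 1)
      \<Longrightarrow> chi m A (M xs) h = 1"
    using assms by blast
  show "distinct xs \<Longrightarrow> j \<in> set xs \<Longrightarrow> chi m A (M xs) (log_Z C j) = inverse (omega m) ^ a j"
    using assms(1)
  proof (induction xs)
    case (Cons i xs)
    have j: "j \<in> L" and i: "i \<in> L" and xs: "set xs \<subseteq> L" using Cons.prems by auto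
    have step: "chi m A (M (i # xs)) (log_Z C j) =
        chi m A (log_X C i) (log_Z C j) ^ a i * chi m A (M xs) (log_Z C j)"
      using i j M [OF xs] by (simp add: M_def chi_mul_left chi_pow paulis_mul chi_ZZ)
    show ?case
    proof (cases "i = j")
      case True
      then have "chi m A (M xs) (log_Z C j) = 1"
        using Cons.prems xs j by (intro triv) (auto simp: chi_XZ chi_ZZ subset_iff)
      then show ?thesis using True step j by (simp add: chi_XZ)
    next
      case False
      then show ?thesis using Cons step i j by (simp add: chi_XZ)
    qed
  qed simp
  show "distinct xs \<Longrightarrow> j \<in> set xs \<Longrightarrow> chi m A (M xs) (log_X C j) = omega m ^ a' j"
    using assms(1)
  proof (induction xs)
    case (Cons i xs)
    have j: "j \<in> L" and i: "i \<in> L" and xs: "set xs \<subseteq> L" using Cons.prems by auto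
    have step: "chi m A (M (i # xs)) (log_X C j) =
        chi m A (log_Z C i) (log_X C j) ^ a' i * chi m A (M xs) (log_X C j)"
      using i j M [OF xs] by (simp add: M_def chi_mul_left chi_pow paulis_mul chi_XX)
    show ?case
    proof (cases "i = j")
      case True
      then have "chi m A (M xs) (log_X C j) = 1"
        using Cons.prems xs j by (intro triv) (auto simp: chi_ZX chi_XX subset_iff)
      then show ?thesis using True step j by (simp add: chi_ZX)
    next
      case False
      then show ?thesis using Cons step i j by (simp add: chi_ZX)
    qed
  qed simp
qed

lemma monomial_paulis [simp]: "logical_monomial m C a a' \<in> paulis m A"
  unfolding logical_monomial_def Let_def using monomial_list(1) [of "logicals C"] by simp

lemma chi_monomial_Z: "j \<in> L \<Longrightarrow> chi m A (logical_monomial m C a a') (log_Z C j) = inverse (omega m) ^ a j"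
  and chi_monomial_X: "j \<in> L \<Longrightarrow> chi m A (logical_monomial m C a a') (log_X C j) = omega m ^ a' j"
  unfolding logical_monomial_def Let_def
  using monomial_list(3,4) [of "logicals C"] distinct_logicals by simp_all

lemma chi_logical_S: "i \<in> L \<Longrightarrow> s \<in> S \<Longrightarrow> chi m A (log_X C i) s = 1"
    "i \<in> L \<Longrightarrow> s \<in> S \<Longrightarrow> chi m A (log_Z C i) s = 1"
  by (rule chi_commute; simp add: paulis_unitary log_X_commute_S log_Z_commute_S)+

lemma chi_S_logical: "i \<in> L \<Longrightarrow> s \<in> S \<Longrightarrow> chi m A s (log_X C i) = 1"
    "i \<in> L \<Longrightarrow> s \<in> S \<Longrightarrow> chi m A s (log_Z C i) = 1"
  by (rule chi_commute; simp add: paulis_unitary log_X_commute_S log_Z_commute_S)+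

lemma chi_monomial_S: "s \<in> S \<Longrightarrow> chi m A (logical_monomial m C a a') s = 1"
  unfolding logical_monomial_def Let_def
  using monomial_list(2) [of "logicals C" s] chi_logical_S by simp

section \<open>Character sums over the stabilizer group\<close>

lemma S_commute: "s \<in> S \<Longrightarrow> t \<in> S \<Longrightarrow> mat_mul m A s t = mat_mul m A t s"
  using code unfolding stabilizer_code_def Let_def by blast

lemma chi_S_S: "s \<in> S \<Longrightarrow> t \<in> S \<Longrightarrow> chi m A s t = 1"
  using S_commute by (intro chi_commute) auto

lemma code_space_nonzero: "\<exists>v\<in>code_space m C. v \<noteq> (\<lambda>x. 0)"
proof (rule ccontr)
  assume "\<not> ?thesis"
  then have "code_space m C \<subseteq> cfun.span {}"
    by (auto simp: zero_fun_def cfun.span_empty)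
  then have "cfun.dim (code_space m C) \<le> 0"
    using cfun.dim_le_card [of "code_space m C" "{}"] by simp
  then show False using dim_code_space m_ge_2 by simp
qed

text \<open>A scalar in \<open>S\<close> must fix a nonzero code vector. Hence distinct stabilizers
  remain distinct modulo phases, on which the counting rests.\<close>

lemma S_scalar:
  assumes "s \<in> S" "s = mat_scale c (ident m A)"
  shows "c = 1"
proof -
  obtain v x where v: "v \<in> code_space m C" "v x \<noteq> 0"
    using code_space_nonzero by fastforce
  then have "v = (\<lambda>x. c * v x)"
    using assms by (auto simp: code_space_def scale_app dest!: bspec [of _ _ s])
  then show ?thesis using v(2) by (metis mult_cancel_right1 mult.commute)
qed

text \<open>Translating the sum by \<open>t\<close> in \<open>S\<close> multiplies it by
  \<open>chi m A g t\<close>, so it vanishes as soon as one value differs from 1.\<close>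

lemma sum_chi_S:
  assumes "g \<in> paulis m A"
  shows "(\<Sum>s\<in>S. chi m A g s) = (if \<forall>s\<in>S. chi m A g s = 1 then of_nat (card S) else 0)"
proof (cases "\<forall>s\<in>S. chi m A g s = 1")
  case False
  then obtain t where t: "t \<in> S" "chi m A g t \<noteq> 1" by blast
  have "bij_betw (mat_mul m A t) S S"
    by (rule bij_betw_byWitness [where f' = "mat_mul m A (dagger t)"])
      (use t in \<open>auto simp: unitary_dagger_mul_cancel [where B = A] unitary_mul_dagger_cancel [where B = A]\<close>)
  then have "(\<Sum>s\<in>S. chi m A g s) = (\<Sum>s\<in>S. chi m A g (mat_mul m A t s))"
    by (rule sum.reindex_bij_betw [symmetric])
  also have "\<dots> = chi m A g t * (\<Sum>s\<in>S. chi m A g s)"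
    using t assms by (simp add: chi_mul sum_distrib_left)
  finally show ?thesis using t False by auto
qed auto

text \<open>One direction is \<open>S_scalar\<close>. The other avoids matrix entries: all
  characters of the identity are 1, so the sum in \<open>sum_chi\<close> is nonzero, which forces
  divisibility.\<close>

lemma S_trivial_iff:
  assumes "s \<in> S" "s = mat_scale c (weyl m A a b)" "cmod c = 1"
  shows "(\<forall>q\<in>A. m dvd a q \<and> m dvd b q) \<longleftrightarrow> s = ident m A"
proof
  assume "\<forall>q\<in>A. m dvd a q \<and> m dvd b q"
  then have "weyl m A a b = ident m A" by (intro weyl_trivial) auto
  then have *: "s = mat_scale c (ident m A)" using assms by simp
  then have "c = 1" using S_scalar assms(1) by blast
  then show "s = ident m A" using * by simp
next
  let ?Y = "confs m A \<times> confs m A"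
  assume "s = ident m A"
  then have eq: "chi m A g s = 1" if "g \<in> paulis m A" for g
    using that by (intro chi_commute) (auto intro: paulis_unitary simp: paulis_unitary)
  have "(\<Sum>y\<in>?Y. chi m A (weyl m A (zero_ext A (fst y)) (zero_ext A (snd y))) s) = of_nat (card ?Y)"
    by (simp add: eq)
  moreover have "card ?Y \<noteq> 0" using m_ge_2 by (simp add: card_cartesian_product card_confs)
  ultimately show "\<forall>q\<in>A. m dvd a q \<and> m dvd b q"
    unfolding assms(2) by (subst (asm) sum_chi) (auto simp: assms(3) split: if_splits)
qed

text \<open>The symplectic complement of \<open>S\<close>, given by reduced exponents so that each
  Pauli is counted once up to phase.\<close>

definition S_perp :: "('q conf \<times> 'q conf) set" where
  "S_perp = {y \<in> confs m A \<times> confs m A. \<forall>s\<in>S. chi m A (weyl m A (fst y) (snd y)) s = 1}"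

text \<open>Double counting of the characters over all exponent pairs and all of \<open>S\<close>.
  Summing over the pairs first leaves only \<open>s = ident m A\<close> and gives
  \<open>m ^ (2 * card A)\<close>; summing over \<open>S\<close> first gives \<open>card S\<close>
  for each member of \<open>S_perp\<close>. For composite \<open>m\<close> this replaces the
  dimension formula for a complement.\<close>

lemma card_S_perp: "card S_perp = m ^ (card A + card L)"
proof -
  let ?Y = "confs m A \<times> confs m A"
  have ext: "weyl m A (zero_ext A a) (zero_ext A b) = weyl m A a b" for a b
    by (rule weyl_cong) (auto simp: zero_ext_def)
  have inner: "(\<Sum>y\<in>?Y. chi m A (weyl m A (fst y) (snd y)) s) =
      (if s = ident m A then of_nat (m ^ (2 * card A)) else 0)" if "s \<in> S" for s
  proof -
    obtain c a b where s: "s = mat_scale c (weyl m A a b)" "cmod c = 1"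
      using paulis_reduced [OF m_pos S_paulis [OF \<open>s \<in> S\<close>]] by metis
    have "(\<forall>q\<in>A. m dvd a q \<and> m dvd b q) \<longleftrightarrow> s = ident m A"
      using S_trivial_iff that s by blast
    then show ?thesis
      using sum_chi [of A m A c a b] s by (simp add: ext)
  qed
  have "(\<Sum>y\<in>?Y. \<Sum>s\<in>S. chi m A (weyl m A (fst y) (snd y)) s) =
      (\<Sum>s\<in>S. \<Sum>y\<in>?Y. chi m A (weyl m A (fst y) (snd y)) s)"
    by (rule sum.swap)
  also have "\<dots> = of_nat (m ^ (2 * card A))"
    by (simp add: inner cong: sum.cong)
  also have "(\<Sum>y\<in>?Y. \<Sum>s\<in>S. chi m A (weyl m A (fst y) (snd y)) s) =
      (\<Sum>y\<in>?Y. if y \<in> S_perp then of_nat (card S) else 0)"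
    by (intro sum.cong refl, subst sum_chi_S) (auto simp: S_perp_def)
  also have "\<dots> = of_nat (card S_perp * card S)"
    by (subst sum.If_cases) (auto simp: S_perp_def Int_def intro!: arg_cong [of _ _ card])
  finally have "card S_perp * card S = m ^ (2 * card A)"
    using of_nat_eq_iff by blast
  also have "2 * card A = (card A + card L) + (card A - card L)"
    using k_le_n card_L by simp
  finally show ?thesis
    unfolding card_S power_add by simp
qed

text \<open>There are as many products of stabilizers and logical monomials as there are Weyl operators
  commuting with the stabilizer.\<close>

lemma commutant_S:
  assumes "g \<in> paulis m A" "\<And>s. s \<in> S \<Longrightarrow> chi m A g s = 1"
  obtains c s a a' where "cmod c = 1" "s \<in> S" "a \<in> L \<rightarrow>\<^sub>E {..<m}" "a' \<in> L \<rightarrow>\<^sub>E {..<m}"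
    "g = mat_scale c (mat_mul m A s (logical_monomial m C a a'))"
proof -
  define D where "D = S \<times> ((L \<rightarrow>\<^sub>E {..<m}) \<times> (L \<rightarrow>\<^sub>E {..<m}))"
  define F where "F = (\<lambda>(s :: 'q operator, a, a'). mat_mul m A s (logical_monomial m C a a'))"
  \<comment> \<open>Some reduced exponents of a Pauli, with its phase forgotten: equal values of
    \<open>rep\<close> imply equality up to a phase.\<close>
  define rep where "rep g = (SOME y. y \<in> confs m A \<times> confs m A \<and>
    (\<exists>c. cmod c = 1 \<and> g = mat_scale c (weyl m A (fst y) (snd y))))" for g
  have rep: "rep g \<in> confs m A \<times> confs m A"
    "\<exists>c. cmod c = 1 \<and> g = mat_scale c (weyl m A (fst (rep g)) (snd (rep g)))" if "g \<in> paulis m A" for g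
  proof -
    have "\<exists>y. y \<in> confs m A \<times> confs m A \<and> (\<exists>c. cmod c = 1 \<and> g = mat_scale c (weyl m A (fst y) (snd y)))"
      using paulis_reduced [OF m_pos that] by (metis SigmaI fst_conv snd_conv)
    from someI_ex [OF this] show "rep g \<in> confs m A \<times> confs m A"
      "\<exists>c. cmod c = 1 \<and> g = mat_scale c (weyl m A (fst (rep g)) (snd (rep g)))"
      unfolding rep_def by blast+
  qed
  have F: "F d \<in> paulis m A" if "d \<in> D" for d
    using that by (auto simp: F_def D_def paulis_mul)
  have rep_eqD: "\<exists>c. cmod c = 1 \<and> g = mat_scale c h" if gh: "g \<in> paulis m A" "h \<in> paulis m A" "rep g = rep h" for g h
  proof -
    obtain c where c: "cmod c = 1" "g = mat_scale c (weyl m A (fst (rep g)) (snd (rep g)))"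
      using rep(2) [OF gh(1)] by blast
    obtain d where d: "cmod d = 1" "h = mat_scale d (weyl m A (fst (rep h)) (snd (rep h)))"
      using rep(2) [OF gh(2)] by blast
    have "mat_scale (c * cnj d) h = mat_scale (c * cnj d) (mat_scale d (weyl m A (fst (rep g)) (snd (rep g))))"
      using d(2) gh(3) by simp
    also have "\<dots> = g" using c(2) d(1) by (simp add: mult.assoc)
    finally have "g = mat_scale (c * cnj d) h" ..
    moreover have "cmod (c * cnj d) = 1" using c(1) d(1) by (simp add: norm_mult)
    ultimately show ?thesis by blast
  qed
  have chi_scale_D: "chi m A (mat_scale c g) h = chi m A g h"
    if "cmod c = 1" "g \<in> paulis m A" "h \<in> paulis m A" for c g h
    using that by (simp add: chi_scale)
  \<comment> \<open>Characters against the logical generators recover the exponents. Cancelling the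
    monomial leaves \<open>s = c t\<close>, and \<open>S_scalar\<close> for \<open>s\<close> times
    the adjoint of \<open>t\<close> gives \<open>c = 1\<close>.\<close>
  have inj: "inj_on (rep \<circ> F) D"
  proof (rule inj_onI)
    fix d e assume d: "d \<in> D" and e: "e \<in> D" and eq: "(rep \<circ> F) d = (rep \<circ> F) e"
    obtain s a a' where d': "d = (s, a, a')" by (cases d)
    obtain t b b' where e': "e = (t, b, b')" by (cases e)
    have st: "s \<in> S" "t \<in> S" and ab: "a \<in> L \<rightarrow>\<^sub>E {..<m}" "a' \<in> L \<rightarrow>\<^sub>E {..<m}"
      "b \<in> L \<rightarrow>\<^sub>E {..<m}" "b' \<in> L \<rightarrow>\<^sub>E {..<m}"
      using d e by (auto simp: d' e' D_def)
    obtain c where c: "cmod c = 1" "F d = mat_scale c (F e)"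
      using rep_eqD [OF F [OF d] F [OF e]] eq by auto
    have chi: "chi m A (F d) h = chi m A (F e) h" if "h \<in> paulis m A" for h
      unfolding c(2) using c(1) F [OF e] that by (rule chi_scale_D)
    have a_eq: "a = b"
    proof (rule PiE_ext [OF ab(1,3)])
      fix j assume j: "j \<in> L"
      have "inverse (omega m ^ a j) = inverse (omega m ^ b j)"
        using chi [of "log_Z C j"] j st
        by (simp add: F_def d' e' chi_mul_left chi_S_logical chi_monomial_Z power_inverse)
      then show "a j = b j" using ab j by (intro omega_power_inj [of m]) auto
    qed
    have a'_eq: "a' = b'"
    proof (rule PiE_ext [OF ab(2,4)])
      fix j assume j: "j \<in> L"
      have "omega m ^ a' j = omega m ^ b' j"
        using chi [of "log_X C j"] j st
        by (simp add: F_def d' e' chi_mul_left chi_S_logical chi_monomial_X)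
      then show "a' j = b' j" using ab j by (intro omega_power_inj [of m]) auto
    qed
    let ?M = "logical_monomial m C a a'"
    have M: "unitary_op m A ?M" by (simp add: paulis_unitary)
    have "mat_mul m A (mat_mul m A s ?M) (dagger ?M) = mat_mul m A (mat_scale c (mat_mul m A t ?M)) (dagger ?M)"
      using c(2) by (simp add: F_def d' e' a_eq a'_eq)
    then have s: "s = mat_scale c t"
      using M st by (simp add: mat_mul_assoc)
    then have "mat_mul m A s (dagger t) = mat_scale c (ident m A)" using st by simp
    then have "c = 1" by (rule S_scalar [rotated]) (use st in simp)
    then show "d = e" using s a_eq a'_eq by (simp add: d' e')
  qed
  have "(rep \<circ> F) ` D \<subseteq> S_perp"
  proof
    fix y assume "y \<in> (rep \<circ> F) ` D"
    then obtain d where d: "d \<in> D" "y = rep (F d)" by auto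
    obtain s a a' where d': "d = (s, a, a')" by (cases d)
    have s: "s \<in> S" using d by (simp add: d' D_def)
    obtain c where c: "cmod c = 1" "F d = mat_scale c (weyl m A (fst y) (snd y))"
      using rep(2) [OF F [OF d(1)]] d(2) by auto
    have "chi m A (weyl m A (fst y) (snd y)) t = 1" if "t \<in> S" for t
    proof -
      have "chi m A (weyl m A (fst y) (snd y)) t = chi m A (F d) t"
        using c that by (simp add: chi_scale_D)
      also have "\<dots> = 1" using that s by (simp add: F_def d' chi_mul_left chi_S_S chi_monomial_S)
      finally show ?thesis .
    qed
    then show "y \<in> S_perp"
      using rep(1) [OF F [OF d(1)]] d(2) by (auto simp: S_perp_def)
  qed
  moreover have "finite S_perp" unfolding S_perp_def by (rule finite_subset [of _ "confs m A \<times> confs m A"]) auto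
  moreover have "card ((rep \<circ> F) ` D) = card S_perp"
  proof -
    have "card A - card L + (card L + card L) = card A + card L"
      using k_le_n card_L by simp
    then show ?thesis
      unfolding card_image [OF inj] card_S_perp unfolding D_def
      by (simp add: card_cartesian_product card_PiE card_S flip: power_add)
  qed
  \<comment> \<open>With \<open>n = card A\<close> and \<open>k = card L\<close>, both sides have
    \<open>m^(n-k) m^(2k) = m^(n+k)\<close> elements, so the injection is onto.\<close>
  ultimately have im: "(rep \<circ> F) ` D = S_perp"
    by (intro card_subset_eq)
  have "rep g \<in> S_perp"
  proof -
    obtain c where c: "cmod c = 1" "g = mat_scale c (weyl m A (fst (rep g)) (snd (rep g)))"
      using rep(2) [OF assms(1)] by blast
    have "chi m A (weyl m A (fst (rep g)) (snd (rep g))) s = 1" if "s \<in> S" for s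
      using chi_scale_D [OF c(1) weyl_in_paulis, of s "fst (rep g)" "snd (rep g)"] c(2) assms(2) that by simp
    then show ?thesis using rep(1) [OF assms(1)] by (auto simp: S_perp_def)
  qed
  then obtain d where d: "d \<in> D" "rep g = rep (F d)"
    using im by (metis comp_apply imageE)
  then obtain c where "cmod c = 1" "g = mat_scale c (F d)"
    using rep_eqD [OF assms(1) F] by blast
  then show thesis
    using that d(1) by (cases d) (auto simp: F_def D_def)
qed

text \<open>By \<open>commutant_S\<close>, \<open>g\<close> is a phase times a stabilizer times a
  monomial. A nonzero exponent would put that product, which is scalar on every part other than
  \<open>T\<close>, into a coset counted by the min-distance and make the distance at most 1. So the
  exponents vanish, and what remains commutes with the logical generators.\<close>

lemma error_detecting_local:
  assumes "partition_on A P" "error_detecting m C P" "T \<in> P"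
    and "g = weyl m A (zero_ext T a) (zero_ext T b)" "\<And>s. s \<in> S \<Longrightarrow> chi m A g s = 1" "i \<in> L"
  shows "chi m A g (log_X C i) = 1 \<and> chi m A g (log_Z C i) = 1"
proof -
  have gp: "g \<in> paulis m A" using assms(4) by simp
  obtain c s a1 a2 where c: "cmod c = 1" "s \<in> S" "a1 \<in> L \<rightarrow>\<^sub>E {..<m}" "a2 \<in> L \<rightarrow>\<^sub>E {..<m}"
    and g: "g = mat_scale c (mat_mul m A s (logical_monomial m C a1 a2))"
    using commutant_S [OF gp assms(5)] by blast
  have zero: "a1 j = 0 \<and> a2 j = 0" if "j \<in> L" for j
  proof (rule ccontr)
    assume nz: "\<not> (a1 j = 0 \<and> a2 j = 0)"
    let ?G = "S #>\<^bsub>unitary_group m A\<^esub> logical_monomial m C a1 a2"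
    let ?g = "mat_mul m A s (logical_monomial m C a1 a2)"
    have G: "?G \<in> nontrivial_logical_paulis m C"
      unfolding nontrivial_logical_paulis_def using c that nz by blast
    have "?g \<in> ?G" using c unfolding r_coset_def by auto
    \<comment> \<open>The support is read off from \<open>g\<close>, whose exponents vanish outside
      \<open>T\<close>.\<close>
    moreover have "?g = mat_scale (cnj c) g" using g c by simp
    then have "acts_as_scalar m A R ?g" if "R \<in> P" "R \<noteq> T" for R
      unfolding assms(4) \<open>?g = _\<close>
    proof (intro acts_as_scalar_weyl)
      have "R \<inter> T = {}"
        using assms(1,3) that by (auto simp: partition_on_def disjoint_def)
      then show "zero_ext T a q = 0" "zero_ext T b q = 0" if "q \<in> R" for q
        using that by (auto simp: zero_ext_def)
    qed (use assms(1) that in \<open>auto simp: partition_on_def\<close>)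
    then have "supp m A P ?g \<subseteq> {T}" unfolding supp_def by auto
    then have "card (supp m A P ?g) \<le> 1" using card_mono [of "{T}"] by simp
    moreover have "(INF g\<in>?G. card (supp m A P g)) \<le> card (supp m A P ?g)"
      using \<open>?g \<in> ?G\<close> by (intro cINF_lower) auto
    moreover have "min_distance m C P \<le> (INF g\<in>?G. card (supp m A P g))"
      unfolding min_distance_def using G by (intro cINF_lower) auto
    ultimately show False
      using assms(2) unfolding error_detecting_def by simp
  qed
  have "chi m A g h = chi m A (mat_mul m A s (logical_monomial m C a1 a2)) h" if "h \<in> paulis m A" for h
    unfolding g using c that by (intro chi_scale) (auto simp: paulis_mul)
  then show ?thesis
    using assms(6) c(2) zero by (simp add: chi_mul_left chi_S_logical chi_monomial_X chi_monomial_Z)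
qed

text \<open>Duality of finite abelian groups, modulo phases: the third assumption puts the
  restriction of \<open>p\<close> to \<open>T\<close> into the double annihilator of the
  restrictions of the stabilizers, hence into that group itself. The stabilizer obtained restricts
  to the inverse of \<open>p\<close> on \<open>T\<close>.\<close>

lemma cleaning:
  assumes "T \<subseteq> A" "p \<in> paulis m A"
    and "\<And>a b. (\<forall>s\<in>S. chi m A (weyl m A (zero_ext T a) (zero_ext T b)) s = 1) \<Longrightarrow>
       chi m A (weyl m A (zero_ext T a) (zero_ext T b)) p = 1"
  obtains s c a b where "s \<in> S" "cmod c = 1" "mat_mul m A s p = mat_scale c (weyl m A a b)"
    "\<And>q. q \<in> T \<Longrightarrow> m dvd a q \<and> m dvd b q"
proof -
  let ?W = "\<lambda>y. weyl m A (zero_ext T (fst y)) (zero_ext T (snd y))"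
  let ?Y = "confs m T \<times> confs m T"
  have fT: "finite T" using assms(1) finite_A finite_subset by blast
  have "(\<Sum>s\<in>S. \<Sum>y\<in>?Y. chi m A (?W y) (mat_mul m A s p)) \<noteq> 0"
  proof -
    let ?Y1 = "{y \<in> ?Y. \<forall>s\<in>S. chi m A (?W y) s = 1}"
    have "(\<Sum>s\<in>S. \<Sum>y\<in>?Y. chi m A (?W y) (mat_mul m A s p)) =
        (\<Sum>y\<in>?Y. \<Sum>s\<in>S. chi m A (?W y) (mat_mul m A s p))"
      by (rule sum.swap)
    also have "\<dots> = (\<Sum>y\<in>?Y. chi m A (?W y) p * (\<Sum>s\<in>S. chi m A (?W y) s))"
      using assms(2) by (simp add: chi_mul sum_distrib_left mult.commute)
    \<comment> \<open>Where the inner sum over \<open>S\<close> survives, the Pauli of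
      \<open>y\<close> commutes with \<open>S\<close>, and the assumption turns the factor for
      \<open>p\<close> into 1.\<close>
    also have "\<dots> = (\<Sum>y\<in>?Y. if y \<in> ?Y1 then of_nat (card S) else 0)"
      by (intro sum.cong refl, subst sum_chi_S) (use assms(3) in auto)
    also have "\<dots> = of_nat (card ?Y1 * card S)"
      using fT by (subst sum.If_cases) (auto simp: Int_def intro!: arg_cong [of _ _ card])
    also have "\<dots> \<noteq> 0"
    proof -
      \<comment> \<open>The trivial Pauli belongs to \<open>?Y1\<close>, so the total is
        positive.\<close>
      let ?z = "(\<lambda>q\<in>T. 0, \<lambda>q\<in>T. 0) :: 'q conf \<times> 'q conf"
      have "?W ?z = ident m A"
        by (intro weyl_trivial) (auto simp: zero_ext_def)
      then have "?z \<in> ?Y1" by (auto simp: confs_def)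
      moreover have "finite ?Y1" using fT by (auto intro: rev_finite_subset [of ?Y])
      ultimately have "0 < card ?Y1" unfolding card_gt_0_iff by blast
      moreover have "0 < card S" by (simp add: card_S)
      ultimately show ?thesis
        by (simp only: of_nat_eq_0_iff mult_eq_0_iff de_Morgan_disj neq0_conv simp_thms)
    qed
    finally show ?thesis .
  qed
  \<comment> \<open>A nonvanishing total has a nonvanishing term, and by \<open>sum_chi\<close> its
    \<open>s\<close> makes \<open>s p\<close> trivial on \<open>T\<close>.\<close>
  then obtain s where s: "s \<in> S" "(\<Sum>y\<in>?Y. chi m A (?W y) (mat_mul m A s p)) \<noteq> 0"
    by (meson sum.neutral)
  have "mat_mul m A s p \<in> paulis m A" using s assms(2) by (simp add: paulis_mul)
  then obtain c a b where c: "cmod c = 1" "mat_mul m A s p = mat_scale c (weyl m A a b)"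
    unfolding paulis_def by blast
  then have "\<forall>q\<in>T. m dvd a q \<and> m dvd b q"
    using s(2) sum_chi [OF finite_A m_pos assms(1) c(1), of a b] by (auto split: if_splits)
  then show thesis using that s(1) c by blast
qed

end

section \<open>Encodings\<close>

lemma app_unitary_inner:
  assumes "finite A" "unitary_op m A U" "v \<in> vects m A"
  shows "(\<Sum>x\<in>confs m A. cnj (mat_app m A U u x) * mat_app m A U v x) = (\<Sum>x\<in>confs m A. cnj (u x) * v x)"
proof -
  have adj: "(\<Sum>x\<in>confs m A. cnj (mat_app m A U u x) * w x) = (\<Sum>x\<in>confs m A. cnj (u x) * mat_app m A (dagger U) w x)" for w
    unfolding mat_app_def dagger_def
    by (simp add: sum_distrib_left sum_distrib_right mult_ac) (rule sum.swap)
  have "mat_app m A (dagger U) (mat_app m A U v) = v"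
    using assms by (simp flip: mat_app_mul)
  then show ?thesis by (simp add: adj)
qed

lemma funpow_app_in_vects [simp]: "v \<in> vects m A \<Longrightarrow> unitary_op m A U \<Longrightarrow> (mat_app m A U ^^ n) v \<in> vects m A"
  by (induction n) auto

lemma app_sum: "mat_app m B M (\<lambda>x. \<Sum>t\<in>T. v t x) = (\<lambda>x. \<Sum>t\<in>T. mat_app m B M (v t) x)"
  unfolding mat_app_def by (subst sum.swap) (simp add: sum_distrib_left)

text \<open>Up to phase the n-th power multiplies the exponents by n, so the m-th power is a scalar.
  Powers appear as iterated application to vectors, the form used for eigenvectors and for the
  encoded basis.\<close>

lemma paulis_funpow:
  assumes "finite A" "0 < m" "g \<in> paulis m A"
  obtains c where "cmod c = 1" "\<And>v. v \<in> vects m A \<Longrightarrow> (mat_app m A g ^^ m) v = (\<lambda>x. c * v x)"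
proof -
  obtain c a b where g: "cmod c = 1" "g = mat_scale c (weyl m A a b)"
    using assms unfolding paulis_def by blast
  have "\<exists>d. cmod d = 1 \<and> (\<forall>v\<in>vects m A. (mat_app m A g ^^ n) v =
      (\<lambda>x. d * mat_app m A (weyl m A (\<lambda>q. n * a q) (\<lambda>q. n * b q)) v x))" for n
  proof (induction n)
    case 0
    show ?case using assms by (intro exI [of _ 1]) (simp add: weyl_0)
  next
    case (Suc n)
    then obtain d where d: "cmod d = 1" "\<And>v. v \<in> vects m A \<Longrightarrow> (mat_app m A g ^^ n) v =
      (\<lambda>x. d * mat_app m A (weyl m A (\<lambda>q. n * a q) (\<lambda>q. n * b q)) v x)" by blast
    let ?e = "omega m ^ (\<Sum>q\<in>A. b q * (n * a q))"
    have "(mat_app m A g ^^ Suc n) v =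
      (\<lambda>x. (d * c * ?e) * mat_app m A (weyl m A (\<lambda>q. Suc n * a q) (\<lambda>q. Suc n * b q)) v x)"
      if "v \<in> vects m A" for v
    proof -
      have "(mat_app m A g ^^ Suc n) v = (\<lambda>x. d * mat_app m A (mat_mul m A g (weyl m A (\<lambda>q. n * a q) (\<lambda>q. n * b q))) v x)"
        using that by (simp add: d(2) app_scale mat_app_mul)
      then show ?thesis
        using assms(1,2) by (simp add: g(2) weyl_mul scale_app mult.assoc)
    qed
    then show ?case
      using d(1) g(1) by (intro exI [of _ "d * c * ?e"]) (simp add: norm_mult norm_power)
  qed
  then obtain d where "cmod d = 1" "\<And>v. v \<in> vects m A \<Longrightarrow> (mat_app m A g ^^ m) v =
      (\<lambda>x. d * mat_app m A (weyl m A (\<lambda>q. m * a q) (\<lambda>q. m * b q)) v x)" by meson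
  moreover have "weyl m A (\<lambda>q. m * a q) (\<lambda>q. m * b q) = ident m A"
    using assms by (intro weyl_trivial) auto
  ultimately show thesis
    using assms that by simp
qed

lemma paulis_root:
  assumes "finite A" "0 < m" "g \<in> paulis m A"
  obtains z where "cmod z = 1"
    "\<And>v. v \<in> vects m A \<Longrightarrow> (mat_app m A (mat_scale z g) ^^ m) v = v"
proof -
  obtain c where c: "cmod c = 1" "\<And>v. v \<in> vects m A \<Longrightarrow> (mat_app m A g ^^ m) v = (\<lambda>x. c * v x)"
    using paulis_funpow [OF assms] by blast
  \<comment> \<open>An m-th root of the inverse of \<open>c\<close>: rescaling by it makes the m-th
    power the identity.\<close>
  define z where "z = cis (- Arg c / m)"
  have "cis (Arg c) = c"
    using rcis_cmod_Arg [of c] c(1) by (simp add: rcis_def)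
  moreover have "z ^ m = cis (- Arg c)"
    using assms(2) by (simp add: z_def DeMoivre)
  ultimately have z: "z ^ m * c = 1"
    by (metis add.left_inverse cis_mult cis_zero)
  have pow: "(mat_app m A (mat_scale z g) ^^ n) v = (\<lambda>x. z ^ n * (mat_app m A g ^^ n) v x)" for n v
    by (induction n) (simp_all add: scale_app app_scale mult.assoc)
  have "(mat_app m A (mat_scale z g) ^^ m) v = v" if "v \<in> vects m A" for v
    using that z by (simp add: pow c(2) flip: mult.assoc)
  moreover have "cmod z = 1" by (simp add: z_def)
  ultimately show thesis using that by blast
qed

text \<open>A discrete Fourier transform along the orbit of \<open>v\<close>: its components add up
  to \<open>m\<close> times \<open>v\<close>, so one is nonzero, and it is an eigenvector. The last
  clause preserves eigenvalue equations of operators commuting with \<open>z\<close>, which makes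
  the step repeatable.\<close>

lemma pauli_eigenvector:
  assumes "finite A" "0 < m" "z \<in> paulis m A" "v \<in> vects m A" "v \<noteq> (\<lambda>x. 0)"
  obtains d w where "cmod d = 1" "w \<in> vects m A" "w \<noteq> (\<lambda>x. 0)" "mat_app m A z w = (\<lambda>x. d * w x)"
    "\<And>g e. mat_mul m A g z = mat_mul m A z g \<Longrightarrow> mat_app m A g v = (\<lambda>x. e * v x) \<Longrightarrow>
       mat_app m A g w = (\<lambda>x. e * w x)"
proof -
  obtain y where y: "cmod y = 1" "\<And>v. v \<in> vects m A \<Longrightarrow> (mat_app m A (mat_scale y z) ^^ m) v = v"
    using paulis_root [OF assms(1-3)] by blast
  define z' where "z' = mat_scale y z"
  have z': "unitary_op m A z'"
    unfolding z'_def using assms y by (intro unitary_scale paulis_unitary)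
  define u where "u t = (mat_app m A z' ^^ t) v" for t
  have u: "u t \<in> vects m A" for t using assms z' by (simp add: u_def)
  have u_Suc: "mat_app m A z' (u t) = u (Suc t)" for t by (simp add: u_def)
  have u_m: "u m = u 0" using y(2) assms(4) by (simp add: u_def z'_def)
  define w where "w j = (\<lambda>x. \<Sum>t<m. omega m ^ (j * t) * u t x)" for j
  have "(\<Sum>j<m. w j x) = of_nat m * v x" for x
  proof -
    have "(\<Sum>j<m. w j x) = (\<Sum>t<m. (\<Sum>j<m. omega m ^ (t * j)) * u t x)"
      unfolding w_def by (subst sum.swap) (simp add: sum_distrib_left mult.commute)
    \<comment> \<open>Below \<open>m\<close>, only \<open>t = 0\<close> is divisible by
      \<open>m\<close>.\<close>
    also have "\<dots> = (\<Sum>t<m. if t = 0 then of_nat m * v x else 0)"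
      using assms(2) by (intro sum.cong refl) (auto simp: sum_omega_power u_def dest: nat_dvd_not_less)
    finally show ?thesis using assms(2) by simp
  qed
  moreover obtain x where "v x \<noteq> 0" using assms(5) by auto
  ultimately have "(\<Sum>j<m. w j x) \<noteq> 0" using assms(2) by simp
  then obtain j where j: "w j x \<noteq> 0" by (meson sum.neutral)
  have w_vects: "w j \<in> vects m A"
    unfolding vects_def w_def
  proof clarify
    fix x assume "(\<Sum>t<m. omega m ^ (j * t) * u t x) \<noteq> 0"
    then obtain t where "u t x \<noteq> 0" by (metis (no_types, lifting) mult_zero_right sum.neutral)
    then show "x \<in> confs m A" using u [of t] by (auto simp: vects_def)
  qed
  \<comment> \<open>Applying \<open>z'\<close> moves the orbit one step on; the sum closes up
    because \<open>u m = u 0\<close> and \<open>omega m ^ m = 1\<close>.\<close>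
  have "omega m ^ j * mat_app m A z' (w j) x = w j x" for x
  proof -
    have "omega m ^ j * mat_app m A z' (w j) x = (\<Sum>t<m. omega m ^ (j * Suc t) * u (Suc t) x)"
      unfolding w_def app_sum app_scale u_Suc by (simp add: sum_distrib_left power_add mult.assoc)
    also have "\<dots> = w j x"
      using sum.lessThan_Suc_shift [of "\<lambda>t. omega m ^ (j * t) * u t x" m] omega_power_m [OF assms(2)]
      by (simp add: w_def u_m mult.commute [of j] power_mult)
    finally show ?thesis .
  qed
  then have e: "omega m ^ j * (y * mat_app m A z (w j) x) = w j x" for x
    by (simp add: z'_def scale_app)
  have eig: "mat_app m A z (w j) x = cnj (omega m ^ j * y) * w j x" for x
  proof -
    let ?c = "omega m ^ j * y"
    have "cnj ?c * w j x = (cnj ?c * ?c) * mat_app m A z (w j) x"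
      using e [of x] by (simp only: mult.assoc)
    also have "cnj ?c * ?c = 1"
      using y(1) by (intro cnj_mult_eq_1) (simp add: norm_mult norm_power)
    finally show ?thesis by simp
  qed
  show thesis
  proof (rule that)
    show "cmod (cnj (omega m ^ j * y)) = 1" using y(1) by (simp add: norm_mult norm_power)
    show "w j \<in> vects m A" by (fact w_vects)
    show "w j \<noteq> (\<lambda>x. 0)" using j by auto
    show "mat_app m A z (w j) = (\<lambda>x. cnj (omega m ^ j * y) * w j x)" using eig by auto
    fix g e assume g: "mat_mul m A g z = mat_mul m A z g" "mat_app m A g v = (\<lambda>x. e * v x)"
    have "mat_app m A g (u t) = (\<lambda>x. e * u t x)" for t
    proof (induction t)
      case 0
      then show ?case using g(2) by (simp add: u_def)
    next
      case (Suc t)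
      have "mat_app m A g (u (Suc t)) = mat_app m A (mat_mul m A g z') (u t)"
        by (simp add: mat_app_mul flip: u_Suc)
      also have "mat_mul m A g z' = mat_mul m A z' g" by (simp add: z'_def g(1))
      finally show ?case by (simp add: mat_app_mul Suc app_scale flip: u_Suc)
    qed
    then show "mat_app m A g (w j) = (\<lambda>x. e * w j x)"
      unfolding w_def app_sum app_scale by (simp add: sum_distrib_left mult_ac)
  qed
qed

text \<open>Earlier eigenvalue equations survive each use of \<open>pauli_eigenvector\<close>
  because the operators commute. The final clause, with a stabilizer for \<open>g\<close> and
  \<open>e = 1\<close>, keeps the vector in the code space.\<close>

lemma pauli_joint_eigenvector:
  assumes "finite A" "0 < m" "set zs \<subseteq> paulis m A"
    and "\<forall>z\<in>set zs. \<forall>z'\<in>set zs. mat_mul m A z z' = mat_mul m A z' z"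
    and "v \<in> vects m A" "v \<noteq> (\<lambda>x. 0)"
  shows "\<exists>w\<in>vects m A. w \<noteq> (\<lambda>x. 0) \<and>
    (\<forall>z\<in>set zs. \<exists>d. cmod d = 1 \<and> mat_app m A z w = (\<lambda>x. d * w x)) \<and>
    (\<forall>g e. (\<forall>z\<in>set zs. mat_mul m A g z = mat_mul m A z g) \<longrightarrow> mat_app m A g v = (\<lambda>x. e * v x) \<longrightarrow>
       mat_app m A g w = (\<lambda>x. e * w x))"
proof -
  define Q where "Q zs w \<longleftrightarrow> w \<in> vects m A \<and> w \<noteq> (\<lambda>x. 0) \<and>
    (\<forall>z\<in>set zs. \<exists>d. cmod d = 1 \<and> mat_app m A z w = (\<lambda>x. d * w x)) \<and>
    (\<forall>g e. (\<forall>z\<in>set zs. mat_mul m A g z = mat_mul m A z g) \<longrightarrow> mat_app m A g v = (\<lambda>x. e * v x) \<longrightarrow>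
       mat_app m A g w = (\<lambda>x. e * w x))" for zs w
  define comm where "comm zs \<longleftrightarrow> (\<forall>z\<in>set zs. \<forall>z'\<in>set zs. mat_mul m A z z' = mat_mul m A z' z)" for zs
  have "\<exists>w. Q zs w" if "set zs \<subseteq> paulis m A" "comm zs" for zs
    using that
  proof (induction zs)
    case Nil
    then show ?case using assms(5,6) by (auto simp: Q_def)
  next
    case (Cons z zs)
    have "comm zs" using Cons.prems by (simp add: comm_def)
    then obtain w where w: "Q zs w" using Cons by auto
    have z: "z \<in> paulis m A" using Cons.prems by simp
    obtain d w' where w': "cmod d = 1" "w' \<in> vects m A" "w' \<noteq> (\<lambda>x. 0)" "mat_app m A z w' = (\<lambda>x. d * w' x)"
      and pres: "\<And>g e. mat_mul m A g z = mat_mul m A z g \<Longrightarrow> mat_app m A g w = (\<lambda>x. e * w x) \<Longrightarrow>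
         mat_app m A g w' = (\<lambda>x. e * w' x)"
      using pauli_eigenvector [OF assms(1,2) z, of w] w unfolding Q_def by blast
    have "\<exists>d. cmod d = 1 \<and> mat_app m A y w' = (\<lambda>x. d * w' x)" if y: "y \<in> set zs" for y
    proof -
      obtain c where "cmod c = 1" "mat_app m A y w = (\<lambda>x. c * w x)"
        using w y unfolding Q_def by blast
      moreover have "mat_mul m A y z = mat_mul m A z y"
        using Cons.prems(2) y unfolding comm_def by (meson list.set_intros)
      ultimately show ?thesis using pres by blast
    qed
    moreover have "mat_app m A g w' = (\<lambda>x. e * w' x)"
      if "\<forall>y\<in>set (z # zs). mat_mul m A g y = mat_mul m A y g" "mat_app m A g v = (\<lambda>x. e * v x)" for g e
    proof (rule pres)
      show "mat_mul m A g z = mat_mul m A z g" using that(1) by simp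
      show "mat_app m A g w = (\<lambda>x. e * w x)" using w that unfolding Q_def by simp
    qed
    ultimately have "Q (z # zs) w'" using w' unfolding Q_def by auto
    then show ?case by (rule exI [of _ w'])
  qed
  then obtain w where "Q zs w" using assms(3,4) comm_def by blast
  then show ?thesis unfolding Q_def by blast
qed

section \<open>The projection onto the code space\<close>

context stabilizer
begin

text \<open>The average over the stabilizer group, which is the orthogonal projection onto the code
  space.\<close>

definition proj :: "'q operator" where
  "proj = (\<lambda>x y. (\<Sum>s\<in>S. s x y) / of_nat (card S))"

lemma mul_proj: "mat_mul m A M proj = (\<lambda>x y. (\<Sum>s\<in>S. mat_mul m A M s x y) / of_nat (card S))"
  unfolding mat_mul_def proj_def
  by (subst sum.swap) (simp add: sum_distrib_left sum_divide_distrib)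

lemma proj_mul: "mat_mul m A proj M = (\<lambda>x y. (\<Sum>s\<in>S. mat_mul m A s M x y) / of_nat (card S))"
  unfolding mat_mul_def proj_def
  by (subst sum.swap) (simp add: sum_distrib_right sum_divide_distrib)

lemma proj_app: "mat_app m A proj v = (\<lambda>x. (\<Sum>s\<in>S. mat_app m A s v x) / of_nat (card S))"
  unfolding mat_app_def proj_def
  by (subst sum.swap) (simp add: sum_distrib_right sum_divide_distrib)

lemma card_S_nonzero [simp]: "card S \<noteq> 0"
  by (simp add: card_S)

lemma proj_in_matrices [simp]: "proj \<in> matrices m A A"
  unfolding matrices_def
proof clarify
  fix x y assume "proj x y \<noteq> 0"
  then have "(\<Sum>s\<in>S. s x y) \<noteq> 0" by (auto simp: proj_def)
  then obtain s where "s \<in> S" "s x y \<noteq> 0" by (meson sum.neutral)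
  then show "x \<in> confs m A \<and> y \<in> confs m A"
    using matrices_0 [OF unitary_in_matrices [OF S_unitary]] by blast
qed

lemma mul_S_proj:
  assumes "s \<in> S" shows "mat_mul m A s proj = proj"
proof -
  have "bij_betw (mat_mul m A s) S S"
    by (rule bij_betw_byWitness [where f' = "mat_mul m A (dagger s)"])
      (use assms in \<open>auto simp: unitary_dagger_mul_cancel [where B = A] unitary_mul_dagger_cancel [where B = A]\<close>)
  then have "(\<Sum>t\<in>S. mat_mul m A s t x y) = (\<Sum>t\<in>S. t x y)" for x y
    using sum.reindex_bij_betw [of "mat_mul m A s" S S "\<lambda>t. t x y"] by simp
  then show ?thesis by (simp add: mul_proj) (simp add: proj_def)
qed

lemma proj_proj: "mat_mul m A proj proj = proj"
  by (subst proj_mul) (simp add: mul_S_proj cong: sum.cong)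

lemma dagger_proj: "dagger proj = proj"
proof -
  have "bij_betw dagger S S"
    by (rule bij_betw_byWitness [where f' = dagger]) auto
  then have "(\<Sum>s\<in>S. dagger s x y) = (\<Sum>t\<in>S. t x y)" for x y
    using sum.reindex_bij_betw [of dagger S S "\<lambda>t. t x y"] by simp
  then show ?thesis
    by (simp add: proj_def dagger_def fun_eq_iff)
qed

text \<open>As the character sum of \<open>s\<close> vanishes, some Pauli \<open>g\<close> has
  \<open>chi m A g s \<noteq> 1\<close>. Conjugation by \<open>g\<close> preserves the trace and
  also multiplies it by this number.\<close>

lemma trace_S:
  assumes "s \<in> S" "s \<noteq> ident m A"
  shows "mat_trace m A s = 0"
proof -
  obtain c a b where s: "s = mat_scale c (weyl m A a b)" "cmod c = 1"
    using S_paulis [OF assms(1)] unfolding paulis_def by blast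
  let ?W = "\<lambda>y. weyl m A (zero_ext A (fst y)) (zero_ext A (snd y))"
  have "(\<Sum>y\<in>confs m A \<times> confs m A. chi m A (?W y) s) = 0"
    using sum_chi [of A m A c a b] s S_trivial_iff [OF assms(1) s] assms(2) by simp
  moreover have "card (confs m A \<times> confs m A) \<noteq> 0" by (simp add: card_cartesian_product card_confs)
  ultimately obtain g where g: "g \<in> paulis m A" "chi m A g s \<noteq> 1"
    by (metis (no_types, lifting) of_nat_eq_0_iff real_of_card sum.cong sum_constant mult.right_neutral weyl_in_paulis)
  have "mat_trace m A s = mat_trace m A (mat_mul m A (mat_mul m A s (dagger g)) g)"
    using assms g by (simp add: mat_mul_assoc paulis_unitary)
  also have "\<dots> = mat_trace m A (mat_mul m A (mat_mul m A g s) (dagger g))"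
    by (subst mat_trace_mul_commute) (simp add: mat_mul_assoc)
  also have "mat_mul m A g s = mat_scale (chi m A g s) (mat_mul m A s g)"
    using assms g by (intro chi_paulis) auto
  also have "mat_trace m A (mat_mul m A (mat_scale (chi m A g s) (mat_mul m A s g)) (dagger g)) =
      chi m A g s * mat_trace m A s"
    using assms g by (simp add: mat_mul_assoc paulis_unitary) (simp add: mat_trace_def mat_scale_def sum_distrib_left)
  finally show ?thesis using g(2) by simp
qed

text \<open>Only the identity contributes. The value is the rank of the projection, against which
  the encoding is measured in \<open>ex_encoding\<close>.\<close>

lemma trace_proj: "mat_trace m A proj = of_nat (m ^ card L)"
proof -
  have "mat_trace m A proj = (\<Sum>s\<in>S. mat_trace m A s) / of_nat (card S)"
    unfolding mat_trace_def proj_def by (subst sum.swap) (simp add: sum_divide_distrib)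
  also have "(\<Sum>s\<in>S. mat_trace m A s) = (\<Sum>s\<in>S. if s = ident m A then of_nat (m ^ card A) else 0)"
    by (intro sum.cong refl) (auto simp: trace_S mat_trace_ident)
  also have "\<dots> = of_nat (m ^ card A)" by simp
  also have "m ^ card A = m ^ card L * card S"
    using k_le_n by (simp add: card_S card_L flip: power_add)
  finally show ?thesis by simp
qed

lemma code_spaceD: "v \<in> code_space m C \<Longrightarrow> s \<in> S \<Longrightarrow> mat_app m A s v = v"
  and code_space_vects: "v \<in> code_space m C \<Longrightarrow> v \<in> vects m A"
  unfolding code_space_def by auto

lemma proj_code_space: "v \<in> code_space m C \<Longrightarrow> mat_app m A proj v = v"
  by (simp add: proj_app code_spaceD)

lemma commute_ZZ: "i \<in> L \<Longrightarrow> j \<in> L \<Longrightarrow> mat_mul m A (log_Z C i) (log_Z C j) = mat_mul m A (log_Z C j) (log_Z C i)"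
  and commute_XX: "i \<in> L \<Longrightarrow> j \<in> L \<Longrightarrow> mat_mul m A (log_X C i) (log_X C j) = mat_mul m A (log_X C j) (log_X C i)"
  and commute_ZX: "i \<in> L \<Longrightarrow> j \<in> L \<Longrightarrow> mat_mul m A (log_Z C i) (log_X C j) =
      mat_scale (if i = j then omega m else 1) (mat_mul m A (log_X C j) (log_Z C i))"
  using chi_paulis [of A m "log_Z C i" "log_Z C j"] chi_paulis [of A m "log_X C i" "log_X C j"]
    chi_paulis [of A m "log_Z C i" "log_X C j"] by (simp_all add: chi_ZZ chi_XX chi_ZX)

text \<open>The encoded all-zero state. The eigenvalues \<open>d i\<close> are arbitrary phases,
  since the m-th power of \<open>log_Z C i\<close> may be a scalar other than 1.\<close>

lemma zero_logical_state:
  obtains v d where "v \<in> code_space m C" "(\<Sum>x\<in>confs m A. cnj (v x) * v x) = 1"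
    "\<And>i. i \<in> L \<Longrightarrow> cmod (d i) = 1 \<and> mat_app m A (log_Z C i) v = (\<lambda>x. d i * v x)"
proof -
  obtain u where u: "u \<in> code_space m C" "u \<noteq> (\<lambda>x. 0)"
    using code_space_nonzero by blast
  obtain w where w: "w \<in> vects m A" "w \<noteq> (\<lambda>x. 0)"
    and eig: "\<And>i. i \<in> L \<Longrightarrow> \<exists>d. cmod d = 1 \<and> mat_app m A (log_Z C i) w = (\<lambda>x. d * w x)"
    and fixed: "\<And>g e. (\<forall>i\<in>L. mat_mul m A g (log_Z C i) = mat_mul m A (log_Z C i) g) \<Longrightarrow>
       mat_app m A g u = (\<lambda>x. e * u x) \<Longrightarrow> mat_app m A g w = (\<lambda>x. e * w x)"
    using pauli_joint_eigenvector [OF finite_A m_pos _ _ code_space_vects [OF u(1)] u(2),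
        of "map (log_Z C) (logicals C)"] commute_ZZ
    by (auto simp: image_subset_iff)
  have w_fixed: "mat_app m A s w = w" if "s \<in> S" for s
    using fixed [of s 1] log_Z_commute_S that code_spaceD [OF u(1) that] by simp
  define N where "N = (\<Sum>x\<in>confs m A. (cmod (w x))\<^sup>2)"
  have "N \<noteq> 0"
  proof
    assume "N = 0"
    then have "\<forall>x\<in>confs m A. w x = 0" unfolding N_def by (simp add: sum_nonneg_eq_0_iff)
    then show False using w by (auto simp: vects_def fun_eq_iff)
  qed
  moreover have "N \<ge> 0" unfolding N_def by (simp add: sum_nonneg)
  ultimately have N: "N > 0" by simp
  define r where "r = complex_of_real (1 / sqrt N)"
  define v where "v = (\<lambda>x. r * w x)"
  have "(1 / sqrt N) * (1 / sqrt N) * N = 1" using N by simp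
  then have r: "cnj r * r * of_real N = 1"
    unfolding r_def complex_cnj_complex_of_real by (simp only: of_real_1 flip: of_real_mult)
  have "(\<Sum>x\<in>confs m A. cnj (v x) * v x) = cnj r * r * (\<Sum>x\<in>confs m A. of_real ((cmod (w x))\<^sup>2))"
    unfolding v_def complex_norm_square by (simp add: sum_distrib_left mult_ac)
  also have "\<dots> = 1" using r by (simp add: N_def)
  finally have norm: "(\<Sum>x\<in>confs m A. cnj (v x) * v x) = 1" .
  obtain d where d: "\<And>i. i \<in> L \<Longrightarrow> cmod (d i) = 1 \<and> mat_app m A (log_Z C i) w = (\<lambda>x. d i * w x)"
    using eig by metis
  show thesis
  proof (rule that [OF _ norm])
    show "v \<in> code_space m C"
      using w w_fixed by (auto simp: code_space_def v_def app_scale vects_def)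
    show "cmod (d i) = 1 \<and> mat_app m A (log_Z C i) v = (\<lambda>x. d i * v x)" if "i \<in> L" for i
      using d [OF that] by (simp add: v_def app_scale mult_ac)
  qed
qed

end

lemma funpow_commute: "f (g x) = g (f x) \<Longrightarrow> (\<And>y. f (g y) = g (f y)) \<Longrightarrow> f ((g ^^ n) x) = (g ^^ n) (f x)"
  by (induction n) auto

section \<open>Construction of an encoding\<close>

context stabilizer
begin

text \<open>Error detection, in the form of \<open>error_detecting_local\<close>, is exactly the
  hypothesis of \<open>cleaning\<close> for a logical generator.\<close>

lemma local_cleaning:
  assumes "partition_on A P" "error_detecting m C P" "T \<in> P" "i \<in> L"
    and "h \<in> {log_X C i, log_Z C i}"
  obtains s c a b where "s \<in> S" "cmod c = 1" "mat_mul m A s h = mat_scale c (weyl m A a b)"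
    "\<And>q. q \<in> T \<Longrightarrow> m dvd a q \<and> m dvd b q"
proof (rule cleaning)
  show "T \<subseteq> A" using assms(1,3) by (auto simp: partition_on_def)
  show "h \<in> paulis m A" using assms(4,5) by auto
  show "chi m A (weyl m A (zero_ext T a) (zero_ext T b)) h = 1"
    if "\<forall>s\<in>S. chi m A (weyl m A (zero_ext T a) (zero_ext T b)) s = 1" for a b
    using error_detecting_local [OF assms(1-3) refl _ assms(4)] that assms(5) by auto
qed (use that in blast)

text \<open>The logical basis state \<open>y\<close> is obtained by applying powers
  \<open>y i\<close> of the logical X's to the encoded zero state. Different \<open>y\<close> differ
  in an eigenvalue of some \<open>log_Z C j\<close>, whence orthogonality; comparing traces gives
  surjectivity. The two extra conclusions serve products of codeblocks: the block projections
  multiply to that of the combined code, and stabilizers disappear next to \<open>E\<close>.\<close>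

lemma ex_encoding:
  obtains E where "encoding m C E" "mat_mul m L E (dagger E) = proj"
    "\<And>s. s \<in> S \<Longrightarrow> mat_mul m A s E = E"
proof -
  obtain v d where v: "v \<in> code_space m C" "(\<Sum>x\<in>confs m A. cnj (v x) * v x) = 1"
    and d: "\<And>i. i \<in> L \<Longrightarrow> cmod (d i) = 1 \<and> mat_app m A (log_Z C i) v = (\<lambda>x. d i * v x)"
    using zero_logical_state by blast
  have "\<exists>z. cmod z = 1 \<and> (\<forall>v\<in>vects m A. (mat_app m A (mat_scale z (log_X C i)) ^^ m) v = v)" if "i \<in> L" for i
    by (rule paulis_root [OF finite_A m_pos log_X_paulis [OF that]]) blast
  \<comment> \<open>With this rescaling the m-th power of each logical X is the identity, so the
    exponents of the basis states can be read modulo \<open>m\<close>, as the cyclic shift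
    \<open>pauli_X\<close> demands.\<close>
  then obtain \<nu> where \<nu>: "\<And>i. i \<in> L \<Longrightarrow> cmod (\<nu> i) = 1"
    "\<And>i v. i \<in> L \<Longrightarrow> v \<in> vects m A \<Longrightarrow> (mat_app m A (mat_scale (\<nu> i) (log_X C i)) ^^ m) v = v"
    by metis
  define X where "X i = mat_app m A (mat_scale (\<nu> i) (log_X C i))" for i
  define Z where "Z i = mat_app m A (log_Z C i)" for i
  have X_scale: "X i (\<lambda>x. c * u x) = (\<lambda>x. c * X i u x)" for i u c
    by (simp add: X_def app_scale)
  have XX: "X i (X j u) = X j (X i u)" if "i \<in> L" "j \<in> L" for i j u
    using commute_XX [OF that] by (simp add: X_def mult.commute flip: mat_app_mul)
  have ZX: "Z i (X j u) = (\<lambda>x. (if i = j then omega m else 1) * X j (Z i u) x)" if "i \<in> L" "j \<in> L" for i j u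
    using commute_ZX [OF that] by (auto simp: X_def Z_def scale_app app_scale mult.left_commute simp flip: mat_app_mul)
  have sX: "mat_app m A s (X j u) = X j (mat_app m A s u)" if "s \<in> S" "j \<in> L" for s j u
    using log_X_commute_S [OF that(2,1)] by (simp add: X_def flip: mat_app_mul)
  have X_unitary: "unitary_op m A (mat_scale (\<nu> i) (log_X C i))" if "i \<in> L" for i
    using \<nu>(1) that by (intro unitary_scale paulis_unitary) auto
  have X_vects: "X i u \<in> vects m A" if "i \<in> L" for i u
    unfolding X_def using X_unitary that by simp

  \<comment> \<open>A list in place of \<open>L\<close> allows induction; by \<open>XX\<close> its
    order is immaterial.\<close>
  define e where "e y xs = foldr (\<lambda>i. X i ^^ y i) xs v" for y :: "'l \<Rightarrow> nat" and xs
  have e_vects: "e y xs \<in> vects m A" if "set xs \<subseteq> L" for y xs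
    using that
  proof (induction xs)
    case Nil
    then show ?case using v(1) by (simp add: e_def code_space_vects)
  next
    case (Cons i xs)
    then have "X i ^^ y i = mat_app m A (mat_scale (\<nu> i) (log_X C i)) ^^ y i" "e y xs \<in> vects m A"
      by (simp_all add: X_def)
    then show ?case using Cons.prems X_unitary by (simp add: e_def)
  qed
  have e_X: "X j (e y xs) = e (y(j := Suc (y j))) xs" if "set xs \<subseteq> L" "distinct xs" "j \<in> set xs" for j y xs
    using that
  proof (induction xs)
    case (Cons i xs)
    have ij: "i \<in> L" "j \<in> L" using Cons.prems by auto
    show ?case
    proof (cases "i = j")
      case True
      then have "e (y(j := Suc (y j))) xs = e y xs"
        unfolding e_def using Cons.prems(2) by (intro foldr_cong) auto
      then show ?thesis using True by (simp add: e_def)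
    next
      case False
      have "X j (e y (i # xs)) = (X i ^^ y i) (X j (e y xs))"
        using XX [OF ij(2,1)] by (simp add: e_def funpow_commute)
      then show ?thesis using False Cons by (simp add: e_def)
    qed
  qed simp
  have e_m: "e (y(j := m)) xs = e (y(j := 0)) xs" if "set xs \<subseteq> L" "distinct xs" for j y xs
    using that
  proof (induction xs)
    case (Cons i xs)
    show ?case
    proof (cases "i = j")
      case True
      then have "e (y(j := m)) xs = e (y(j := 0)) xs"
        unfolding e_def using Cons.prems(2) by (intro foldr_cong) auto
      moreover have "(X j ^^ m) (e (y(j := 0)) xs) = e (y(j := 0)) xs"
        unfolding X_def using \<nu>(2) True Cons.prems e_vects by simp
      ultimately show ?thesis using True by (simp add: e_def)
    next
      case False
      then show ?thesis using Cons by (simp add: e_def)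
    qed
  qed (simp add: e_def)
  have Z_pow: "Z j ((X i ^^ n) u) = (\<lambda>x. (if i = j then omega m ^ n else 1) * (X i ^^ n) (Z j u) x)"
    if "i \<in> L" "j \<in> L" for i j n u
    by (induction n) (auto simp: ZX [OF that(2,1)] X_scale)
  have pow_scale: "(X i ^^ n) (\<lambda>x. c * u x) = (\<lambda>x. c * (X i ^^ n) u x)" for i n u c
    by (induction n) (auto simp: X_scale)
  have e_Z: "Z j (e y xs) = (\<lambda>x. (if j \<in> set xs then omega m ^ y j else 1) * d j * e y xs x)"
    if "set xs \<subseteq> L" "distinct xs" "j \<in> L" for j y xs
    using that
  proof (induction xs)
    case Nil
    then show ?case using d by (simp add: e_def Z_def)
  next
    case (Cons i xs)
    then have "Z j (e y (i # xs)) = (\<lambda>x. (if i = j then omega m ^ y i else 1) * (X i ^^ y i) (Z j (e y xs)) x)"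
      using Z_pow [of i j "y i" "e y xs"] by (simp add: e_def)
    also have "Z j (e y xs) = (\<lambda>x. (if j \<in> set xs then omega m ^ y j else 1) * d j * e y xs x)"
      using Cons by auto
    finally show ?case
      using Cons.prems(2) by (auto simp: pow_scale e_def)
  qed
  have e_S: "mat_app m A s (e y xs) = e y xs" if "set xs \<subseteq> L" "s \<in> S" for s y xs
    using that
  proof (induction xs)
    case Nil
    then show ?case using v(1) by (simp add: e_def code_spaceD)
  next
    case (Cons i xs)
    have "mat_app m A s ((X i ^^ y i) (e y xs)) = (X i ^^ y i) (mat_app m A s (e y xs))"
      using sX Cons.prems by (intro funpow_commute) auto
    then show ?case using Cons by (simp add: e_def)
  qed
  have e_norm: "(\<Sum>x\<in>confs m A. cnj (e y xs x) * e y xs x) = 1" if "set xs \<subseteq> L" for y xs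
    using that
  proof (induction xs)
    case Nil
    then show ?case using v(2) by (simp add: e_def)
  next
    case (Cons i xs)
    have u: "(\<Sum>x\<in>confs m A. cnj ((X i ^^ n) (e y xs) x) * (X i ^^ n) (e y xs) x) = 1" for n
    proof (induction n)
      case 0
      then show ?case using Cons by simp
    next
      case (Suc n)
      have "(X i ^^ n) (e y xs) \<in> vects m A"
        unfolding X_def using X_unitary e_vects Cons.prems by simp
      then show ?case
        using Suc app_unitary_inner [OF finite_A X_unitary, of i] Cons.prems
        by (simp add: X_def)
    qed
    then show ?case by (simp add: e_def)
  qed

  define E where "E x y = (if y \<in> confs m L then e y (logicals C) x else 0)" for x y
  \<comment> \<open>From here on the same names denote the facts for the full list of logical
    qudits.\<close>
  note e_vects = e_vects [of "logicals C", simplified]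
    and e_X = e_X [OF subset_refl distinct_logicals]
    and e_m = e_m [OF subset_refl distinct_logicals]
    and e_Z = e_Z [OF subset_refl distinct_logicals]
    and e_S = e_S [OF subset_refl] and e_norm = e_norm [OF subset_refl]
  have E: "E \<in> matrices m A L"
    using e_vects by (auto simp: matrices_def E_def vects_def)
  have fL: "finite L" by simp
  have mul_E: "mat_mul m A M E = (\<lambda>x y. if y \<in> confs m L then mat_app m A M (e y (logicals C)) x else 0)" for M
    by (auto simp: mat_mul_def mat_app_def E_def fun_eq_iff)
  have E_X: "mat_mul m L E (pauli_X m L j) = mat_mul m A (mat_scale (\<nu> j) (log_X C j)) E" if j: "j \<in> L" for j
  proof (intro ext)
    fix x y
    show "mat_mul m L E (pauli_X m L j) x y = mat_mul m A (mat_scale (\<nu> j) (log_X C j)) E x y"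
    proof (cases "y \<in> confs m L")
      case True
      let ?y = "y(j := (y j + 1) mod m)"
      have y: "?y \<in> confs m L" "y j < m" using True j by (auto simp: confs_def PiE_iff extensional_def)
      have "mat_mul m L E (pauli_X m L j) x y = (\<Sum>z\<in>confs m L. if z = ?y then E x z else 0)"
        unfolding mat_mul_def pauli_X_def using True by (intro sum.cong refl) auto
      also have "\<dots> = e ?y (logicals C) x" using y by (simp add: E_def)
      \<comment> \<open>\<open>Suc (y j)\<close> is already reduced unless it equals
        \<open>m\<close>, the case settled by \<open>e_m\<close>.\<close>
      also have "e ?y (logicals C) = e (y(j := Suc (y j))) (logicals C)"
      proof (cases "Suc (y j) = m")
        case True
        then show ?thesis using e_m [of y j] by simp
      next
        case False
        then show ?thesis using y(2) by simp
      qed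
      also have "\<dots> x = mat_mul m A (mat_scale (\<nu> j) (log_X C j)) E x y"
        unfolding mul_E using True e_X [OF j, of y] by (simp add: X_def)
      finally show ?thesis .
    next
      case False
      then show ?thesis by (simp add: mat_mul_def pauli_X_def E_def)
    qed
  qed
  have E_Z: "mat_mul m A (log_Z C j) E = mat_scale (d j) (mat_mul m L E (pauli_Z m L j))" if j: "j \<in> L" for j
  proof (intro ext)
    fix x y
    have "mat_mul m L E (pauli_Z m L j) x y = (\<Sum>z\<in>confs m L. if z = y then E x y * omega m ^ y j else 0)"
      unfolding mat_mul_def pauli_Z_def by (intro sum.cong refl) auto
    also have "\<dots> = E x y * omega m ^ y j" by (auto simp: E_def)
    finally show "mat_mul m A (log_Z C j) E x y = mat_scale (d j) (mat_mul m L E (pauli_Z m L j)) x y"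
      using e_Z [OF j, of y] j by (simp add: mul_E mat_scale_def E_def Z_def)
  qed
  have EE: "mat_mul m A (dagger E) E = ident m L"
  proof (intro ext)
    fix y y'
    have G: "mat_mul m A (dagger E) E y y' = (if y \<in> confs m L \<and> y' \<in> confs m L then
        (\<Sum>x\<in>confs m A. cnj (e y (logicals C) x) * e y' (logicals C) x) else 0)"
      by (auto simp: mat_mul_def dagger_def E_def)
    have "(\<Sum>x\<in>confs m A. cnj (e y (logicals C) x) * e y' (logicals C) x) = 0" (is "?s = 0")
      if y: "y \<in> confs m L" "y' \<in> confs m L" "y \<noteq> y'"
    proof -
      obtain j where j: "j \<in> L" "y j \<noteq> y' j"
        using y unfolding confs_def by (metis PiE_ext)
      \<comment> \<open>\<open>log_Z C j\<close> is unitary and leaves the inner product unchanged,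
        while its two eigenvalues multiply it by a number other than 1.\<close>
      have "?s = (\<Sum>x\<in>confs m A. cnj (Z j (e y (logicals C)) x) * Z j (e y' (logicals C)) x)"
        unfolding Z_def using j(1) e_vects by (simp add: app_unitary_inner paulis_unitary)
      also have "\<dots> = (cnj (d j) * d j) * (cnj (omega m ^ y j) * omega m ^ y' j) * ?s"
        unfolding e_Z [OF j(1)] using j(1) by (simp add: sum_distrib_left mult_ac)
      also have "cnj (d j) * d j = 1" using d j(1) by simp
      finally have s: "?s = (cnj (omega m ^ y j) * omega m ^ y' j) * ?s"
        unfolding mult_1_left .
      show "?s = 0"
      proof (rule ccontr)
        assume "?s \<noteq> 0"
        have cancel: "a = 1" if "t = a * t" "t \<noteq> 0" for a t :: complex
          using that by simp
        have "cnj (omega m ^ y j) * omega m ^ y' j = 1"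
          by (rule cancel [OF s \<open>?s \<noteq> 0\<close>])
        then have "omega m ^ y j * cnj (omega m ^ y j) * omega m ^ y' j = omega m ^ y j"
          by (simp only: mult.assoc mult_1_right)
        then have "omega m ^ y' j = omega m ^ y j"
          by (simp add: norm_power del: complex_cnj_power)
        then show False
          using j y omega_power_inj [of m "y' j" "y j"] by (auto simp: confs_def PiE_iff)
      qed
    qed
    then show "mat_mul m A (dagger E) E y y' = ident m L y y'"
      unfolding G by (auto simp: ident_def e_norm)
  qed
  have sE: "mat_mul m A s E = E" if "s \<in> S" for s
    unfolding mul_E using e_S that by (simp add: E_def fun_eq_iff)
  then have projE: "mat_mul m A proj E = E"
    by (simp add: proj_mul)
  \<comment> \<open>\<open>E\<close> times its adjoint is a projection below \<open>proj\<close>,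
    because \<open>proj\<close> fixes \<open>E\<close>, and both have trace
    \<open>m ^ card L\<close>.\<close>
  have comp: "proj = mat_mul m L E (dagger E)"
  proof (rule projection_eqI [OF finite_A])
    show "mat_mul m L E (dagger E) \<in> matrices m A A" using E by auto
    show "mat_mul m A (mat_mul m L E (dagger E)) (mat_mul m L E (dagger E)) = mat_mul m L E (dagger E)"
    proof -
      have "mat_mul m A (dagger E) (mat_mul m L E (dagger E)) = dagger E"
        using E by (simp add: EE ident_mul [OF fL dagger_in_matrices [OF E]] flip: mat_mul_assoc)
      then show ?thesis by (simp add: mat_mul_assoc)
    qed
    show "mat_mul m A proj (mat_mul m L E (dagger E)) = mat_mul m L E (dagger E)"
      by (simp add: projE flip: mat_mul_assoc)
    show "mat_trace m A proj = mat_trace m A (mat_mul m L E (dagger E))"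
      by (subst mat_trace_mul_commute) (simp add: trace_proj EE mat_trace_ident)
  qed (simp_all add: dagger_proj proj_proj dagger_mul)
  have "encoding m C E"
    unfolding encoding_def Let_def
  proof (intro conjI ballI)
    show "mat_app m L E ` vects m L = code_space m C"
    proof
      show "mat_app m L E ` vects m L \<subseteq> code_space m C"
        using E by (auto simp: code_space_def sE simp flip: mat_app_mul)
      show "code_space m C \<subseteq> mat_app m L E ` vects m L"
      proof
        fix u assume "u \<in> code_space m C"
        then have "u = mat_app m L E (mat_app m A (dagger E) u)"
          using proj_code_space by (simp add: comp mat_app_mul)
        moreover have "mat_app m A (dagger E) u \<in> vects m L" using E by auto
        ultimately show "u \<in> mat_app m L E ` vects m L" by blast
      qed
    qed
    fix i assume i: "i \<in> L"
    have "mat_mul m A (log_X C i) E = mat_scale (cnj (\<nu> i)) (mat_mul m L E (pauli_X m L i))"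
      using \<nu>(1) [OF i] by (simp add: E_X [OF i])
    then show "\<exists>c. cmod c = 1 \<and> mat_mul m A (log_X C i) E = mat_scale c (mat_mul m L E (pauli_X m L i))"
      using \<nu>(1) [OF i] complex_mod_cnj by metis
    show "\<exists>c. cmod c = 1 \<and> mat_mul m A (log_Z C i) E = mat_scale c (mat_mul m L E (pauli_Z m L i))"
      using E_Z [OF i] d [OF i] by blast
  qed (fact E EE)+
  then show thesis by (rule that) (simp_all add: comp sE)
qed

end

section \<open>Tensor products\<close>

text \<open>Distributivity of products over sums, transported along a bijection. With
  \<open>bij_block\<close> and \<open>bij_restrict\<close> it makes the tensor products over
  codeblocks and over parts multiplicative.\<close>

lemma sum_prod_bij:
  assumes "finite I" "\<And>i. i \<in> I \<Longrightarrow> finite (B i)" "bij_betw h D (Pi\<^sub>E I B)"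
  shows "(\<Sum>z\<in>D. \<Prod>i\<in>I. f i (h z i)) = (\<Prod>i\<in>I. \<Sum>w\<in>B i. f i w :: 'a :: comm_semiring_1)"
  using sum.reindex_bij_betw [OF assms(3), of "\<lambda>p. \<Prod>i\<in>I. f i (p i)"] prod_sum_PiE [of I B f] assms(1,2)
  by simp

section \<open>Tensor products over codeblocks\<close>

definition block :: "(nat \<Rightarrow> 'q set) \<Rightarrow> nat \<Rightarrow> (nat \<times> 'q) conf \<Rightarrow> 'q conf" where
  "block A b x = (\<lambda>q\<in>A b. x (b, q))"

lemma block_in_confs: "x \<in> confs m (Sigma {..<r} A) \<Longrightarrow> b < r \<Longrightarrow> block A b x \<in> confs m (A b)"
  unfolding confs_def block_def by auto

lemma bij_block:
  "bij_betw (\<lambda>x. \<lambda>b\<in>{..<r}. block A b x) (confs m (Sigma {..<r} A)) (\<Pi>\<^sub>E b\<in>{..<r}. confs m (A b))"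
proof (rule bij_betw_byWitness [where f' = "\<lambda>p. \<lambda>z\<in>Sigma {..<r} A. p (fst z) (snd z)"])
  show "\<forall>x\<in>confs m (Sigma {..<r} A).
      (\<lambda>z\<in>Sigma {..<r} A. (\<lambda>b\<in>{..<r}. block A b x) (fst z) (snd z)) = x"
    by (auto simp: confs_def block_def fun_eq_iff PiE_iff extensional_def)
  show "\<forall>p\<in>\<Pi>\<^sub>E b\<in>{..<r}. confs m (A b).
      (\<lambda>b\<in>{..<r}. block A b (\<lambda>z\<in>Sigma {..<r} A. p (fst z) (snd z))) = p"
    by (auto simp: confs_def block_def fun_eq_iff PiE_iff extensional_def)
  show "(\<lambda>x. \<lambda>b\<in>{..<r}. block A b x) ` confs m (Sigma {..<r} A) \<subseteq> (\<Pi>\<^sub>E b\<in>{..<r}. confs m (A b))"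
    by (auto simp: block_in_confs)
  show "(\<lambda>p. \<lambda>z\<in>Sigma {..<r} A. p (fst z) (snd z)) ` (\<Pi>\<^sub>E b\<in>{..<r}. confs m (A b)) \<subseteq> confs m (Sigma {..<r} A)"
    by (auto simp: confs_def PiE_iff)
qed

lemma block_eq_iff:
  assumes "x \<in> confs m (Sigma {..<r} A)" "y \<in> confs m (Sigma {..<r} A)"
  shows "(\<forall>b<r. block A b x = block A b y) \<longleftrightarrow> x = y"
proof
  assume eq: "\<forall>b<r. block A b x = block A b y"
  have "(\<lambda>b\<in>{..<r}. block A b x) = (\<lambda>b\<in>{..<r}. block A b y)"
    using eq by (auto simp: fun_eq_iff)
  then show "x = y"
    using bij_block [of A r m] assms unfolding bij_betw_def inj_on_def by blast
qed simp

lemma sum_block: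
  assumes "\<And>b. b < r \<Longrightarrow> finite (A b)"
  shows "(\<Sum>z\<in>confs m (Sigma {..<r} A). \<Prod>b<r. f b (block A b z)) =
    (\<Prod>b<r. \<Sum>w\<in>confs m (A b). f b w :: complex)"
proof -
  have "(\<Sum>z\<in>confs m (Sigma {..<r} A). \<Prod>b<r. f b (block A b z)) =
      (\<Sum>z\<in>confs m (Sigma {..<r} A). \<Prod>b<r. f b ((\<lambda>b\<in>{..<r}. block A b z) b))"
    by (intro sum.cong prod.cong refl) simp
  also have "\<dots> = (\<Prod>b<r. \<Sum>w\<in>confs m (A b). f b w)"
    by (rule sum_prod_bij [OF _ _ bij_block]) (use assms in auto)
  finally show ?thesis .
qed

text \<open>Generalizes \<open>block_tensor\<close> to rectangular factors, since an encoding has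
  physical rows and logical columns.\<close>

definition rect_tensor ::
  "nat \<Rightarrow> nat \<Rightarrow> (nat \<Rightarrow> 'p set) \<Rightarrow> (nat \<Rightarrow> 'q set) \<Rightarrow> (nat \<Rightarrow> ('p, 'q) cmatrix) \<Rightarrow> (nat \<times> 'p, nat \<times> 'q) cmatrix" where
  "rect_tensor m r A B M = (\<lambda>x y.
     if x \<in> confs m (Sigma {..<r} A) \<and> y \<in> confs m (Sigma {..<r} B)
     then \<Prod>b<r. M b (block A b x) (block B b y) else 0)"

lemma block_tensor_eq: "block_tensor m r A U = rect_tensor m r A A U"
  unfolding block_tensor_def rect_tensor_def block_def ..

lemma rect_tensor_in_matrices [simp]:
  "rect_tensor m r A B M \<in> matrices m (Sigma {..<r} A) (Sigma {..<r} B)"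
  unfolding matrices_def rect_tensor_def by auto

lemma rect_tensor_cong:
  "(\<And>b. b < r \<Longrightarrow> M b = N b) \<Longrightarrow> rect_tensor m r A B M = rect_tensor m r A B N"
  unfolding rect_tensor_def by (intro ext if_cong prod.cong refl) auto

lemma rect_tensor_mul:
  assumes "\<And>b. b < r \<Longrightarrow> finite (B b)"
  shows "mat_mul m (Sigma {..<r} B) (rect_tensor m r A B M) (rect_tensor m r B D N) =
    rect_tensor m r A D (\<lambda>b. mat_mul m (B b) (M b) (N b))"
proof (intro ext)
  fix x y
  show "mat_mul m (Sigma {..<r} B) (rect_tensor m r A B M) (rect_tensor m r B D N) x y =
    rect_tensor m r A D (\<lambda>b. mat_mul m (B b) (M b) (N b)) x y"
  proof (cases "x \<in> confs m (Sigma {..<r} A) \<and> y \<in> confs m (Sigma {..<r} D)")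
    case True
    then have "mat_mul m (Sigma {..<r} B) (rect_tensor m r A B M) (rect_tensor m r B D N) x y =
        (\<Sum>z\<in>confs m (Sigma {..<r} B). \<Prod>b<r. M b (block A b x) (block B b z) * N b (block B b z) (block D b y))"
      unfolding mat_mul_def rect_tensor_def by (intro sum.cong refl) (simp add: prod.distrib)
    also have "\<dots> = (\<Prod>b<r. \<Sum>w\<in>confs m (B b). M b (block A b x) w * N b w (block D b y))"
      by (rule sum_block [OF assms])
    finally show ?thesis using True by (simp add: rect_tensor_def mat_mul_def)
  next
    case False
    then show ?thesis by (auto simp: rect_tensor_def mat_mul_def)
  qed
qed

lemma rect_tensor_dagger: "dagger (rect_tensor m r A B M) = rect_tensor m r B A (\<lambda>b. dagger (M b))"
  unfolding dagger_def rect_tensor_def by (intro ext) auto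

lemma rect_tensor_scale:
  "rect_tensor m r A B (\<lambda>b. mat_scale (c b) (M b)) = mat_scale (\<Prod>b<r. c b) (rect_tensor m r A B M)"
  unfolding mat_scale_def rect_tensor_def by (intro ext) (simp add: prod.distrib)

lemma rect_tensor_ident: "rect_tensor m r A A (\<lambda>b. ident m (A b)) = ident m (Sigma {..<r} A)"
proof (intro ext)
  fix x y
  show "rect_tensor m r A A (\<lambda>b. ident m (A b)) x y = ident m (Sigma {..<r} A) x y"
  proof (cases "x \<in> confs m (Sigma {..<r} A) \<and> y \<in> confs m (Sigma {..<r} A)")
    case True
    have "(\<Prod>b<r. ident m (A b) (block A b x) (block A b y)) =
        (if \<forall>b<r. block A b x = block A b y then 1 else 0)"
      using True by (auto simp: ident_def block_in_confs)
    then show ?thesis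
      using True block_eq_iff [of x m r A y] by (simp add: rect_tensor_def ident_def)
  next
    case False
    then show ?thesis by (auto simp: rect_tensor_def ident_def)
  qed
qed

lemma rect_tensor_weyl:
  assumes "\<And>b. b < r \<Longrightarrow> finite (A b)"
  shows "rect_tensor m r A A (\<lambda>b. weyl m (A b) (f b) (g b)) =
    weyl m (Sigma {..<r} A) (\<lambda>(b, q). f b q) (\<lambda>(b, q). g b q)"
proof (intro ext)
  fix x y
  show "rect_tensor m r A A (\<lambda>b. weyl m (A b) (f b) (g b)) x y =
    weyl m (Sigma {..<r} A) (\<lambda>(b, q). f b q) (\<lambda>(b, q). g b q) x y"
  proof (cases "x \<in> confs m (Sigma {..<r} A) \<and> y \<in> confs m (Sigma {..<r} A)")
    case True
    let ?h = "\<lambda>b q. if x (b, q) = (y (b, q) + f b q) mod m then omega m ^ (g b q * y (b, q)) else 0"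
    have "rect_tensor m r A A (\<lambda>b. weyl m (A b) (f b) (g b)) x y = (\<Prod>b<r. \<Prod>q\<in>A b. ?h b q)"
    proof -
      have "weyl m (A b) (f b) (g b) (block A b x) (block A b y) = (\<Prod>q\<in>A b. ?h b q)" if "b < r" for b
      proof -
        have "block A b x \<in> confs m (A b)" "block A b y \<in> confs m (A b)"
          using True that block_in_confs by blast+
        then show ?thesis
          unfolding weyl_def by (auto simp: block_def intro!: prod.cong)
      qed
      then show ?thesis using True by (simp add: rect_tensor_def)
    qed
    also have "\<dots> = (\<Prod>(b, q)\<in>Sigma {..<r} A. ?h b q)"
      using assms by (subst prod.Sigma) auto
    also have "\<dots> = weyl m (Sigma {..<r} A) (\<lambda>(b, q). f b q) (\<lambda>(b, q). g b q) x y"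
      using True by (auto simp: weyl_def intro!: prod.cong)
    finally show ?thesis .
  next
    case False
    then show ?thesis by (auto simp: rect_tensor_def weyl_def)
  qed
qed

section \<open>Tensor products over a partition\<close>

lemma bij_restrict:
  assumes "partition_on A P"
  shows "bij_betw (\<lambda>x. \<lambda>R\<in>P. restrict x R) (confs m A) (\<Pi>\<^sub>E R\<in>P. confs m R)"
proof -
  \<comment> \<open>The part containing \<open>q\<close>; it tells the inverse map which local
    configuration supplies the value at \<open>q\<close>.\<close>
  define part where "part q = (THE R. R \<in> P \<and> q \<in> R)" for q
  have part: "part q = R" if "R \<in> P" "q \<in> R" for q R
    unfolding part_def
    using that assms by (intro the_equality) (auto simp: partition_on_def disjoint_def)
  have PA: "R \<subseteq> A" if "R \<in> P" for R
    using assms that by (auto simp: partition_on_def)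
  have part_in: "part q \<in> P" "q \<in> part q" if "q \<in> A" for q
    using that assms part by (auto simp: partition_on_def)
  show ?thesis
  proof (rule bij_betw_byWitness [where f' = "\<lambda>p. \<lambda>q\<in>A. p (part q) q"])
    show "\<forall>x\<in>confs m A. (\<lambda>q\<in>A. (\<lambda>R\<in>P. restrict x R) (part q) q) = x"
      using part_in by (auto simp: confs_def fun_eq_iff PiE_iff extensional_def)
    show "\<forall>p\<in>\<Pi>\<^sub>E R\<in>P. confs m R. (\<lambda>R\<in>P. restrict (\<lambda>q\<in>A. p (part q) q) R) = p"
    proof
      fix p assume p: "p \<in> (\<Pi>\<^sub>E R\<in>P. confs m R)"
      show "(\<lambda>R\<in>P. restrict (\<lambda>q\<in>A. p (part q) q) R) = p"
      proof
        fix R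
        show "(\<lambda>R\<in>P. restrict (\<lambda>q\<in>A. p (part q) q) R) R = p R"
        proof (cases "R \<in> P")
          case True
          then have "p R \<in> extensional R" using PiE_mem [OF p, of R] by (simp add: confs_def PiE_iff)
          then show ?thesis
            using True PA [OF True] part [OF True] by (auto simp: fun_eq_iff extensional_def)
        qed (use p in auto)
      qed
    qed
    show "(\<lambda>x. \<lambda>R\<in>P. restrict x R) ` confs m A \<subseteq> (\<Pi>\<^sub>E R\<in>P. confs m R)"
      using PA by (fastforce simp: confs_def PiE_iff)
    show "(\<lambda>p. \<lambda>q\<in>A. p (part q) q) ` (\<Pi>\<^sub>E R\<in>P. confs m R) \<subseteq> confs m A"
      using part_in by (fastforce simp: confs_def PiE_iff)
  qed
qed

lemma tensor_mul:
  assumes "finite A" "partition_on A P"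
  shows "mat_mul m A (tensor m A P U) (tensor m A P V) = tensor m A P (\<lambda>R. mat_mul m R (U R) (V R))"
proof (intro ext)
  fix x y
  have fin: "finite P" "\<And>R. R \<in> P \<Longrightarrow> finite R"
    using finite_elements [OF assms] assms by (auto simp: partition_on_def intro: finite_subset)
  show "mat_mul m A (tensor m A P U) (tensor m A P V) x y = tensor m A P (\<lambda>R. mat_mul m R (U R) (V R)) x y"
  proof (cases "x \<in> confs m A \<and> y \<in> confs m A")
    case True
    then have "mat_mul m A (tensor m A P U) (tensor m A P V) x y =
        (\<Sum>z\<in>confs m A. \<Prod>R\<in>P. U R (restrict x R) ((\<lambda>R\<in>P. restrict z R) R) * V R ((\<lambda>R\<in>P. restrict z R) R) (restrict y R))"
      unfolding mat_mul_def tensor_def by (intro sum.cong refl) (simp add: prod.distrib)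
    also have "\<dots> = (\<Prod>R\<in>P. \<Sum>w\<in>confs m R. U R (restrict x R) w * V R w (restrict y R))"
      by (rule sum_prod_bij [OF _ _ bij_restrict [OF assms(2)]]) (use fin in auto)
    finally show ?thesis using True by (simp add: tensor_def mat_mul_def)
  next
    case False
    then show ?thesis by (auto simp: tensor_def mat_mul_def)
  qed
qed

lemma tensor_dagger: "dagger (tensor m A P U) = tensor m A P (\<lambda>R. dagger (U R))"
  unfolding dagger_def tensor_def by (intro ext) auto

lemma tensor_cong: "(\<And>R. R \<in> P \<Longrightarrow> U R = V R) \<Longrightarrow> tensor m A P U = tensor m A P V"
  unfolding tensor_def by (intro ext if_cong prod.cong refl) auto

lemma tensor_scale: "tensor m A P (\<lambda>R. mat_scale (c R) (U R)) = mat_scale (\<Prod>R\<in>P. c R) (tensor m A P U)"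
  unfolding mat_scale_def tensor_def by (intro ext) (simp add: prod.distrib)

lemma tensor_in_matrices [simp]: "tensor m A P U \<in> matrices m A A"
  unfolding matrices_def tensor_def by auto

lemma tensor_ident:
  assumes "finite A" "partition_on A P"
  shows "tensor m A P (ident m) = ident m A"
proof -
  have "finite R" if "R \<in> P" for R
    using that assms by (auto simp: partition_on_def intro: finite_subset)
  then have "tensor m A P (ident m) = tensor m A P (\<lambda>R. weyl m R (\<lambda>_. 0) (\<lambda>_. 0))"
    by (intro tensor_cong) (simp add: weyl_0)
  then show ?thesis
    using tensor_weyl [OF assms, of m "\<lambda>_. 0" "\<lambda>_. 0"] weyl_0 [OF assms(1), of m] by simp
qed

section \<open>Several codeblocks\<close>

lemma matrix_eqI:
  fixes M N :: "('p, 'q) cmatrix"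
  assumes "finite B" "M \<in> matrices m A B" "N \<in> matrices m A B"
    and "\<And>w. w \<in> vects m B \<Longrightarrow> mat_app m B M w = mat_app m B N w"
  shows "M = N"
proof (intro ext)
  fix x y
  show "M x y = N x y"
  proof (cases "y \<in> confs m B")
    case True
    let ?w = "\<lambda>z. of_bool (z = y) :: complex"
    have "mat_app m B K ?w x = K x y" for K :: "('p, 'q) cmatrix"
    proof -
      have "mat_app m B K ?w x = (\<Sum>z\<in>confs m B. if z = y then K x z else 0)"
        unfolding mat_app_def by (intro sum.cong refl) auto
      then show ?thesis using True assms(1) by simp
    qed
    moreover have "?w \<in> vects m B" using True by (auto simp: vects_def)
    ultimately show ?thesis using assms(4) by metis
  next
    case False
    then show ?thesis using assms(2,3) matrices_0 by metis
  qed
qed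

locale codeblocks =
  fixes m r :: nat and C :: "nat \<Rightarrow> ('q, 'l) stab_code"
  assumes m_ge_2: "2 \<le> m" and codes: "\<And>b. b < r \<Longrightarrow> stabilizer_code m (C b)"
begin

abbreviation "A b \<equiv> qudits (C b)"
abbreviation "S b \<equiv> stab (C b)"
abbreviation "L b \<equiv> set (logicals (C b))"
abbreviation "AA \<equiv> Sigma {..<r} A"
abbreviation "LL \<equiv> Sigma {..<r} L"
abbreviation "on_block B b U \<equiv> rect_tensor m r B B (\<lambda>b'. if b' = b then U else ident m (B b'))"

lemma m_pos [simp]: "0 < m" using m_ge_2 by simp

lemma stabilizer: "b < r \<Longrightarrow> stabilizer m (C b)"
  using m_ge_2 codes by unfold_locales

lemma finite_A [simp]: "b < r \<Longrightarrow> finite (A b)"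
  using stabilizer by (rule stabilizer.finite_A)

lemma finite_AA [simp]: "finite AA" and finite_LL [simp]: "finite LL"
  by auto

section \<open>The combined code and its encoding\<close>

lemma qudits_combine [simp]: "qudits (combine m r C) = AA"
  and logicals_combine [simp]: "set (logicals (combine m r C)) = LL"
  and stab_combine: "stab (combine m r C) = {rect_tensor m r A A s | s. \<forall>b<r. s b \<in> S b}"
  and log_X_combine: "log_X (combine m r C) (b, i) = on_block A b (log_X (C b) i)"
  and log_Z_combine: "log_Z (combine m r C) (b, i) = on_block A b (log_Z (C b) i)"
  unfolding combine_def Let_def by (auto simp: block_tensor_eq)

text \<open>Fixes one encoding per block, with the additional properties supplied by
  \<open>ex_encoding\<close>, so that their tensor product is a definite matrix.\<close>

definition enc :: "nat \<Rightarrow> ('q, 'l) cmatrix" where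
  "enc b = (SOME E. encoding m (C b) E \<and> mat_mul m (L b) E (dagger E) = stabilizer.proj (C b) \<and>
     (\<forall>s\<in>S b. mat_mul m (A b) s E = E))"

definition EE :: "(nat \<times> 'q, nat \<times> 'l) cmatrix" where
  "EE = rect_tensor m r A L enc"

lemma enc:
  assumes "b < r"
  shows "encoding m (C b) (enc b)" "mat_mul m (L b) (enc b) (dagger (enc b)) = stabilizer.proj (C b)"
    "s \<in> S b \<Longrightarrow> mat_mul m (A b) s (enc b) = enc b"
proof -
  interpret stab: stabilizer m "C b" by (rule stabilizer [OF assms])
  have "\<exists>E. encoding m (C b) E \<and> mat_mul m (L b) E (dagger E) = stab.proj \<and> (\<forall>s\<in>S b. mat_mul m (A b) s E = E)"
    by (rule stab.ex_encoding) blast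
  from someI_ex [OF this] show "encoding m (C b) (enc b)" "mat_mul m (L b) (enc b) (dagger (enc b)) = stab.proj"
    "s \<in> S b \<Longrightarrow> mat_mul m (A b) s (enc b) = enc b"
    unfolding enc_def by blast+
qed

lemma enc_in_matrices: "b < r \<Longrightarrow> enc b \<in> matrices m (A b) (L b)"
  and enc_isometry: "b < r \<Longrightarrow> mat_mul m (A b) (dagger (enc b)) (enc b) = ident m (L b)"
  using enc(1) unfolding encoding_def Let_def by auto

lemma EE_in_matrices [simp]: "EE \<in> matrices m AA LL"
  unfolding EE_def by simp

lemma EE_isometry: "mat_mul m AA (dagger EE) EE = ident m LL"
  unfolding EE_def rect_tensor_dagger
  by (subst rect_tensor_mul) (auto simp: enc_isometry simp flip: rect_tensor_ident intro!: rect_tensor_cong)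

lemma stab_EE:
  assumes "\<And>b. b < r \<Longrightarrow> s b \<in> S b"
  shows "mat_mul m AA (rect_tensor m r A A s) EE = EE"
  unfolding EE_def by (subst rect_tensor_mul) (auto simp: enc(3) assms intro!: rect_tensor_cong)

text \<open>\<open>EE\<close> times its adjoint is the tensor product of the block projections. A
  product of averages is an average over families with one stabilizer from each block; each family
  gives a stabilizer of the combined code, which fixes \<open>v\<close>.\<close>

lemma EE_dagger_fixes_code:
  assumes v: "v \<in> code_space m (combine m r C)"
  shows "mat_app m AA (mat_mul m LL EE (dagger EE)) v = v"
proof -
  define N where "N = (\<Prod>b<r. of_nat (card (S b)) :: complex)"
  have S: "finite (S b)" "card (S b) \<noteq> 0" if "b < r" for b
    using stabilizer.finite_S [OF stabilizer [OF that]] stabilizer.card_S_nonzero [OF stabilizer [OF that]] by auto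
  have N: "N \<noteq> 0" "N = of_nat (card (Pi\<^sub>E {..<r} S))"
    using S by (auto simp: N_def card_PiE)
  have "mat_mul m LL EE (dagger EE) = rect_tensor m r A A (\<lambda>b. stabilizer.proj (C b))"
    unfolding EE_def rect_tensor_dagger by (subst rect_tensor_mul) (auto simp: enc(2) intro!: rect_tensor_cong)
  also have "\<dots> = (\<lambda>x y. (\<Sum>s\<in>Pi\<^sub>E {..<r} S. rect_tensor m r A A s x y) / N)"
  proof (intro ext)
    fix x y
    have "(\<Prod>b<r. stabilizer.proj (C b) (block A b x) (block A b y)) =
        (\<Prod>b<r. (\<Sum>s\<in>S b. s (block A b x) (block A b y))) / N"
      unfolding N_def prod_dividef [symmetric]
      by (intro prod.cong refl) (simp add: stabilizer.proj_def [OF stabilizer])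
    also have "(\<Prod>b<r. (\<Sum>s\<in>S b. s (block A b x) (block A b y))) =
        (\<Sum>s\<in>Pi\<^sub>E {..<r} S. \<Prod>b<r. s b (block A b x) (block A b y))"
      using S by (subst prod_sum_PiE) auto
    finally show "rect_tensor m r A A (\<lambda>b. stabilizer.proj (C b)) x y =
        (\<Sum>s\<in>Pi\<^sub>E {..<r} S. rect_tensor m r A A s x y) / N"
      by (cases "x \<in> confs m AA \<and> y \<in> confs m AA") (auto simp: rect_tensor_def)
  qed
  finally have "mat_app m AA (mat_mul m LL EE (dagger EE)) v =
      (\<lambda>x. (\<Sum>s\<in>Pi\<^sub>E {..<r} S. mat_app m AA (rect_tensor m r A A s) v x) / N)"
    unfolding mat_app_def
    by (subst sum.swap) (simp add: sum_distrib_right sum_divide_distrib)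
  also have "\<dots> = (\<lambda>x. (\<Sum>s\<in>Pi\<^sub>E {..<r} S. v x) / N)"
  proof -
    have "mat_app m AA (rect_tensor m r A A s) v = v" if "s \<in> Pi\<^sub>E {..<r} S" for s
    proof -
      have "rect_tensor m r A A s \<in> stab (combine m r C)"
        using that unfolding stab_combine by auto
      then show ?thesis using v by (simp add: code_space_def)
    qed
    then show ?thesis by simp
  qed
  finally show ?thesis using N by simp
qed

text \<open>The other blocks carry identities, which pass through their encodings.\<close>

lemma on_block_EE:
  assumes "b < r" "mat_mul m (A b) U (enc b) = mat_scale c (mat_mul m (L b) (enc b) u)"
  shows "mat_mul m AA (on_block A b U) EE = mat_scale c (mat_mul m LL EE (on_block L b u))"
proof -
  have "mat_mul m AA (on_block A b U) EE =
      rect_tensor m r A L (\<lambda>b'. mat_scale (if b' = b then c else 1)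
        (mat_mul m (L b') (enc b') (if b' = b then u else ident m (L b'))))"
    unfolding EE_def
    by (subst rect_tensor_mul)
      (auto simp: assms(2) ident_mul [OF finite_A enc_in_matrices] mul_ident [OF _ enc_in_matrices]
        intro!: rect_tensor_cong)
  also have "\<dots> = mat_scale c (rect_tensor m r A L (\<lambda>b'. mat_mul m (L b') (enc b') (if b' = b then u else ident m (L b'))))"
    unfolding rect_tensor_scale using assms(1) by simp
  also have "rect_tensor m r A L (\<lambda>b'. mat_mul m (L b') (enc b') (if b' = b then u else ident m (L b'))) =
      mat_mul m LL EE (on_block L b u)"
    unfolding EE_def by (subst rect_tensor_mul) auto
  finally show ?thesis .
qed

lemma on_block_weyl:
  fixes B :: "nat \<Rightarrow> 'a set"
  assumes "\<And>b. b < r \<Longrightarrow> finite (B b)"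
  shows "on_block B b (weyl m (B b) f g) =
    weyl m (Sigma {..<r} B) (\<lambda>(b', q). if b' = b then f q else 0) (\<lambda>(b', q). if b' = b then g q else 0)"
proof -
  have "on_block B b (weyl m (B b) f g) =
      rect_tensor m r B B (\<lambda>b'. weyl m (B b') (\<lambda>q. if b' = b then f q else 0) (\<lambda>q. if b' = b then g q else 0))"
    using assms by (intro rect_tensor_cong) (auto simp: weyl_0)
  then show ?thesis
    using rect_tensor_weyl [of r B m, OF assms] by simp
qed

lemma on_block_X:
  assumes "b < r" "i \<in> L b"
  shows "on_block L b (pauli_X m (L b) i) = pauli_X m LL (b, i)"
proof -
  have 1: "on_block L b (weyl m (L b) (\<lambda>p. of_bool (p = i)) (\<lambda>_. 0)) = weyl m LL (\<lambda>p. of_bool (p = (b, i))) (\<lambda>_. 0)"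
    by (subst on_block_weyl) (auto intro!: weyl_cong)
  have 2: "pauli_X m (L b) i = weyl m (L b) (\<lambda>p. of_bool (p = i)) (\<lambda>_. 0)"
    using assms m_ge_2 by (intro pauli_X_weyl) auto
  have 3: "pauli_X m LL (b, i) = weyl m LL (\<lambda>p. of_bool (p = (b, i))) (\<lambda>_. 0)"
    using assms m_ge_2 by (intro pauli_X_weyl) auto
  show ?thesis unfolding 2 3 by (rule 1)
qed

lemma on_block_Z:
  assumes "b < r" "i \<in> L b"
  shows "on_block L b (pauli_Z m (L b) i) = pauli_Z m LL (b, i)"
proof -
  have 1: "on_block L b (weyl m (L b) (\<lambda>_. 0) (\<lambda>p. of_bool (p = i))) = weyl m LL (\<lambda>_. 0) (\<lambda>p. of_bool (p = (b, i)))"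
    by (subst on_block_weyl) (auto intro!: weyl_cong)
  have 2: "pauli_Z m (L b) i = weyl m (L b) (\<lambda>_. 0) (\<lambda>p. of_bool (p = i))"
    using assms by (intro pauli_Z_weyl) auto
  have 3: "pauli_Z m LL (b, i) = weyl m LL (\<lambda>_. 0) (\<lambda>p. of_bool (p = (b, i)))"
    using assms by (intro pauli_Z_weyl) auto
  show ?thesis unfolding 2 3 by (rule 1)
qed

lemma enc_X: "b < r \<Longrightarrow> i \<in> L b \<Longrightarrow>
    \<exists>c. cmod c = 1 \<and> mat_mul m (A b) (log_X (C b) i) (enc b) = mat_scale c (mat_mul m (L b) (enc b) (pauli_X m (L b) i))"
  and enc_Z: "b < r \<Longrightarrow> i \<in> L b \<Longrightarrow>
    \<exists>c. cmod c = 1 \<and> mat_mul m (A b) (log_Z (C b) i) (enc b) = mat_scale c (mat_mul m (L b) (enc b) (pauli_Z m (L b) i))"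
  using enc(1) unfolding encoding_def Let_def by auto

lemma encoding_EE: "encoding m (combine m r C) EE"
  unfolding encoding_def Let_def qudits_combine logicals_combine
proof (intro conjI ballI)
  show "mat_app m LL EE ` vects m LL = code_space m (combine m r C)"
  proof
    show "mat_app m LL EE ` vects m LL \<subseteq> code_space m (combine m r C)"
      by (auto simp: code_space_def stab_combine stab_EE simp flip: mat_app_mul
          intro!: mat_app_in_vects [OF EE_in_matrices])
    show "code_space m (combine m r C) \<subseteq> mat_app m LL EE ` vects m LL"
    proof
      fix v assume "v \<in> code_space m (combine m r C)"
      then have "v = mat_app m LL EE (mat_app m AA (dagger EE) v)"
        using EE_dagger_fixes_code by (simp add: mat_app_mul)
      moreover have "mat_app m AA (dagger EE) v \<in> vects m LL"
        by (rule mat_app_in_vects [OF dagger_in_matrices [OF EE_in_matrices]])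
      ultimately show "v \<in> mat_app m LL EE ` vects m LL" by blast
    qed
  qed
  fix j assume "j \<in> LL"
  then obtain b i where j: "j = (b, i)" "b < r" "i \<in> L b" by auto
  show "\<exists>c. cmod c = 1 \<and> mat_mul m AA (log_X (combine m r C) j) EE = mat_scale c (mat_mul m LL EE (pauli_X m LL j))"
    using enc_X [OF j(2,3)] on_block_EE [OF j(2)]
    unfolding j(1) log_X_combine on_block_X [OF j(2,3), symmetric] by blast
  show "\<exists>c. cmod c = 1 \<and> mat_mul m AA (log_Z (combine m r C) j) EE = mat_scale c (mat_mul m LL EE (pauli_Z m LL j))"
    using enc_Z [OF j(2,3)] on_block_EE [OF j(2)]
    unfolding j(1) log_Z_combine on_block_Z [OF j(2,3), symmetric] by blast
qed (simp_all add: EE_isometry)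

text \<open>The logical action of \<open>U\<close> up to phase. Unlike the map
  \<open>induced\<close>, the relation carries the invariance of the code space with it, so it
  passes directly to products; many \<open>U\<close> share the same \<open>u\<close>.\<close>

definition implements :: "(nat \<times> 'q) operator \<Rightarrow> (nat \<times> 'l) operator \<Rightarrow> bool" where
  "implements U u \<longleftrightarrow> (\<exists>c. cmod c = 1 \<and> mat_mul m AA U EE = mat_scale c (mat_mul m LL EE u))"

lemma implements_ident: "implements (ident m AA) (ident m LL)"
  unfolding implements_def using ident_mul [OF finite_AA EE_in_matrices] mul_ident [OF finite_LL EE_in_matrices]
  by (intro exI [of _ 1]) simp

lemma implements_mul:
  assumes "implements U u" "implements V v"
  shows "implements (mat_mul m AA U V) (mat_mul m LL u v)"
proof -
  obtain c d where "cmod c = 1" "mat_mul m AA U EE = mat_scale c (mat_mul m LL EE u)"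
    "cmod d = 1" "mat_mul m AA V EE = mat_scale d (mat_mul m LL EE v)"
    using assms unfolding implements_def by blast
  then have "mat_mul m AA (mat_mul m AA U V) EE = mat_scale (d * c) (mat_mul m LL EE (mat_mul m LL u v))"
    by (simp add: mat_mul_assoc) (simp flip: mat_mul_assoc)
  moreover have "cmod (d * c) = 1" using \<open>cmod c = 1\<close> \<open>cmod d = 1\<close> by (simp add: norm_mult)
  ultimately show ?thesis unfolding implements_def by blast
qed

text \<open>The adjoint of \<open>U\<close> on the left solves the equation for \<open>EE\<close>,
  and the adjoint of \<open>u\<close> on the right then removes \<open>u\<close>; hence unitarity is
  assumed of both.\<close>

lemma implements_dagger:
  assumes "implements U u" "unitary_op m AA U" "unitary_op m LL u"
  shows "implements (dagger U) (dagger u)"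
proof -
  obtain c where c: "cmod c = 1" "mat_mul m AA U EE = mat_scale c (mat_mul m LL EE u)"
    using assms unfolding implements_def by blast
  define W where "W = mat_mul m AA (dagger U) EE"
  have W: "W \<in> matrices m AA LL"
    unfolding W_def using assms(2)
    by (intro mat_mul_in_matrices [OF dagger_in_matrices [OF unitary_in_matrices] EE_in_matrices])
  have "EE = mat_mul m AA (dagger U) (mat_mul m AA U EE)"
    using unitary_dagger_mul_cancel [OF finite_AA assms(2) EE_in_matrices] by simp
  also have "\<dots> = mat_scale c (mat_mul m LL W u)"
    by (simp add: c(2) W_def mat_mul_assoc)
  finally have "mat_mul m LL EE (dagger u) = mat_mul m LL (mat_scale c (mat_mul m LL W u)) (dagger u)"
    by (rule arg_cong)
  also have "\<dots> = mat_scale c W"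
    using assms(3) mul_ident [OF finite_LL W] by (simp add: mat_mul_assoc)
  finally have "mat_scale (cnj c) (mat_mul m LL EE (dagger u)) = mat_mul m AA (dagger U) EE"
    using c(1) by (simp add: W_def)
  then show ?thesis
    unfolding implements_def using c(1) by (intro exI [of _ "cnj c"]) simp
qed

lemma implements_commutator:
  assumes "implements U u" "unitary_op m AA U" "unitary_op m LL u"
    and "implements V v" "unitary_op m AA V" "unitary_op m LL v"
  shows "implements (commutator m AA U V) (commutator m LL u v)"
  unfolding commutator_def by (intro implements_mul implements_dagger assms)

text \<open>\<open>U\<close> maps the range of \<open>EE\<close> into the code space, which
  \<open>EE\<close> times its adjoint fixes; so the relation holds with phase 1. As
  \<open>EE\<close> is an isometry, the unitarity of \<open>U\<close> passes to
  \<open>u\<close>.\<close>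

lemma implements_induced:
  assumes "logical_operator m (combine m r C) U"
  defines "u \<equiv> induced m (combine m r C) EE U"
  shows "unitary_op m LL u" "implements U u"
proof -
  have U: "unitary_op m AA U" "mat_app m AA U ` code_space m (combine m r C) \<subseteq> code_space m (combine m r C)"
    using assms(1) unfolding logical_operator_def by auto
  have u: "u = mat_mul m AA (dagger EE) (mat_mul m AA U EE)"
    unfolding u_def induced_def by simp
  have code: "mat_app m LL EE ` vects m LL = code_space m (combine m r C)"
    using encoding_EE unfolding encoding_def Let_def by simp
  have UE: "mat_mul m AA U EE \<in> matrices m AA LL"
    using U(1) by (intro mat_mul_in_matrices [OF unitary_in_matrices EE_in_matrices])
  have uL: "u \<in> matrices m LL LL"
    unfolding u by (rule mat_mul_in_matrices [OF dagger_in_matrices [OF EE_in_matrices] UE])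
  have EEu: "mat_mul m LL EE u = mat_mul m AA U EE"
  proof (rule matrix_eqI [OF finite_LL _ UE])
    show "mat_mul m LL EE u \<in> matrices m AA LL"
      by (rule mat_mul_in_matrices [OF EE_in_matrices uL])
    fix w :: "(nat \<times> 'l) vect" assume "w \<in> vects m LL"
    then have "mat_app m AA U (mat_app m LL EE w) \<in> code_space m (combine m r C)"
      using U(2) code by blast
    then have "mat_app m AA (mat_mul m LL EE (dagger EE)) (mat_app m AA U (mat_app m LL EE w)) =
        mat_app m AA U (mat_app m LL EE w)"
      by (rule EE_dagger_fixes_code)
    then show "mat_app m LL (mat_mul m LL EE u) w = mat_app m LL (mat_mul m AA U EE) w"
      by (simp add: u mat_app_mul)
  qed
  then show "implements U u"
    unfolding implements_def by (intro exI [of _ 1]) simp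
  have "mat_mul m LL (dagger u) u = mat_mul m AA (dagger (mat_mul m LL EE u)) (mat_mul m LL EE u)"
  proof -
    have "mat_mul m AA (dagger EE) (mat_mul m LL EE u) = u"
      using uL by (simp add: EE_isometry flip: mat_mul_assoc)
    then show ?thesis unfolding dagger_mul mat_mul_assoc by simp
  qed
  also have "\<dots> = ident m LL"
    unfolding EEu dagger_mul mat_mul_assoc
    using unitary_dagger_mul_cancel [OF finite_AA U(1) EE_in_matrices] EE_isometry by simp
  finally show "unitary_op m LL u"
    by (rule isometry_unitary [OF finite_LL uL])
qed

end

section \<open>Descent in the Clifford hierarchy\<close>

locale transversal_setting = codeblocks m r C for m r and C :: "nat \<Rightarrow> ('q, 'l) stab_code" +
  fixes QB :: "nat \<Rightarrow> 'q set set" and Q :: "(nat \<times> 'q) set set"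
  assumes QB: "\<And>b. b < r \<Longrightarrow> partition_on (A b) (QB b)"
    and detecting: "\<And>b. b < r \<Longrightarrow> error_detecting m (C b) (QB b)"
    and Q: "partition_on AA Q"
    and Q_blocks: "\<And>R. R \<in> Q \<Longrightarrow> \<exists>B q. B \<subseteq> {..<r} \<and> (\<forall>b\<in>B. q b \<in> QB b) \<and> R = Sigma B q"
begin

text \<open>Triviality is recorded on the tensor factors themselves, not through
  \<open>acts_as_scalar\<close>, so that commutators can be formed factor by factor.\<close>

definition product_trivial_on :: "(nat \<times> 'q) set set \<Rightarrow> (nat \<times> 'q) operator \<Rightarrow> bool" where
  "product_trivial_on F U \<longleftrightarrow> (\<exists>V. (\<forall>R\<in>Q. unitary_op m R (V R)) \<and> U = tensor m AA Q V \<and>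
     (\<forall>R\<in>F. \<exists>c. V R = mat_scale c (ident m R)))"

lemma finite_Q: "finite Q"
  by (rule finite_elements [OF finite_AA Q])

lemma finite_R:
  assumes "R \<in> Q" shows "finite R"
proof (rule finite_subset [OF _ finite_AA])
  show "R \<subseteq> AA" using assms Q by (auto simp: partition_on_def)
qed

lemma product_trivial_on_unitary:
  assumes "product_trivial_on F U"
  shows "unitary_op m AA U"
proof -
  obtain V where V: "\<And>R. R \<in> Q \<Longrightarrow> unitary_op m R (V R)" "U = tensor m AA Q V"
    using assms unfolding product_trivial_on_def by blast
  have "mat_mul m AA (dagger U) U = tensor m AA Q (ident m)"
    unfolding V(2) tensor_dagger tensor_mul [OF finite_AA Q] using V(1) by (intro tensor_cong) auto
  then show ?thesis
    using tensor_ident [OF finite_AA Q] V(2) by (intro isometry_unitary) auto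
qed

text \<open>On each part the commutator is that of the factors, and a commutator with a scalar is a
  scalar. So the trivial parts of both operands are inherited.\<close>

lemma product_trivial_on_commutator:
  assumes "product_trivial_on F U" "product_trivial_on G P" "F \<subseteq> Q" "G \<subseteq> Q"
  shows "product_trivial_on (F \<union> G) (commutator m AA U P)"
proof -
  obtain V where V: "\<And>R. R \<in> Q \<Longrightarrow> unitary_op m R (V R)" "U = tensor m AA Q V"
    "\<And>R. R \<in> F \<Longrightarrow> \<exists>c. V R = mat_scale c (ident m R)"
    using assms unfolding product_trivial_on_def by blast
  obtain W where W: "\<And>R. R \<in> Q \<Longrightarrow> unitary_op m R (W R)" "P = tensor m AA Q W"
    "\<And>R. R \<in> G \<Longrightarrow> \<exists>c. W R = mat_scale c (ident m R)"
    using assms unfolding product_trivial_on_def by blast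
  have "commutator m AA U P = tensor m AA Q (\<lambda>R. commutator m R (V R) (W R))"
    unfolding commutator_def V(2) W(2) tensor_dagger tensor_mul [OF finite_AA Q] ..
  moreover have "unitary_op m R (commutator m R (V R) (W R))" if "R \<in> Q" for R
    using that V(1) W(1) finite_R by (intro unitary_commutator)
  moreover have "\<exists>c. commutator m R (V R) (W R) = mat_scale c (ident m R)" if "R \<in> F \<union> G" for R
  proof -
    have R: "R \<in> Q" "finite R" using that assms(3,4) finite_R by auto
    have VW: "unitary_op m R (V R)" "unitary_op m R (W R)" using V(1) W(1) R by auto
    from that show ?thesis
    proof
      assume "R \<in> F"
      then obtain c where "V R = mat_scale c (ident m R)" using V(3) by blast
      then show ?thesis
        using R(2) VW(2) by (auto simp: commutator_def dagger_scale)
    next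
      assume "R \<in> G"
      then obtain c where "W R = mat_scale c (ident m R)" using W(3) by blast
      then show ?thesis
        using R(2) VW(1) by (auto simp: commutator_def dagger_scale)
    qed
  qed
  ultimately show ?thesis
    unfolding product_trivial_on_def
    by (intro exI [of _ "\<lambda>R. commutator m R (V R) (W R)"]) simp
qed

lemma product_trivial_on_all:
  assumes "product_trivial_on Q U"
  shows "\<exists>c. U = mat_scale c (ident m AA)"
proof -
  obtain V c where V: "U = tensor m AA Q V" "\<And>R. R \<in> Q \<Longrightarrow> V R = mat_scale (c R) (ident m R)"
    using assms unfolding product_trivial_on_def by metis
  then have "U = tensor m AA Q (\<lambda>R. mat_scale (c R) (ident m R))"
    by (auto intro: tensor_cong)
  then show ?thesis
    unfolding tensor_scale tensor_ident [OF finite_AA Q] by blast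
qed

section \<open>Cleaned representatives of logical Paulis\<close>

lemma weyl_product_trivial_on:
  assumes "\<And>z. z \<in> R \<Longrightarrow> m dvd f z \<and> m dvd g z" "R \<in> Q"
  shows "product_trivial_on {R} (weyl m AA f g)"
  unfolding product_trivial_on_def
proof (intro exI conjI ballI)
  show "weyl m AA f g = tensor m AA Q (\<lambda>R. weyl m R f g)"
    by (rule tensor_weyl [OF finite_AA Q])
  show "unitary_op m R' (weyl m R' f g)" if "R' \<in> Q" for R'
    using finite_R [OF that] by simp
  show "weyl m R' f g = mat_scale 1 (ident m R')" if "R' \<in> {R}" for R'
    using that assms finite_R by (simp add: weyl_trivial)
qed

lemma product_trivial_on_ident: "R \<in> Q \<Longrightarrow> product_trivial_on {R} (ident m AA)"
  using weyl_product_trivial_on [of R "\<lambda>_. 0" "\<lambda>_. 0"] by (simp add: weyl_0)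

lemma product_trivial_on_mul:
  assumes "product_trivial_on {R} U" "product_trivial_on {R} P" "R \<in> Q"
  shows "product_trivial_on {R} (mat_mul m AA U P)"
proof -
  obtain V c where V: "\<And>R. R \<in> Q \<Longrightarrow> unitary_op m R (V R)" "U = tensor m AA Q V"
    "V R = mat_scale c (ident m R)"
    using assms unfolding product_trivial_on_def by blast
  obtain W d where W: "\<And>R. R \<in> Q \<Longrightarrow> unitary_op m R (W R)" "P = tensor m AA Q W"
    "W R = mat_scale d (ident m R)"
    using assms unfolding product_trivial_on_def by blast
  have "mat_mul m R (V R) (W R) = mat_scale (c * d) (ident m R)"
    using V(3) W(3) finite_R [OF assms(3)] by (simp add: mult.commute)
  moreover have "mat_mul m AA U P = tensor m AA Q (\<lambda>R. mat_mul m R (V R) (W R))"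
    unfolding V(2) W(2) by (rule tensor_mul [OF finite_AA Q])
  moreover have "\<forall>R\<in>Q. unitary_op m R (mat_mul m R (V R) (W R))"
    using V(1) W(1) finite_R by auto
  ultimately show ?thesis
    unfolding product_trivial_on_def by (intro exI [of _ "\<lambda>R. mat_mul m R (V R) (W R)"]) auto
qed

lemma product_trivial_on_dagger:
  assumes "product_trivial_on {R} U"
  shows "product_trivial_on {R} (dagger U)"
proof -
  obtain V c where V: "\<And>R. R \<in> Q \<Longrightarrow> unitary_op m R (V R)" "U = tensor m AA Q V"
    "V R = mat_scale c (ident m R)"
    using assms unfolding product_trivial_on_def by blast
  have "dagger (V R) = mat_scale (cnj c) (ident m R)"
    using V(3) by (simp add: dagger_scale)
  moreover have "dagger U = tensor m AA Q (\<lambda>R. dagger (V R))"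
    unfolding V(2) by (rule tensor_dagger)
  moreover have "\<forall>R\<in>Q. unitary_op m R (dagger (V R))"
    using V(1) by auto
  ultimately show ?thesis
    unfolding product_trivial_on_def by (intro exI [of _ "\<lambda>R. dagger (V R)"]) auto
qed

text \<open>\<open>R\<close> contains at most one part of block \<open>b\<close>, so a single use of
  \<open>local_cleaning\<close> suffices; if it contains none, the generator is already trivial on
  \<open>R\<close>. The encoding absorbs the stabilizer factor, and the other blocks carry
  identities.\<close>

lemma cleaned_generator:
  assumes R: "R \<in> Q" and b: "b < r" "i \<in> L b"
    and h: "h = log_X (C b) i \<and> u = pauli_X m (L b) i \<or> h = log_Z (C b) i \<and> u = pauli_Z m (L b) i"
  shows "\<exists>P. product_trivial_on {R} P \<and> implements P (on_block L b u)"
proof -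
  interpret stab: stabilizer m "C b" by (rule stabilizer [OF b(1)])
  obtain B q where Bq: "B \<subseteq> {..<r}" "\<forall>b\<in>B. q b \<in> QB b" "R = Sigma B q"
    using Q_blocks [OF R] by blast
  have hL: "h \<in> {log_X (C b) i, log_Z (C b) i}" using h by auto
  obtain s c f g where s: "s \<in> S b" "cmod c = 1" "mat_mul m (A b) s h = mat_scale c (weyl m (A b) f g)"
    and triv: "\<And>z. (b, z) \<in> R \<Longrightarrow> m dvd f z \<and> m dvd g z"
  proof (cases "b \<in> B")
    case True
    show thesis
      by (rule stab.local_cleaning [OF QB [OF b(1)] detecting [OF b(1)] _ b(2) hL, of "q b"])
        (use True Bq that in auto)
  next
    case False
    have "h \<in> paulis m (A b)" using hL b(2) by auto
    then obtain c f g where "cmod c = 1" "h = mat_scale c (weyl m (A b) f g)"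
      unfolding paulis_def by blast
    then show thesis
      using that [of "ident m (A b)" c f g] False Bq(3) stab.ident_S by auto
  qed
  obtain e where e: "cmod e = 1" "mat_mul m (A b) h (enc b) = mat_scale e (mat_mul m (L b) (enc b) u)"
    using h enc_X [OF b] enc_Z [OF b] by blast
  have "mat_mul m (A b) (weyl m (A b) f g) (enc b) = mat_scale (cnj c) (mat_mul m (A b) (mat_mul m (A b) s h) (enc b))"
    using s(2) by (simp add: s(3))
  also have "\<dots> = mat_scale (cnj c * e) (mat_mul m (L b) (enc b) u)"
    by (simp add: mat_mul_assoc e(2)) (simp add: enc(3) [OF b(1) s(1)] flip: mat_mul_assoc)
  finally have "mat_mul m AA (on_block A b (weyl m (A b) f g)) EE =
      mat_scale (cnj c * e) (mat_mul m LL EE (on_block L b u))"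
    by (rule on_block_EE [OF b(1)])
  moreover have "cmod (cnj c * e) = 1" using s(2) e(1) by (simp add: norm_mult)
  ultimately have "implements (on_block A b (weyl m (A b) f g)) (on_block L b u)"
    unfolding implements_def by blast
  moreover have "product_trivial_on {R} (on_block A b (weyl m (A b) f g))"
  proof -
    have "on_block A b (weyl m (A b) f g) =
        weyl m AA (\<lambda>(b', q). if b' = b then f q else 0) (\<lambda>(b', q). if b' = b then g q else 0)"
      by (rule on_block_weyl [OF finite_A])
    moreover have "product_trivial_on {R}
        (weyl m AA (\<lambda>(b', q). if b' = b then f q else 0) (\<lambda>(b', q). if b' = b then g q else 0))"
      by (rule weyl_product_trivial_on [OF _ R]) (use triv in auto)
    ultimately show ?thesis by simp
  qed
  ultimately show ?thesis by blast
qed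

text \<open>Triviality on \<open>R\<close> and the relation \<open>implements\<close> both pass to
  products and adjoints, so generators suffice.\<close>

lemma cleaned_pauli:
  assumes R: "R \<in> Q" and p: "p \<in> pauli_group m LL"
  shows "\<exists>P. product_trivial_on {R} P \<and> implements P p"
proof -
  have X: "\<exists>P. product_trivial_on {R} P \<and> implements P (pauli_X m LL j)" if "j \<in> LL" for j
    using that cleaned_generator [OF R] on_block_X by fastforce
  have Z: "\<exists>P. product_trivial_on {R} P \<and> implements P (pauli_Z m LL j)" if "j \<in> LL" for j
    using that cleaned_generator [OF R] on_block_Z by fastforce
  have gen: "\<exists>P. product_trivial_on {R} P \<and> implements P h"
    if "h \<in> pauli_X m LL ` LL \<union> pauli_Z m LL ` LL \<union>
      (if m = 2 then (\<lambda>q. mat_scale \<i> (mat_mul m LL (pauli_X m LL q) (pauli_Z m LL q))) ` LL else {})" for h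
  proof -
    have "\<exists>P. product_trivial_on {R} P \<and>
        implements P (mat_scale \<i> (mat_mul m LL (pauli_X m LL j) (pauli_Z m LL j)))" if j: "j \<in> LL" for j
    proof -
      obtain P where P: "product_trivial_on {R} P" "implements P (pauli_X m LL j)"
        using X [OF j] by blast
      obtain P' where P': "product_trivial_on {R} P'" "implements P' (pauli_Z m LL j)"
        using Z [OF j] by blast
      have "implements (mat_mul m AA P P') (mat_mul m LL (pauli_X m LL j) (pauli_Z m LL j))"
        using P P' by (intro implements_mul)
      then obtain c where c: "cmod c = 1" "mat_mul m AA (mat_mul m AA P P') EE =
          mat_scale c (mat_mul m LL EE (mat_mul m LL (pauli_X m LL j) (pauli_Z m LL j)))"
        unfolding implements_def by blast
      \<comment> \<open>The factor \<open>\<i>\<close> of \<open>Y\<close> is compensated in the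
        phase that \<open>implements\<close> allows.\<close>
      have "mat_mul m AA (mat_mul m AA P P') EE = mat_scale (c * - \<i>)
          (mat_mul m LL EE (mat_scale \<i> (mat_mul m LL (pauli_X m LL j) (pauli_Z m LL j))))"
        unfolding c(2) mul_scale_right mat_scale_scale by (simp add: mult.assoc)
      moreover have "cmod (c * - \<i>) = 1" using c(1) by (simp add: norm_mult)
      ultimately have "implements (mat_mul m AA P P')
          (mat_scale \<i> (mat_mul m LL (pauli_X m LL j) (pauli_Z m LL j)))"
        unfolding implements_def by blast
      then show ?thesis using product_trivial_on_mul [OF P(1) P'(1) R] by blast
    qed
    then show ?thesis using that X Z by (auto split: if_splits)
  qed
  from p show ?thesis
    unfolding pauli_group_def
  proof induction
    case one
    then show ?case
      using product_trivial_on_ident [OF R] implements_ident by auto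
  next
    case (incl h)
    then show ?case by (rule gen)
  next
    case (inv h)
    obtain P where P: "product_trivial_on {R} P" "implements P h"
      using gen [OF inv] by blast
    have h: "unitary_op m LL h"
      using inv pauli_generators [OF finite_LL m_ge_2] paulis_unitary [OF finite_LL m_pos] by blast
    have "implements (dagger P) (dagger h)"
      by (rule implements_dagger [OF P(2) product_trivial_on_unitary [OF P(1)] h])
    then show ?case
      using product_trivial_on_dagger [OF P(1)] h by auto
  next
    case (eng h1 h2)
    then obtain P1 P2 where "product_trivial_on {R} P1" "implements P1 h1"
      "product_trivial_on {R} P2" "implements P2 h2" by blast
    then show ?case
      using product_trivial_on_mul [OF _ _ R] implements_mul by (metis mult_unitary_group)
  qed
qed

text \<open>Induction on the number of parts not yet known to be trivial. One such part
  \<open>R\<close> is fixed before the Pauli \<open>p\<close>. As \<open>implements\<close>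
  determines the logical commutator up to phase, the representative of \<open>p\<close> that is
  trivial on \<open>R\<close> can be used physically, and it adds \<open>R\<close> to
  \<open>F\<close>. Levels start at 1, which accounts for the successor.\<close>

lemma clifford_descent:
  assumes "product_trivial_on F U" "F \<subseteq> Q" "implements U u" "unitary_op m LL u"
  shows "u \<in> clifford m LL (pauli_group m LL) (Suc (card (Q - F)))"
  using assms
proof (induction "card (Q - F)" arbitrary: F U u)
  case 0
  then have "F = Q" using finite_Q by auto
  then obtain c where c: "U = mat_scale c (ident m AA)"
    using product_trivial_on_all 0 by blast
  obtain d where d: "cmod d = 1" "mat_mul m AA U EE = mat_scale d (mat_mul m LL EE u)"
    using 0 unfolding implements_def by blast
  \<comment> \<open>\<open>U\<close> is a scalar here, and the isometry \<open>EE\<close> transfers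
    this to \<open>u\<close>.\<close>
  have "mat_scale c EE = mat_scale d (mat_mul m LL EE u)"
    using d(2) ident_mul [OF finite_AA EE_in_matrices] by (simp add: c)
  then have "mat_mul m AA (dagger EE) (mat_scale c EE) = mat_mul m AA (dagger EE) (mat_scale d (mat_mul m LL EE u))"
    by simp
  then have "mat_scale c (ident m LL) = mat_scale d u"
    using 0 by (simp add: EE_isometry flip: mat_mul_assoc)
  then have "mat_scale (cnj d) (mat_scale c (ident m LL)) = mat_scale (cnj d) (mat_scale d u)"
    by simp
  then have u: "u = mat_scale (cnj d * c) (ident m LL)"
    using d(1) by simp
  \<comment> \<open>So far \<open>c\<close> is only some complex number; unitarity of
    \<open>u\<close> shows that \<open>cnj d * c\<close> is a phase.\<close>
  have "mat_mul m LL u (dagger u) = mat_scale 1 (ident m LL)" using 0 by simp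
  then have "mat_scale ((cnj d * c) * cnj (cnj d * c)) (ident m LL) = mat_scale 1 (ident m LL)"
    unfolding u dagger_scale by (simp add: mult_ac)
  then have "(cnj d * c) * cnj (cnj d * c) = 1"
    using mat_scale_unitary_cancel [OF finite_LL m_pos unitary_ident [OF finite_LL]] by blast
  then have "cmod (cnj d * c) = 1"
    by (metis abs_norm_cancel complex_mod_mult_cnj norm_one power2_eq_1_iff real_sqrt_abs real_sqrt_one)
  moreover have "ident m LL \<in> pauli_group m LL"
    unfolding pauli_group_def using generate.one [of "unitary_group m LL"] by simp
  ultimately show ?case
    unfolding \<open>0 = card (Q - F)\<close> [symmetric] clifford.simps(2) using u by blast
next
  case (Suc n)
  have "Q - F \<noteq> {}" using Suc.hyps(2) by (metis card.empty nat.distinct(1))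
  then obtain R where R: "R \<in> Q" "R \<notin> F" by blast
  have n: "n = card (Q - insert R F)"
    using Suc.hyps(2) R finite_Q by (metis Diff_insert DiffI card_Diff_singleton diff_Suc_1)
  have "commutator m LL u p \<in> clifford m LL (pauli_group m LL) (Suc n)" if p: "p \<in> pauli_group m LL" for p
  proof -
    obtain P where P: "product_trivial_on {R} P" "implements P p"
      using cleaned_pauli [OF R(1) p] by blast
    have pu: "unitary_op m LL p"
      using p pauli_group_subset_paulis [OF finite_LL m_ge_2] paulis_unitary [OF finite_LL m_pos] by blast
    have "product_trivial_on (F \<union> {R}) (commutator m AA U P)"
      using Suc.prems P R by (intro product_trivial_on_commutator) auto
    then have "product_trivial_on (insert R F) (commutator m AA U P)" by simp
    moreover have "implements (commutator m AA U P) (commutator m LL u p)"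
      using Suc.prems P pu product_trivial_on_unitary by (intro implements_commutator) auto
    moreover have "unitary_op m LL (commutator m LL u p)"
      using Suc.prems(4) pu by (intro unitary_commutator) auto
    ultimately show ?thesis
      using Suc.hyps(1) [OF n, of "commutator m AA U P"] R Suc.prems(2) n by simp
  qed
  then show ?case
    unfolding Suc.hyps(2) [symmetric] clifford.simps(3) using Suc.prems(4) by blast
qed

end

theorem corollary6:
  fixes m r :: nat
    and C :: "nat \<Rightarrow> ('q, 'l) stab_code"
    and QB :: "nat \<Rightarrow> 'q set set"
    and Q :: "(nat \<times> 'q) set set"
    and U :: "(nat \<times> 'q) operator"
  assumes "m \<ge> 2" and "r \<ge> 1"
    and "\<And>b. b < r \<Longrightarrow> stabilizer_code m (C b)"
    and "\<And>b. b < r \<Longrightarrow> partition_on (qudits (C b)) (QB b)"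
    and "\<And>b. b < r \<Longrightarrow> error_detecting m (C b) (QB b)"
    and "partition_on (qudits (combine m r C)) Q"
    and "\<And>R. R \<in> Q \<Longrightarrow> \<exists>B q. B \<subseteq> {..<r} \<and> (\<forall>b\<in>B. q b \<in> QB b) \<and> R = Sigma B q"
    and "logical_operator m (combine m r C) U"
    and "transversal m (qudits (combine m r C)) Q U"
  shows "\<exists>M\<ge>1. U \<in> logical_clifford m (combine m r C) M"
proof -
  interpret codeblocks m r C
    by unfold_locales (fact assms(1,3))+
  interpret transversal_setting m r C QB Q
    by unfold_locales (use assms in simp_all)
  let ?u = "induced m (combine m r C) EE U"
  \<comment> \<open>The descent starts with no part known to be trivial, so the level reached is the
    number of parts plus one.\<close>
  have "product_trivial_on {} U"
    using assms(9) unfolding product_trivial_on_def transversal_def by auto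
  then have "?u \<in> clifford m LL (pauli_group m LL) (Suc (card (Q - {})))"
    using implements_induced [OF assms(8)] by (intro clifford_descent) auto
  then have "U \<in> logical_clifford m (combine m r C) (Suc (card Q))"
    using assms(8) encoding_EE unfolding logical_clifford_def by auto
  then show ?thesis by (intro exI [of _ "Suc (card Q)"]) simp
qed

end
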